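(* Let $\mathbf{OpPerLCCon}$ be the category of all connected locally compact Hausdorff spaces and all open perfect maps between them, and let $\mathbf{DOpPerLCCon}$ be the category whose objects are all connected complete local contact algebras and whose morphisms $\varphi:(A,\rho,\mathbb{B})\to(B,\eta,\mathbb{B}')$ are all complete Boolean homomorphisms $\varphi:A\to B$ satisfying (L1) for all $a,b\in A$, $\varphi(a)\,\eta\,\varphi(b)$ implies $a\,\rho\,b$; (L2) $b\in\mathbb{B}'$ implies $\varphi_\Lambda(b)\in\mathbb{B}$; (L3) $a\in\mathbb{B}$ implies $\varphi(a)\in\mathbb{B}'$; and (LO) for all $a\in A$ and all $b\in\mathbb{B}'$, $\varphi_\Lambda(b)\,\rho\,a$ implies $b\,\eta\,\varphi(a)$. Then $\mathbf{OpPerLCCon}$ and $\mathbf{DOpPerLCCon}$ are dually equivalent. In particular, the category $\mathbf{OpCCon}$ of all connected compact Hausdorff spaces and all open maps between them is dually equivalent to the category $\mathbf{DOpCCon}$ whose objects are all connected complete normal contact algebras and whose morphisms $\varphi:(A,C)\to(B,C')$ are all complete Boolean homomorphisms $\varphi:A\to B$ satisfying (F1) for all $a,b\in A$, $\varphi(a)\,C'\,\varphi(b)$ implies $a\,C\,b$; and (CO) for all $a\in A$ and all $b\in B$, $a\,C\,\varphi_\Lambda(b)$ implies $\varphi(a)\,C'\,b$.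
   Context: Open maps are assumed to be continuous. A map is perfect if it is continuous, closed, and all its point inverses are compact. Maps are not assumed to be onto. A space is connected if it is not the union of two disjoint non-empty open subsets (so the empty space counts as connected). A contact algebra $(B,C)$ is a Boolean algebra $B=(B,0,1,\vee,\wedge,{}^* )$ ($0=1$ is allowed; $^*$ is complement) with a binary relation $C$ on $B$ such that: (C1) $a\neq 0$ implies $aCa$; (C2) $aCb$ implies $a\ne 0$ and $b\neq 0$; (C3) $aCb$ implies $bCa$; (C4) $aC(b\vee c)$ iff $aCb$ or $aCc$. Write $a(-C)b$ for "not $aCb$", and $a\ll_C b$ iff $a(-C)b^*$. A contact algebra is connected if $aCa^*$ for every $a\neq 0,1$. It is a normal contact algebra if: (C5) if $a(-C)b$ then $a(-C)c$ and $b(-C)c^*$ for some $c\in B$; (C6) if $a\neq 1$ then there exists $b\neq 0$ with $b(-C)a$. A local contact algebra $(B,\rho,\mathbb{B})$ consists of a contact algebra $(B,\rho)$ and an ideal $\mathbb{B}$ of $B$ (possibly non-proper) such that: (BC1) if $a\in\mathbb{B}$, $c\in B$ and $a\ll_\rho c$ then $a\ll_\rho b\ll_\rho c$ for some $b\in\mathbb{B}$; (BC2) if $a\rho b$ then there is $c\in\mathbb{B}$ with $a\rho(c\wedge b)$; (BC3) if $a\ne 0$ then there is $b\in\mathbb{B}\setminus\{0\}$ with $b\ll_\rho a$. It is connected if the contact algebra $(B,\rho)$ is connected. "Complete" (for normal or local contact algebras) means that $B$ is a complete Boolean algebra. A complete Boolean homomorphism is one preserving all joins and meets. For such $\varphi:A\to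 B$, $\varphi_\Lambda:B\to A$ denotes its left adjoint: $b\le\varphi(a)$ iff $\varphi_\Lambda(b)\le a$. Composition of morphisms is composition of functions. Two categories are dually equivalent if one is equivalent to the opposite of the other. *)

theory Defs
  imports "HOL-Analysis.Analysis" "HOL-Algebra.Complete_Lattice"
begin

unbundle cardinal_syntax


section \<open>Categories, functors, equivalence\<close>

text \<open>
  Hom-sets need not be disjoint, so composition \<open>cmp\<close> also takes the three objects:
  \<open>cmp C X Y Z g f\<close> is the composite of \<open>f : X \<rightarrow> Y\<close> and \<open>g : Y \<rightarrow> Z\<close>.
\<close>

record ('o, 'm) category_data =
  obj :: "'o set"
  hom_set :: "'o \<Rightarrow> 'o \<Rightarrow> 'm set"
  idm :: "'o \<Rightarrow> 'm"
  cmp :: "'o \<Rightarrow> 'o \<Rightarrow> 'o \<Rightarrow> 'm \<Rightarrow> 'm \<Rightarrow> 'm"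

definition is_category :: "('o, 'm) category_data \<Rightarrow> bool" where
  "is_category C \<longleftrightarrow>
     (\<forall>X\<in>obj C. idm C X \<in> hom_set C X X) \<and>
     (\<forall>X\<in>obj C. \<forall>Y\<in>obj C. \<forall>Z\<in>obj C. \<forall>f\<in>hom_set C X Y. \<forall>g\<in>hom_set C Y Z.
        cmp C X Y Z g f \<in> hom_set C X Z) \<and>
     (\<forall>X\<in>obj C. \<forall>Y\<in>obj C. \<forall>f\<in>hom_set C X Y.
        cmp C X X Y f (idm C X) = f \<and> cmp C X Y Y (idm C Y) f = f) \<and>
     (\<forall>W\<in>obj C. \<forall>X\<in>obj C. \<forall>Y\<in>obj C. \<forall>Z\<in>obj C.
        \<forall>f\<in>hom_set C W X. \<forall>g\<in>hom_set C X Y. \<forall>h\<in>hom_set C Y Z.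
        cmp C W X Z (cmp C X Y Z h g) f = cmp C W Y Z h (cmp C W X Y g f))"

definition opposite :: "('o, 'm) category_data \<Rightarrow> ('o, 'm) category_data" where
  "opposite C =
     \<lparr>obj = obj C,
      hom_set = (\<lambda>X Y. hom_set C Y X),
      idm = idm C,
      cmp = (\<lambda>X Y Z g f. cmp C Z Y X f g)\<rparr>"

record ('o, 'm, 'p, 'n) functor_data =
  fobj :: "'o \<Rightarrow> 'p"
  fmap :: "'o \<Rightarrow> 'o \<Rightarrow> 'm \<Rightarrow> 'n"

definition is_functor ::
  "('o, 'm) category_data \<Rightarrow> ('p, 'n) category_data \<Rightarrow> ('o, 'm, 'p, 'n) functor_data \<Rightarrow> bool" where
  "is_functor C D F \<longleftrightarrow>
     (\<forall>X\<in>obj C. fobj F X \<in> obj D) \<and>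
     (\<forall>X\<in>obj C. \<forall>Y\<in>obj C. \<forall>f\<in>hom_set C X Y.
        fmap F X Y f \<in> hom_set D (fobj F X) (fobj F Y)) \<and>
     (\<forall>X\<in>obj C. fmap F X X (idm C X) = idm D (fobj F X)) \<and>
     (\<forall>X\<in>obj C. \<forall>Y\<in>obj C. \<forall>Z\<in>obj C. \<forall>f\<in>hom_set C X Y. \<forall>g\<in>hom_set C Y Z.
        fmap F X Z (cmp C X Y Z g f) =
        cmp D (fobj F X) (fobj F Y) (fobj F Z) (fmap F Y Z g) (fmap F X Y f))"

definition id_functor :: "('o, 'm, 'o, 'm) functor_data" where
  "id_functor = \<lparr>fobj = (\<lambda>X. X), fmap = (\<lambda>X Y f. f)\<rparr>"

definition comp_functor ::
  "('p, 'n, 'q, 'k) functor_data \<Rightarrow> ('o, 'm, 'p, 'n) functor_data \<Rightarrow> ('o, 'm, 'q, 'k) functor_data" where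
  "comp_functor G F =
     \<lparr>fobj = (\<lambda>X. fobj G (fobj F X)),
      fmap = (\<lambda>X Y f. fmap G (fobj F X) (fobj F Y) (fmap F X Y f))\<rparr>"

definition is_iso :: "('o, 'm) category_data \<Rightarrow> 'o \<Rightarrow> 'o \<Rightarrow> 'm \<Rightarrow> bool" where
  "is_iso C X Y f \<longleftrightarrow>
     f \<in> hom_set C X Y \<and>
     (\<exists>g\<in>hom_set C Y X. cmp C X Y X g f = idm C X \<and> cmp C Y X Y f g = idm C Y)"

definition is_nat_iso ::
  "('o, 'm) category_data \<Rightarrow> ('p, 'n) category_data \<Rightarrow>
   ('o, 'm, 'p, 'n) functor_data \<Rightarrow> ('o, 'm, 'p, 'n) functor_data \<Rightarrow> ('o \<Rightarrow> 'n) \<Rightarrow> bool" where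
  "is_nat_iso C D F G \<eta> \<longleftrightarrow>
     (\<forall>X\<in>obj C. is_iso D (fobj F X) (fobj G X) (\<eta> X)) \<and>
     (\<forall>X\<in>obj C. \<forall>Y\<in>obj C. \<forall>f\<in>hom_set C X Y.
        cmp D (fobj F X) (fobj F Y) (fobj G Y) (\<eta> Y) (fmap F X Y f) =
        cmp D (fobj F X) (fobj G X) (fobj G Y) (fmap G X Y f) (\<eta> X))"

definition equivalent_categories ::
  "('o, 'm) category_data \<Rightarrow> ('p, 'n) category_data \<Rightarrow> bool" where
  "equivalent_categories C D \<longleftrightarrow>
     is_category C \<and> is_category D \<and>
     (\<exists>F G \<eta> \<epsilon>. is_functor C D F \<and> is_functor D C G \<and>
        is_nat_iso C C id_functor (comp_functor G F) \<eta> \<and>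
        is_nat_iso D D (comp_functor F G) id_functor \<epsilon>)"

definition dually_equivalent ::
  "('o, 'm) category_data \<Rightarrow> ('p, 'n) category_data \<Rightarrow> bool" where
  "dually_equivalent C D \<longleftrightarrow> equivalent_categories C (opposite D)"


section \<open>Boolean algebras\<close>

locale boolean_lattice = bounded_lattice B for B (structure) +
  assumes meet_join_distrib:
    "\<lbrakk>x \<in> carrier B; y \<in> carrier B; z \<in> carrier B\<rbrakk> \<Longrightarrow> x \<sqinter> (y \<squnion> z) = (x \<sqinter> y) \<squnion> (x \<sqinter> z)"
    and complemented:
    "x \<in> carrier B \<Longrightarrow> \<exists>y\<in>carrier B. x \<sqinter> y = \<bottom> \<and> x \<squnion> y = \<top>"

definition bcompl :: "('a, 'b) gorder_scheme \<Rightarrow> 'a \<Rightarrow> 'a" where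
  "bcompl B x = (THE y. y \<in> carrier B \<and> x \<sqinter>\<^bsub>B\<^esub> y = \<bottom>\<^bsub>B\<^esub> \<and> x \<squnion>\<^bsub>B\<^esub> y = \<top>\<^bsub>B\<^esub>)"

definition boolean_ideal :: "('a, 'b) gorder_scheme \<Rightarrow> 'a set \<Rightarrow> bool" where
  "boolean_ideal B I \<longleftrightarrow>
     I \<subseteq> carrier B \<and> \<bottom>\<^bsub>B\<^esub> \<in> I \<and>
     (\<forall>a\<in>I. \<forall>b\<in>carrier B. b \<sqsubseteq>\<^bsub>B\<^esub> a \<longrightarrow> b \<in> I) \<and>
     (\<forall>a\<in>I. \<forall>b\<in>I. a \<squnion>\<^bsub>B\<^esub> b \<in> I)"

definition boolean_hom ::
  "('a, 'c) gorder_scheme \<Rightarrow> ('b, 'd) gorder_scheme \<Rightarrow> ('a \<Rightarrow> 'b) \<Rightarrow> bool" where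
  "boolean_hom A B \<phi> \<longleftrightarrow>
     \<phi> \<in> carrier A \<rightarrow> carrier B \<and>
     \<phi> \<bottom>\<^bsub>A\<^esub> = \<bottom>\<^bsub>B\<^esub> \<and> \<phi> \<top>\<^bsub>A\<^esub> = \<top>\<^bsub>B\<^esub> \<and>
     (\<forall>x\<in>carrier A. \<phi> (bcompl A x) = bcompl B (\<phi> x)) \<and>
     (\<forall>x\<in>carrier A. \<forall>y\<in>carrier A.
        \<phi> (x \<squnion>\<^bsub>A\<^esub> y) = \<phi> x \<squnion>\<^bsub>B\<^esub> \<phi> y \<and> \<phi> (x \<sqinter>\<^bsub>A\<^esub> y) = \<phi> x \<sqinter>\<^bsub>B\<^esub> \<phi> y)"

definition complete_boolean_hom ::
  "('a, 'c) gorder_scheme \<Rightarrow> ('b, 'd) gorder_scheme \<Rightarrow> ('a \<Rightarrow> 'b) \<Rightarrow> bool" where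
  "complete_boolean_hom A B \<phi> \<longleftrightarrow>
     boolean_hom A B \<phi> \<and>
     (\<forall>S\<subseteq>carrier A. \<phi> (\<Squnion>\<^bsub>A\<^esub>S) = \<Squnion>\<^bsub>B\<^esub>(\<phi> ` S) \<and> \<phi> (\<Sqinter>\<^bsub>A\<^esub>S) = \<Sqinter>\<^bsub>B\<^esub>(\<phi> ` S))"

definition left_adjoint ::
  "('a, 'c) gorder_scheme \<Rightarrow> ('b, 'd) gorder_scheme \<Rightarrow> ('a \<Rightarrow> 'b) \<Rightarrow> 'b \<Rightarrow> 'a" where
  "left_adjoint A B \<phi> b =
     (THE c. c \<in> carrier A \<and> (\<forall>a\<in>carrier A. b \<sqsubseteq>\<^bsub>B\<^esub> \<phi> a \<longleftrightarrow> c \<sqsubseteq>\<^bsub>A\<^esub> a))"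


section \<open>Contact algebras\<close>

record 'a contact_struct = "'a gorder" +
  contact :: "'a \<Rightarrow> 'a \<Rightarrow> bool"

record 'a local_contact_struct = "'a contact_struct" +
  bdd :: "'a set"

definition well_inside :: "('a, 'b) contact_struct_scheme \<Rightarrow> 'a \<Rightarrow> 'a \<Rightarrow> bool" where
  "well_inside B a b \<longleftrightarrow> \<not> contact B a (bcompl B b)"

locale contact_algebra = boolean_lattice B
  for B :: "('a, 'b) contact_struct_scheme" (structure) +
  assumes C1: "\<lbrakk>a \<in> carrier B; a \<noteq> \<bottom>\<rbrakk> \<Longrightarrow> contact B a a"
    and C2: "\<lbrakk>a \<in> carrier B; b \<in> carrier B; contact B a b\<rbrakk> \<Longrightarrow> a \<noteq> \<bottom> \<and> b \<noteq> \<bottom>"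
    and C3: "\<lbrakk>a \<in> carrier B; b \<in> carrier B; contact B a b\<rbrakk> \<Longrightarrow> contact B b a"
    and C4: "\<lbrakk>a \<in> carrier B; b \<in> carrier B; c \<in> carrier B\<rbrakk> \<Longrightarrow>
               contact B a (b \<squnion> c) \<longleftrightarrow> contact B a b \<or> contact B a c"

definition connected_contact :: "('a, 'b) contact_struct_scheme \<Rightarrow> bool" where
  "connected_contact B \<longleftrightarrow>
     (\<forall>a\<in>carrier B. a \<noteq> \<bottom>\<^bsub>B\<^esub> \<and> a \<noteq> \<top>\<^bsub>B\<^esub> \<longrightarrow> contact B a (bcompl B a))"

locale normal_contact_algebra = contact_algebra B
  for B :: "('a, 'b) contact_struct_scheme" (structure) +
  assumes C5: "\<lbrakk>a \<in> carrier B; b \<in> carrier B; \<not> contact B a b\<rbrakk> \<Longrightarrow>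
                 \<exists>c\<in>carrier B. \<not> contact B a c \<and> \<not> contact B b (bcompl B c)"
    and C6: "\<lbrakk>a \<in> carrier B; a \<noteq> \<top>\<rbrakk> \<Longrightarrow> \<exists>b\<in>carrier B. b \<noteq> \<bottom> \<and> \<not> contact B b a"

locale local_contact_algebra = contact_algebra B
  for B :: "('a, 'b) local_contact_struct_scheme" (structure) +
  assumes bdd_ideal: "boolean_ideal B (bdd B)"
    and BC1: "\<lbrakk>a \<in> bdd B; c \<in> carrier B; well_inside B a c\<rbrakk> \<Longrightarrow>
                \<exists>b\<in>bdd B. well_inside B a b \<and> well_inside B b c"
    and BC2: "\<lbrakk>a \<in> carrier B; b \<in> carrier B; contact B a b\<rbrakk> \<Longrightarrow>
                \<exists>c\<in>bdd B. contact B a (c \<sqinter> b)"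
    and BC3: "\<lbrakk>a \<in> carrier B; a \<noteq> \<bottom>\<rbrakk> \<Longrightarrow> \<exists>b\<in>bdd B - {\<bottom>}. well_inside B b a"


section \<open>The four categories\<close>

text \<open>
  HOL has no type of all sets, so points and algebra elements are taken from a type \<open>'u\<close>, and the
  objects are bounded in size by a cardinal \<open>\<kappa>\<close> on \<open>'u\<close>. An algebra is admitted if its carrier
  has fewer than \<open>\<kappa>\<close> elements, a space if it has fewer than \<open>\<kappa>\<close> regular closed sets; this
  is the same bound on both sides, as the regular closed sets of a space are the elements of its
  dual algebra. The only requirement on \<open>'u\<close> is that it has room for the power set of every set of
  fewer than \<open>\<kappa>\<close> elements. The lemmas \<open>size_bound_universe\<close>, \<open>small_space_iff\<close>,
  \<open>size_bound_successor\<close> and \<open>space_below_successor\<close> below show what this covers.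

  Morphisms are extensional functions (\<open>undefined\<close> off the underlying set of the
  domain), so that they are equal iff they agree on that set.
\<close>

definition size_bound :: "'u rel \<Rightarrow> bool" where
  "size_bound \<kappa> \<longleftrightarrow>
     Card_order \<kappa> \<and> (\<forall>S :: 'u set. |S| <o \<kappa> \<longrightarrow> |Pow S| \<le>o |UNIV :: 'u set| )"

definition regular_closed_sets :: "'a topology \<Rightarrow> 'a set set" where
  "regular_closed_sets X =
     {F. F \<subseteq> topspace X \<and> X closure_of (X interior_of F) = F}"

definition OpPerLCCon :: "'u rel \<Rightarrow> ('u topology, 'u \<Rightarrow> 'u) category_data" where
  "OpPerLCCon \<kappa> =
     \<lparr>obj = {X. connected_space X \<and> locally_compact_space X \<and> Hausdorff_space X \<and>
                |regular_closed_sets X| <o \<kappa>},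
      hom_set = (\<lambda>X Y. {f \<in> extensional (topspace X).
                        continuous_map X Y f \<and> open_map X Y f \<and> proper_map X Y f}),
      idm = (\<lambda>X. \<lambda>x\<in>topspace X. x),
      cmp = (\<lambda>X Y Z g f. compose (topspace X) g f)\<rparr>"

definition OpCCon :: "'u rel \<Rightarrow> ('u topology, 'u \<Rightarrow> 'u) category_data" where
  "OpCCon \<kappa> =
     \<lparr>obj = {X. connected_space X \<and> compact_space X \<and> Hausdorff_space X \<and>
                |regular_closed_sets X| <o \<kappa>},
      hom_set = (\<lambda>X Y. {f \<in> extensional (topspace X). continuous_map X Y f \<and> open_map X Y f}),
      idm = (\<lambda>X. \<lambda>x\<in>topspace X. x),
      cmp = (\<lambda>X Y Z g f. compose (topspace X) g f)\<rparr>"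

definition DOpPerLCCon :: "'u rel \<Rightarrow> ('u local_contact_struct, 'u \<Rightarrow> 'u) category_data" where
  "DOpPerLCCon \<kappa> =
     \<lparr>obj = {A. local_contact_algebra A \<and> complete_lattice A \<and> connected_contact A \<and>
                |carrier A| <o \<kappa>},
      hom_set = (\<lambda>A B. {\<phi> \<in> extensional (carrier A).
        complete_boolean_hom A B \<phi> \<and>
        (\<forall>a\<in>carrier A. \<forall>b\<in>carrier A. contact B (\<phi> a) (\<phi> b) \<longrightarrow> contact A a b) \<and>
        (\<forall>b\<in>bdd B. left_adjoint A B \<phi> b \<in> bdd A) \<and>
        (\<forall>a\<in>bdd A. \<phi> a \<in> bdd B) \<and>
        (\<forall>a\<in>carrier A. \<forall>b\<in>bdd B.
           contact A (left_adjoint A B \<phi> b) a \<longrightarrow> contact B b (\<phi> a))}),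
      idm = (\<lambda>A. \<lambda>x\<in>carrier A. x),
      cmp = (\<lambda>A B C \<psi> \<phi>. compose (carrier A) \<psi> \<phi>)\<rparr>"

definition DOpCCon :: "'u rel \<Rightarrow> ('u contact_struct, 'u \<Rightarrow> 'u) category_data" where
  "DOpCCon \<kappa> =
     \<lparr>obj = {A. normal_contact_algebra A \<and> complete_lattice A \<and> connected_contact A \<and>
                |carrier A| <o \<kappa>},
      hom_set = (\<lambda>A B. {\<phi> \<in> extensional (carrier A).
        complete_boolean_hom A B \<phi> \<and>
        (\<forall>a\<in>carrier A. \<forall>b\<in>carrier A. contact B (\<phi> a) (\<phi> b) \<longrightarrow> contact A a b) \<and>
        (\<forall>a\<in>carrier A. \<forall>b\<in>carrier B.
           contact A a (left_adjoint A B \<phi> b) \<longrightarrow> contact B (\<phi> a) b)}),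
      idm = (\<lambda>A. \<lambda>x\<in>carrier A. x),
      cmp = (\<lambda>A B C \<psi> \<phi>. compose (carrier A) \<psi> \<phi>)\<rparr>"


section \<open>Scope of the size bound\<close>

text \<open>
  If \<open>\<kappa>\<close> is a strong limit (for instance the size of a universe of sets), then \<open>\<kappa>\<close> is a
  size bound and the spaces admitted are exactly those with fewer than \<open>\<kappa>\<close> points.
\<close>

lemma size_bound_universe:
  fixes \<kappa> :: "'u rel"
  assumes "Card_order \<kappa>" and strong: "\<And>S :: 'u set. |S| <o \<kappa> \<Longrightarrow> |Pow S| <o \<kappa>"
  shows "size_bound \<kappa>"
proof -
  have "\<kappa> \<le>o |UNIV :: 'u set|"
    using assms(1) by (meson card_of_Field_ordIso card_of_mono1 ordIso_ordLeq_trans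
        ordIso_symmetric subset_UNIV)
  then show ?thesis
    unfolding size_bound_def using assms
    by (meson ordLess_imp_ordLeq ordLeq_transitive)
qed

lemma points_le_regular_closed:
  assumes "Hausdorff_space X"
  shows "|topspace X| \<le>o |Pow (regular_closed_sets X)|"
proof -
  define p where "p x = {F \<in> regular_closed_sets X. x \<in> F}" for x
  have rc: "X closure_of U \<in> regular_closed_sets X" if "openin X U" for U
  proof -
    have U: "U \<subseteq> X interior_of (X closure_of U)"
      using that by (meson closure_of_subset interior_of_maximal openin_subset)
    have "X closure_of (X interior_of (X closure_of U)) \<subseteq> X closure_of U"
      by (meson closedin_closure_of closure_of_minimal interior_of_subset)
    then show ?thesis
      using closure_of_mono[OF U]
      by (auto simp: regular_closed_sets_def closure_of_subset_topspace dest: subsetD)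
  qed
  have "inj_on p (topspace X)"
  proof (rule inj_onI, rule ccontr)
    fix x y assume xy: "x \<in> topspace X" "y \<in> topspace X" "p x = p y" "x \<noteq> y"
    then obtain U V where UV: "openin X U" "openin X V" "x \<in> U" "y \<in> V" "disjnt U V"
      using assms unfolding Hausdorff_space_def by meson
    have "x \<in> X closure_of U"
      using UV by (meson closure_of_subset openin_subset subsetD)
    moreover have "y \<notin> X closure_of U"
      using UV by (auto simp: in_closure_of disjnt_def)
    ultimately show False
      using rc[OF UV(1)] xy(3) unfolding p_def by blast
  qed
  moreover have "p ` topspace X \<subseteq> Pow (regular_closed_sets X)"
    unfolding p_def by blast
  ultimately show ?thesis
    using card_of_ordLeq by blast
qed

lemma small_space_iff:
  fixes \<kappa> :: "'u rel" and X :: "'u topology"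
  assumes "Card_order \<kappa>" and strong: "\<And>S :: 'u set. |S| <o \<kappa> \<Longrightarrow> |Pow S| <o \<kappa>"
    and "Hausdorff_space X"
  shows "|regular_closed_sets X| <o \<kappa> \<longleftrightarrow> |topspace X| <o \<kappa>"
proof
  assume R: "|regular_closed_sets X| <o \<kappa>"
  then have "|regular_closed_sets X| \<le>o |Field \<kappa>|"
    using assms(1) by (meson card_of_Field_ordIso ordIso_symmetric ordLeq_ordIso_trans
        ordLess_imp_ordLeq)
  then obtain h :: "'u set \<Rightarrow> 'u" where h: "inj_on h (regular_closed_sets X)"
    unfolding card_of_ordLeq[symmetric] by blast
  let ?S = "h ` regular_closed_sets X :: 'u set"
  have iso: "|?S| =o |regular_closed_sets X|"
    using h by (meson bij_betw_imageI card_of_ordIsoI ordIso_symmetric)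
  then have "|Pow ?S| <o \<kappa>"
    using R strong ordIso_ordLess_trans by blast
  moreover have "bij_betw (image h) (Pow (regular_closed_sets X)) (Pow ?S)"
    using h by (simp add: bij_betw_Pow bij_betw_imageI)
  then have "|Pow (regular_closed_sets X)| =o |Pow ?S|"
    using card_of_ordIsoI by blast
  ultimately show "|topspace X| <o \<kappa>"
    using points_le_regular_closed[OF assms(3)]
    by (meson ordIso_ordLess_trans ordLeq_ordLess_trans)
next
  assume "|topspace X| <o \<kappa>"
  moreover have "|regular_closed_sets X| \<le>o |Pow (topspace X)|"
    by (rule card_of_mono1) (auto simp: regular_closed_sets_def)
  ultimately show "|regular_closed_sets X| <o \<kappa>"
    using strong ordLeq_ordLess_trans by blast
qed

text \<open>
  Without any assumption on types: for every type \<open>'b\<close>, the successor cardinal of \<open>'b\<close> is a size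
  bound on \<open>'b set\<close>. It admits all algebras with at most as many elements as \<open>'b\<close>, and all spaces
  with at most that many regular closed sets, for which there is always room in \<open>'b set\<close>. Thus
  every space and every algebra of HOL is, up to isomorphism, covered.
\<close>

lemma size_bound_successor:
  "size_bound (cardSuc |UNIV :: 'b set| )"
  "|S| <o cardSuc |UNIV :: 'b set| \<longleftrightarrow> |S| \<le>o |UNIV :: 'b set|"
proof -
  show *: "|S| <o cardSuc |UNIV :: 'b set| \<longleftrightarrow> |S| \<le>o |UNIV :: 'b set|" for S :: "'c set"
    by (rule cardSuc_ordLeq_ordLess) (rule card_of_Card_order)+
  have "|Pow S| \<le>o |UNIV :: 'b set set|" if "|S| <o cardSuc |UNIV :: 'b set|" for S :: "'b set set"
  proof -
    have "|S| \<le>o |UNIV :: 'b set|"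
      using that * by blast
    then obtain h :: "'b set \<Rightarrow> 'b" where "inj_on h S"
      using card_of_ordLeq by metis
    then have "inj_on (image h) (Pow S)"
      by (simp add: inj_on_image_Pow)
    then show ?thesis
      using card_of_ordLeq by (metis subset_UNIV)
  qed
  then show "size_bound (cardSuc |UNIV :: 'b set| )"
    unfolding size_bound_def by (simp add: cardSuc_Card_order[OF card_of_Card_order])
qed

lemma space_below_successor:
  fixes X :: "'p topology"
  assumes "Hausdorff_space X"
    and R: "|regular_closed_sets X| \<le>o |UNIV :: 'b set|"
  shows "\<exists>Y :: 'b set topology. X homeomorphic_space Y"
proof -
  obtain h :: "'p set \<Rightarrow> 'b" where h: "inj_on h (regular_closed_sets X)"
    using R card_of_ordLeq by metis
  then have "inj_on (image h) (Pow (regular_closed_sets X))"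
    by (simp add: inj_on_image_Pow)
  moreover obtain q where "inj_on q (topspace X)" "q ` topspace X \<subseteq> Pow (regular_closed_sets X)"
    using points_le_regular_closed[OF assms(1)] card_of_ordLeq by metis
  ultimately have inj: "inj_on (image h \<circ> q) (topspace X)"
    by (meson comp_inj_on inj_on_subset)
  define r where "r = image h \<circ> q"
  define g where "g = inv_into (topspace X) r"
  let ?Y = "pullback_topology (r ` topspace X) g X"
  have gr: "g (r x) = x" if "x \<in> topspace X" for x
    using inj that unfolding g_def r_def by (rule inv_into_f_f)
  have top: "topspace ?Y = r ` topspace X"
    by (auto simp: topspace_pullback_topology gr)
  have "continuous_map ?Y X g"
    using continuous_map_pullback[of X X id "r ` topspace X" g] by simp
  moreover have "continuous_map X ?Y r"
  proof (rule continuous_map_pullback')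
    have "continuous_map X X id" by simp
    then show "continuous_map X X (g \<circ> r)"
      by (rule continuous_map_eq) (simp add: gr)
  qed auto
  ultimately have "homeomorphic_maps X ?Y r g"
    unfolding homeomorphic_maps_def by (auto simp: gr top)
  then show ?thesis
    unfolding homeomorphic_space_def by blast
qed

end

theory Submission
  imports Defs
begin

text \<open>
  A locally compact Hausdorff space can be recovered from the Boolean algebra of its regular closed
  sets, provided that one remembers which of them meet (contact) and which are compact (bounded).
  The proof compares algebras with spaces through \<^emph>\<open>representations\<close>: a representation of an
  algebra \<open>A\<close> by a space \<open>X\<close> is an isomorphism \<open>h\<close> of \<open>A\<close> onto the regular closed sets of \<open>X\<close>.
  The duality rests on three facts.

  \<^item> The regular closed sets of a locally compact Hausdorff space form a complete local contact
    algebra (\<open>is_local_contact_algebra\<close>), which is connected iff the space is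
    (\<open>connected_iff\<close>). So every space represents an algebra.

  \<^item> Every complete local contact algebra has a representation (\<open>cluster_representation\<close>).
    For an ultrafilter \<open>u\<close> containing a bounded element, let the cluster of \<open>u\<close> consist of the
    elements in contact with every member of \<open>u\<close>. The points of the representing space are these
    clusters, and \<open>a\<close> is represented by the set of clusters that contain \<open>a\<close>. If the algebra
    comes from a space, the cluster of a point is the family of regular closed sets through it.

  \<^item> If \<open>X\<close> represents \<open>A\<close> and \<open>Y\<close> represents \<open>B\<close>, then taking preimages is a bijection from the
    open perfect maps \<open>Y \<rightarrow> X\<close> to the morphisms \<open>A \<rightarrow> B\<close> (\<open>dual_bij_betw\<close>). Openness makes
    preimages commute with closure and interior, so that the preimage map is a complete Boolean
    homomorphism, and its left adjoint is the direct image; (L1), (L2), (L3) and (LO) then say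
    that preimages preserve disjointness, that images and preimages of compact sets are compact,
    and that a set meets a preimage if its image meets the original set. Conversely, from a
    morphism \<open>\<phi>\<close> with left adjoint \<open>\<psi>\<close> the point \<open>f y\<close> is recovered as the common point of
    the compact sets \<open>\<psi> G\<close>, where \<open>G\<close> runs through the compact neighbourhoods of \<open>y\<close>
    (\<open>dual_surj\<close>).

  The passage from these facts to an equivalence is formal (\<open>dually_equivalentI_representation\<close>).
  The compact case is the part of the same correspondence where the whole algebra is bounded: a
  normal contact algebra is the same as a local contact algebra whose ideal is improper
  (\<open>local_contact_algebra_all_bounded\<close>), (CO) is then (LO), and every continuous map between
  compact Hausdorff spaces is perfect.
\<close>

section \<open>Dual equivalence from represented objects\<close>

text \<open>
  This is the principle that a fully faithful and essentially surjective functor is an equivalence,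
  with the functor replaced by the relation that \<open>A\<close> is represented by \<open>X\<close> through \<open>h\<close>. No
  functor has to be singled out: both functors and both natural isomorphisms come from choosing
  representations. Since hom-sets of \<open>D\<close> correspond to hom-sets of \<open>C\<close>, the category axioms for
  \<open>D\<close> are a conclusion: that morphisms of \<open>D\<close> compose is read off from the composition in \<open>C\<close>.
\<close>

lemma dually_equivalentI_representation:
  fixes C :: "('o, 'm) category_data" and D :: "('p, 'n) category_data"
    and Rep :: "'o \<Rightarrow> 'p \<Rightarrow> 'r \<Rightarrow> bool"
    and \<Phi> :: "'o \<Rightarrow> 'p \<Rightarrow> 'r \<Rightarrow> 'o \<Rightarrow> 'p \<Rightarrow> 'r \<Rightarrow> 'm \<Rightarrow> 'n"
  assumes C: "is_category C"
    and ex_dual: "\<And>X. X \<in> obj C \<Longrightarrow> \<exists>A\<in>obj D. \<exists>h. Rep X A h"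
    and ex_space: "\<And>A. A \<in> obj D \<Longrightarrow> \<exists>X\<in>obj C. \<exists>h. Rep X A h"
    and bij: "\<And>X A h Y B k. \<lbrakk>X \<in> obj C; A \<in> obj D; Rep X A h; Y \<in> obj C; B \<in> obj D; Rep Y B k\<rbrakk> \<Longrightarrow>
        bij_betw (\<Phi> X A h Y B k) (hom_set C Y X) (hom_set D A B)"
    and ident: "\<And>X A h. \<lbrakk>X \<in> obj C; A \<in> obj D; Rep X A h\<rbrakk> \<Longrightarrow> \<Phi> X A h X A h (idm C X) = idm D A"
    and comp: "\<And>X A h Y B k Z E l f g.
        \<lbrakk>X \<in> obj C; A \<in> obj D; Rep X A h; Y \<in> obj C; B \<in> obj D; Rep Y B k;
         Z \<in> obj C; E \<in> obj D; Rep Z E l; f \<in> hom_set C Y X; g \<in> hom_set C Z Y\<rbrakk> \<Longrightarrow>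
        \<Phi> X A h Z E l (cmp C Z Y X f g) = cmp D A B E (\<Phi> Y B k Z E l g) (\<Phi> X A h Y B k f)"
  shows "dually_equivalent C D"
proof -
  have "\<exists>A h. \<forall>X\<in>obj C. A X \<in> obj D \<and> Rep X (A X) (h X)"
    using ex_dual by metis
  then obtain FA FH where F: "\<And>X. X \<in> obj C \<Longrightarrow> FA X \<in> obj D \<and> Rep X (FA X) (FH X)"
    by blast
  have "\<exists>X h. \<forall>A\<in>obj D. X A \<in> obj C \<and> Rep (X A) A (h A)"
    using ex_space by metis
  then obtain GX GH where G: "\<And>A. A \<in> obj D \<Longrightarrow> GX A \<in> obj C \<and> Rep (GX A) A (GH A)"
    by blast
  define \<Psi> where "\<Psi> X A h Y B k = inv_into (hom_set C Y X) (\<Phi> X A h Y B k)" for X A h Y B k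
  let ?R = "\<lambda>X A h. X \<in> obj C \<and> A \<in> obj D \<and> Rep X A h"
  have \<Phi>: "\<Phi> X A h Y B k f \<in> hom_set D A B"
    if "?R X A h" "?R Y B k" "f \<in> hom_set C Y X" for X A h Y B k f
    using bij[of X A h Y B k] that by (auto simp: bij_betw_def)
  have \<Psi>: "\<Psi> X A h Y B k \<phi> \<in> hom_set C Y X" "\<Phi> X A h Y B k (\<Psi> X A h Y B k \<phi>) = \<phi>"
    if "?R X A h" "?R Y B k" "\<phi> \<in> hom_set D A B" for X A h Y B k \<phi>
    using bij[of X A h Y B k] that unfolding \<Psi>_def bij_betw_def
    by (simp_all add: inv_into_into f_inv_into_f)
  have inj: "f = g"
    if "?R X A h" "?R Y B k" "f \<in> hom_set C Y X" "g \<in> hom_set C Y X"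
      "\<Phi> X A h Y B k f = \<Phi> X A h Y B k g" for X A h Y B k f g
    using bij[of X A h Y B k] that unfolding bij_betw_def inj_on_def by blast
  have idC: "idm C X \<in> hom_set C X X" if "X \<in> obj C" for X
    using C that unfolding is_category_def by blast
  have cmpC: "cmp C X Y Z g f \<in> hom_set C X Z"
    if "X \<in> obj C" "Y \<in> obj C" "Z \<in> obj C" "f \<in> hom_set C X Y" "g \<in> hom_set C Y Z" for X Y Z f g
    using C that unfolding is_category_def by blast
  have unitC: "cmp C X X Y f (idm C X) = f" "cmp C X Y Y (idm C Y) f = f"
    if "X \<in> obj C" "Y \<in> obj C" "f \<in> hom_set C X Y" for X Y f
    using C that unfolding is_category_def by blast+
  have assocC: "cmp C W X Z (cmp C X Y Z h g) f = cmp C W Y Z h (cmp C W X Y g f)"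
    if "W \<in> obj C" "X \<in> obj C" "Y \<in> obj C" "Z \<in> obj C"
      "f \<in> hom_set C W X" "g \<in> hom_set C X Y" "h \<in> hom_set C Y Z" for W X Y Z f g h
    using C that unfolding is_category_def by blast
  have GR: "?R (GX A) A (GH A)" if "A \<in> obj D" for A
    using G that by blast
  have FR: "?R X (FA X) (FH X)" if "X \<in> obj C" for X
    using F that by blast
  have comp': "cmp D A B E \<psi> \<phi> = \<Phi> X A h Z E l (cmp C Z Y X f g)"
    if "?R X A h" "?R Y B k" "?R Z E l" "f \<in> hom_set C Y X" "g \<in> hom_set C Z Y"
      "\<psi> = \<Phi> Y B k Z E l g" "\<phi> = \<Phi> X A h Y B k f" for X A h Y B k Z E l f g \<phi> \<psi>
    using comp[of X A h Y B k Z E l f g] that by simp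
  \<comment> \<open>The axioms for \<open>D\<close> hold because \<open>\<Phi>\<close> transports them from \<open>C\<close>.\<close>
  have idD: "idm D A \<in> hom_set D A A" if "A \<in> obj D" for A
    using GR[OF that] ident[of "GX A" A "GH A"] \<Phi>[of "GX A" A "GH A" "GX A" A "GH A"] idC
    by metis
  have D: "is_category D"
    unfolding is_category_def
  proof (intro conjI ballI)
    fix A assume "A \<in> obj D" then show "idm D A \<in> hom_set D A A" by (rule idD)
  next
    fix A B E \<phi> \<psi>
    assume o: "A \<in> obj D" "B \<in> obj D" "E \<in> obj D" and m: "\<phi> \<in> hom_set D A B" "\<psi> \<in> hom_set D B E"
    note r = GR[OF o(1)] GR[OF o(2)] GR[OF o(3)]
    show "cmp D A B E \<psi> \<phi> \<in> hom_set D A E"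
      unfolding comp'[OF r \<Psi>(1)[OF r(1,2) m(1)] \<Psi>(1)[OF r(2,3) m(2)]
          \<Psi>(2)[OF r(2,3) m(2), symmetric] \<Psi>(2)[OF r(1,2) m(1), symmetric]]
      using r by (intro \<Phi> cmpC \<Psi> m) auto
  next
    fix A B \<phi> assume o: "A \<in> obj D" "B \<in> obj D" and m: "\<phi> \<in> hom_set D A B"
    note r = GR[OF o(1)] GR[OF o(2)]
    note p = \<Psi>[OF r m]
    show "cmp D A A B \<phi> (idm D A) = \<phi>"
      using comp'[OF r(1) r(1) r(2) idC p(1) p(2)[symmetric] ident[symmetric]] r unitC p by simp
    show "cmp D A B B (idm D B) \<phi> = \<phi>"
      using comp'[OF r(1) r(2) r(2) p(1) idC ident[symmetric] p(2)[symmetric]] r unitC p by simp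
  next
    fix A B E H \<phi> \<psi> \<theta>
    assume o: "A \<in> obj D" "B \<in> obj D" "E \<in> obj D" "H \<in> obj D"
      and m: "\<phi> \<in> hom_set D A B" "\<psi> \<in> hom_set D B E" "\<theta> \<in> hom_set D E H"
    note r = GR[OF o(1)] GR[OF o(2)] GR[OF o(3)] GR[OF o(4)]
    note p = \<Psi>[OF r(1,2) m(1)] and q = \<Psi>[OF r(2,3) m(2)] and s = \<Psi>[OF r(3,4) m(3)]
    show "cmp D A B H (cmp D B E H \<theta> \<psi>) \<phi> = cmp D A E H \<theta> (cmp D A B E \<psi> \<phi>)"
      unfolding comp'[OF r(2,3,4) q(1) s(1) s(2)[symmetric] q(2)[symmetric]]
        comp'[OF r(1,2,3) p(1) q(1) q(2)[symmetric] p(2)[symmetric]]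
        comp'[OF r(1,2,4) p(1) cmpC[OF _ _ _ s(1) q(1)] refl p(2)[symmetric], OF conjunct1[OF r(4)] conjunct1[OF r(3)] conjunct1[OF r(2)]]
        comp'[OF r(1,3,4) cmpC[OF _ _ _ q(1) p(1)] s(1) s(2)[symmetric] refl, OF conjunct1[OF r(3)] conjunct1[OF r(2)] conjunct1[OF r(1)]]
      using assocC[OF _ _ _ _ s(1) q(1) p(1)] r by simp
  qed
  define F where "F = \<lparr>fobj = FA, fmap = (\<lambda>X Y f. \<Phi> Y (FA Y) (FH Y) X (FA X) (FH X) f)\<rparr>"
  define G' where "G' = \<lparr>fobj = GX, fmap = (\<lambda>A B \<phi>. \<Psi> (GX B) B (GH B) (GX A) A (GH A) \<phi>)\<rparr>"
  have Ffun: "is_functor C (opposite D) F"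
    unfolding is_functor_def F_def opposite_def using FR
    by (auto intro!: \<Phi> ident comp)
  have Gfun: "is_functor (opposite D) C G'"
    unfolding is_functor_def G'_def opposite_def functor_data.simps category_data.simps
  proof (intro conjI ballI)
    fix A assume "A \<in> obj D"
    then show "GX A \<in> obj C" using G by blast
  next
    fix A B \<phi> assume "A \<in> obj D" "B \<in> obj D" "\<phi> \<in> hom_set D B A"
    then show "\<Psi> (GX B) B (GH B) (GX A) A (GH A) \<phi> \<in> hom_set C (GX A) (GX B)"
      by (simp add: \<Psi> GR)
  next
    fix A assume o: "A \<in> obj D"
    note r = GR[OF o]
    show "\<Psi> (GX A) A (GH A) (GX A) A (GH A) (idm D A) = idm C (GX A)"
      by (rule inj[OF r r \<Psi>(1)[OF r r]]) (use idD[OF o] \<Psi>(2)[OF r r] ident idC r in auto)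
  next
    fix A B E \<phi> \<psi>
    assume o: "A \<in> obj D" "B \<in> obj D" "E \<in> obj D" and m: "\<phi> \<in> hom_set D B A" "\<psi> \<in> hom_set D E B"
    note r = GR[OF o(1)] GR[OF o(2)] GR[OF o(3)]
    note p = \<Psi>[OF r(2,1) m(1)] and q = \<Psi>[OF r(3,2) m(2)]
    have "cmp D E B A \<phi> \<psi> \<in> hom_set D E A"
      using D o m unfolding is_category_def by blast
    note s = \<Psi>[OF r(3,1) this]
    show "\<Psi> (GX E) E (GH E) (GX A) A (GH A) (cmp D E B A \<phi> \<psi>) =
      cmp C (GX A) (GX B) (GX E) (\<Psi> (GX E) E (GH E) (GX B) B (GH B) \<psi>)
        (\<Psi> (GX B) B (GH B) (GX A) A (GH A) \<phi>)"
      by (rule inj[OF r(3,1) s(1) cmpC[OF _ _ _ p(1) q(1)]])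
        (use r s comp'[OF r(3,2,1) q(1) p(1) p(2)[symmetric] q(2)[symmetric]] in auto)
  qed
  \<comment> \<open>Both \<open>X\<close> and \<open>GX (FA X)\<close> represent \<open>FA X\<close>; the unit is the map that corresponds to the
  identity of this algebra. Dually, \<open>A\<close> and \<open>FA (GX A)\<close> are both represented by \<open>GX A\<close>.\<close>
  define \<eta> where "\<eta> X = \<Psi> (GX (FA X)) (FA X) (GH (FA X)) X (FA X) (FH X) (idm D (FA X))" for X
  define \<epsilon> where "\<epsilon> A = \<Phi> (GX A) A (GH A) (GX A) (FA (GX A)) (FH (GX A)) (idm C (GX A))" for A
  have D_unit: "cmp D A A B \<phi> (idm D A) = \<phi>" "cmp D A B B (idm D B) \<phi> = \<phi>"
    if "A \<in> obj D" "B \<in> obj D" "\<phi> \<in> hom_set D A B" for A B \<phi>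
    using D that unfolding is_category_def by blast+
  have eta: "is_nat_iso C C id_functor (comp_functor G' F) \<eta>"
    unfolding is_nat_iso_def is_iso_def id_functor_def comp_functor_def G'_def F_def
      functor_data.simps
  proof (intro conjI ballI)
    fix X assume o: "X \<in> obj C"
    have oA: "FA X \<in> obj D" using F o by blast
    note r = FR[OF o] GR[OF oA]
    note e = \<Psi>[OF r(2,1) idD[OF oA]] and e' = \<Psi>[OF r(1,2) idD[OF oA]]
    show "\<eta> X \<in> hom_set C X (GX (FA X))"
      using e(1) unfolding \<eta>_def .
    show "\<exists>g\<in>hom_set C (GX (FA X)) X.
            cmp C X (GX (FA X)) X g (\<eta> X) = idm C X \<and>
            cmp C (GX (FA X)) X (GX (FA X)) (\<eta> X) g = idm C (GX (FA X))"
    proof (intro bexI[OF _ e'(1)] conjI)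
      show "cmp C X (GX (FA X)) X (\<Psi> X (FA X) (FH X) (GX (FA X)) (FA X) (GH (FA X)) (idm D (FA X))) (\<eta> X) = idm C X"
        unfolding \<eta>_def
        by (rule inj[OF r(1) r(1)])
          (use r oA e e' cmpC idC ident idD D_unit comp'[OF r(1,2,1) e'(1) e(1) e(2)[symmetric] e'(2)[symmetric]] in auto)
      show "cmp C (GX (FA X)) X (GX (FA X)) (\<eta> X) (\<Psi> X (FA X) (FH X) (GX (FA X)) (FA X) (GH (FA X)) (idm D (FA X))) = idm C (GX (FA X))"
        unfolding \<eta>_def
        by (rule inj[OF r(2) r(2)])
          (use r oA e e' cmpC idC ident idD D_unit comp'[OF r(2,1,2) e(1) e'(1) e'(2)[symmetric] e(2)[symmetric]] in auto)
    qed
  next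
    fix X Y f assume o: "X \<in> obj C" "Y \<in> obj C" and f: "f \<in> hom_set C X Y"
    have oA: "FA X \<in> obj D" "FA Y \<in> obj D" using F o by auto
    note r = FR[OF o(1)] GR[OF oA(1)] FR[OF o(2)] GR[OF oA(2)]
    note eX = \<Psi>[OF r(2,1) idD[OF oA(1)]] and eY = \<Psi>[OF r(4,3) idD[OF oA(2)]]
    note pf = \<Phi>[OF r(3,1) f]
    note gf = \<Psi>[OF r(4,2) pf]
    show "cmp C X Y (GX (FA Y)) (\<eta> Y) f =
       cmp C X (GX (FA X)) (GX (FA Y))
         (\<Psi> (GX (FA Y)) (FA Y) (GH (FA Y)) (GX (FA X)) (FA X) (GH (FA X))
            (\<Phi> Y (FA Y) (FH Y) X (FA X) (FH X) f)) (\<eta> X)"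
      unfolding \<eta>_def
      by (rule inj[OF r(4,1)])
        (use r oA o f eX eY gf pf cmpC D_unit
          comp'[OF r(4,3,1) eY(1) f refl eY(2)[symmetric]]
          comp'[OF r(4,2,1) gf(1) eX(1) eX(2)[symmetric] gf(2)[symmetric]] in auto)
  qed
  have eps: "is_nat_iso (opposite D) (opposite D) (comp_functor F G') id_functor \<epsilon>"
    unfolding is_nat_iso_def is_iso_def id_functor_def comp_functor_def G'_def F_def
      functor_data.simps opposite_def category_data.simps
  proof (intro conjI ballI)
    fix A assume o: "A \<in> obj D"
    have oX: "GX A \<in> obj C" using G o by blast
    note r = GR[OF o] FR[OF oX]
    note i = idC[OF oX]
    show "\<epsilon> A \<in> hom_set D A (FA (GX A))"
      unfolding \<epsilon>_def by (rule \<Phi>[OF r i])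
    show "\<exists>g\<in>hom_set D (FA (GX A)) A.
            cmp D (FA (GX A)) A (FA (GX A)) (\<epsilon> A) g = idm D (FA (GX A)) \<and>
            cmp D A (FA (GX A)) A g (\<epsilon> A) = idm D A"
      unfolding \<epsilon>_def
      by (intro bexI[OF _ \<Phi>[OF r(2,1) i]] conjI)
        (use r oX i ident unitC comp'[OF r(2,1,2) i i refl refl]
          comp'[OF r(1,2,1) i i refl refl] in auto)
  next
    fix A B \<phi> assume o: "A \<in> obj D" "B \<in> obj D" and m: "\<phi> \<in> hom_set D B A"
    have oX: "GX A \<in> obj C" "GX B \<in> obj C" using G o by auto
    note r = GR[OF o(1)] FR[OF oX(1)] GR[OF o(2)] FR[OF oX(2)]
    note i = idC[OF oX(1)] idC[OF oX(2)]
    note p = \<Psi>[OF r(3,1) m]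
    show "cmp D B (FA (GX B)) (FA (GX A))
           (\<Phi> (GX B) (FA (GX B)) (FH (GX B)) (GX A) (FA (GX A)) (FH (GX A))
             (\<Psi> (GX B) B (GH B) (GX A) A (GH A) \<phi>)) (\<epsilon> B) =
          cmp D B A (FA (GX A)) (\<epsilon> A) \<phi>"
      unfolding \<epsilon>_def
      using r unitC[OF _ _ p(1)] comp'[OF r(3,4,2) i(2) p(1) refl refl]
          comp'[OF r(3,1,2) p(1) i(1) refl p(2)[symmetric]] by simp
  qed
  have "is_category (opposite D)"
    using D unfolding is_category_def opposite_def by auto
  then show ?thesis
    unfolding dually_equivalent_def equivalent_categories_def using C Ffun Gfun eta eps by blast
qed

section \<open>Regular closed sets\<close>

lemma regular_closed_iff:
  "F \<in> regular_closed_sets X \<longleftrightarrow> X closure_of (X interior_of F) = F"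
  unfolding regular_closed_sets_def using closure_of_subset_topspace by fastforce

lemma regular_closed_closedin: "F \<in> regular_closed_sets X \<Longrightarrow> closedin X F"
  by (metis closedin_closure_of regular_closed_iff)

lemma regular_closed_subset: "F \<in> regular_closed_sets X \<Longrightarrow> F \<subseteq> topspace X"
  by (simp add: regular_closed_sets_def)

lemma regular_closed_closure_openin:
  assumes "openin X U"
  shows "X closure_of U \<in> regular_closed_sets X"
proof -
  have "U \<subseteq> X interior_of (X closure_of U)"
    using assms by (meson closure_of_subset interior_of_maximal openin_subset)
  moreover have "X closure_of (X interior_of (X closure_of U)) \<subseteq> X closure_of U"
    by (meson closedin_closure_of closure_of_minimal interior_of_subset)
  ultimately show ?thesis
    unfolding regular_closed_iff by (meson closure_of_mono subset_antisym)
qed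

lemma regular_closed_regularization: "X closure_of (X interior_of S) \<in> regular_closed_sets X"
  by (simp add: regular_closed_closure_openin)

lemma regular_closed_subset_regularization:
  assumes "F \<in> regular_closed_sets X" "F \<subseteq> S"
  shows "F \<subseteq> X closure_of (X interior_of S)"
  using assms by (metis closure_of_mono interior_of_mono regular_closed_iff)

text \<open>
  The closure of a union of regular closed sets is the closure of the union of their interiors, and
  closures of open sets are regular closed. This is the join in the algebra of regular closed sets.
\<close>

lemma regular_closed_Union:
  assumes "\<F> \<subseteq> regular_closed_sets X"
  shows "X closure_of \<Union>\<F> \<in> regular_closed_sets X"
proof -
  let ?U = "\<Union>F\<in>\<F>. X interior_of F"
  have "F \<subseteq> X closure_of ?U" if "F \<in> \<F>" for F
    using that assms closure_of_mono[of "X interior_of F" ?U X]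
    by (metis UN_upper regular_closed_iff subsetD)
  then have "X closure_of \<Union>\<F> \<subseteq> X closure_of ?U"
    by (intro closure_of_minimal) auto
  moreover have "X closure_of ?U \<subseteq> X closure_of \<Union>\<F>"
    by (intro closure_of_mono UN_least) (meson Union_upper interior_of_subset order_trans)
  moreover have "openin X ?U" by auto
  ultimately show ?thesis
    using regular_closed_closure_openin by (metis subset_antisym)
qed

lemma regular_closed_empty: "{} \<in> regular_closed_sets X"
  by (simp add: regular_closed_iff)

lemma regular_closed_topspace: "topspace X \<in> regular_closed_sets X"
  by (simp add: regular_closed_iff)

lemma regular_closed_complement:
  assumes "F \<in> regular_closed_sets X"
  shows "X closure_of (topspace X - F) \<in> regular_closed_sets X"
  using assms by (intro regular_closed_closure_openin) (auto simp: regular_closed_closedin)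

text \<open>
  \<open>X closure_of (X interior_of S)\<close> is the largest regular closed subset of a closed set \<open>S\<close>, so the
  meet of regular closed sets is obtained by applying it to their intersection. The next lemma says
  that the closure of the complement of \<open>F\<close> is disjoint from \<open>F\<close> in this algebra.
\<close>

lemma regularization_Int_closure_complement:
  "X closure_of (X interior_of (F \<inter> X closure_of (topspace X - F))) = {}"
proof -
  have "X interior_of F \<inter> X closure_of (topspace X - F) = {}"
    using interior_of_subset[of X F] by (subst openin_Int_closure_of_eq_empty) auto
  then have "X interior_of (F \<inter> X closure_of (topspace X - F)) = {}"
    using interior_of_subset[of X "X closure_of (topspace X - F)"]
    by (auto simp: interior_of_Int)
  then show ?thesis by simp
qed

lemma disjoint_closure_complement_iff:
  assumes "G \<subseteq> topspace X"
  shows "G \<inter> X closure_of (topspace X - F) = {} \<longleftrightarrow> G \<subseteq> X interior_of F"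
  using assms by (auto simp: closure_of_complement)

text \<open>
  The nontrivial half of distributivity. A point of the open set \<open>X interior_of F\<close> which lies in
  \<open>K = X closure_of (X interior_of K)\<close> is in the closure of the intersection of both interiors.
\<close>

lemma regularization_Int_Un_subset:
  assumes F: "F \<in> regular_closed_sets X" and G: "G \<in> regular_closed_sets X"
    and H: "H \<in> regular_closed_sets X"
  shows "X closure_of (X interior_of (F \<inter> (G \<union> H))) \<subseteq>
    X closure_of (X interior_of (F \<inter> G)) \<union> X closure_of (X interior_of (F \<inter> H))"
proof -
  have "X interior_of F \<inter> K \<subseteq> X closure_of (X interior_of (F \<inter> K))"
    if "K \<in> regular_closed_sets X" for K
    using openin_Int_closure_of_subset[of X "X interior_of F" "X interior_of K"] that
    by (simp add: regular_closed_iff interior_of_Int)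
  from this[OF G] this[OF H] show ?thesis
    using interior_of_subset[of X "G \<union> H"]
    by (intro closure_of_minimal closedin_Un closedin_closure_of) (auto simp: interior_of_Int)
qed

text \<open>
  The existence of many compact regular closed sets is what local compactness contributes. Around
  each point of \<open>K\<close> there is an open set whose closure is compact and contained in \<open>W\<close>; finitely
  many of them cover \<open>K\<close>.
\<close>

lemma locally_compact_regular_closed_between:
  assumes "locally_compact_space X" "Hausdorff_space X" "compactin X K" "openin X W" "K \<subseteq> W"
  shows "\<exists>H\<in>regular_closed_sets X. compactin X H \<and> K \<subseteq> X interior_of H \<and> H \<subseteq> W"
proof -
  have nb: "\<exists>U. openin X U \<and> x \<in> U \<and> compactin X (X closure_of U) \<and> X closure_of U \<subseteq> W"
    if x: "x \<in> W" for x
  proof -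
    have "regular_space X"
      using assms locally_compact_Hausdorff_imp_regular_space by blast
    then have "neighbourhood_base_of (closedin X) X"
      by (simp add: neighbourhood_base_of_closedin)
    then obtain U V where 1: "openin X U" "closedin X V" "x \<in> U" "U \<subseteq> V" "V \<subseteq> W"
      using assms(4) x unfolding neighbourhood_base_of by meson
    obtain U' where 2: "openin X U'" "x \<in> U'" "compactin X (X closure_of U')"
      using assms x openin_subset[OF assms(4)]
      by (metis locally_compact_space_compact_closure_of subsetD)
    have "X closure_of (U \<inter> U') \<subseteq> V"
      using 1 by (meson closure_of_minimal inf.coboundedI1)
    moreover have "compactin X (X closure_of (U \<inter> U'))"
      using 2(3) by (rule closed_compactin) (simp_all add: closure_of_mono)
    ultimately show ?thesis
      using 1 2 by (intro exI[of _ "U \<inter> U'"]) auto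
  qed
  then obtain N where N: "\<And>x. x \<in> W \<Longrightarrow> openin X (N x) \<and> x \<in> N x \<and>
      compactin X (X closure_of (N x)) \<and> X closure_of (N x) \<subseteq> W"
    by metis
  have "\<And>U. U \<in> N ` K \<Longrightarrow> openin X U" and "K \<subseteq> \<Union>(N ` K)"
    using N assms(5) by auto
  then obtain \<F> where F: "finite \<F>" "\<F> \<subseteq> N ` K" "K \<subseteq> \<Union>\<F>"
    using assms(3) unfolding compactin_def by meson
  let ?H = "X closure_of \<Union>\<F>"
  have op: "openin X (\<Union>\<F>)"
    using F N assms(5) by (intro openin_Union) auto
  have H: "?H = (\<Union>U\<in>\<F>. X closure_of U)"
    using F by (simp add: closure_of_Union)
  have "compactin X ?H"
    unfolding H using F N assms(5) by (intro compactin_Union) auto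
  moreover have "?H \<subseteq> W"
    unfolding H using F N assms(5) by blast
  moreover have "K \<subseteq> X interior_of ?H"
    using F op by (meson closure_of_subset interior_of_maximal openin_subset order_trans)
  ultimately show ?thesis
    using op regular_closed_closure_openin by blast
qed

lemma locally_compact_regular_closed_neighbourhood:
  assumes "locally_compact_space X" "Hausdorff_space X" "openin X W" "x \<in> W"
  shows "\<exists>H\<in>regular_closed_sets X. compactin X H \<and> x \<in> X interior_of H \<and> H \<subseteq> W"
proof -
  have "compactin X {x}" using assms openin_subset by fastforce
  then show ?thesis
    using locally_compact_regular_closed_between[of X "{x}" W] assms by auto
qed

section \<open>Contact algebras of regular closed sets\<close>

text \<open>
  The underlying space is kept apart from the algebra, because the elements of the algebra are
  arbitrary names of regular closed sets: this covers both the coded algebra of a given space and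
  the space constructed from a given algebra.
\<close>

locale contact_representation =
  fixes A :: "('a, 'c) contact_struct_scheme" (structure)
    and X :: "'x topology" and h :: "'a \<Rightarrow> 'x set"
  assumes is_partial_order: "partial_order A"
    and bij_h: "bij_betw h (carrier A) (regular_closed_sets X)"
    and le_iff: "\<lbrakk>a \<in> carrier A; b \<in> carrier A\<rbrakk> \<Longrightarrow> a \<sqsubseteq> b \<longleftrightarrow> h a \<subseteq> h b"
    and contact_iff: "\<lbrakk>a \<in> carrier A; b \<in> carrier A\<rbrakk> \<Longrightarrow> contact A a b \<longleftrightarrow> h a \<inter> h b \<noteq> {}"
begin

definition elem :: "'x set \<Rightarrow> 'a" where
  "elem F = inv_into (carrier A) h F"

lemma h_regular: "a \<in> carrier A \<Longrightarrow> h a \<in> regular_closed_sets X"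
  using bij_h by (auto simp: bij_betw_def)

lemma elem_closed: "F \<in> regular_closed_sets X \<Longrightarrow> elem F \<in> carrier A"
  unfolding elem_def using bij_h by (metis bij_betw_def inv_into_into)

lemma h_elem: "F \<in> regular_closed_sets X \<Longrightarrow> h (elem F) = F"
  unfolding elem_def using bij_h by (metis bij_betw_inv_into_right)

lemma elem_h: "a \<in> carrier A \<Longrightarrow> elem (h a) = a"
  unfolding elem_def using bij_h by (metis bij_betw_inv_into_left)

lemma h_eq_iff: "\<lbrakk>a \<in> carrier A; b \<in> carrier A\<rbrakk> \<Longrightarrow> h a = h b \<longleftrightarrow> a = b"
  by (metis elem_h)

lemma h_subset: "a \<in> carrier A \<Longrightarrow> h a \<subseteq> topspace X"
  using h_regular regular_closed_subset by blast

lemma least_elem: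
  assumes "S \<subseteq> carrier A"
  shows "least A (elem (X closure_of \<Union>(h ` S))) (Upper A S)"
proof -
  let ?F = "X closure_of \<Union>(h ` S)"
  have F: "?F \<in> regular_closed_sets X"
    using assms h_regular by (intro regular_closed_Union) auto
  have "h a \<subseteq> ?F" if "a \<in> S" for a
    using that assms h_subset by (intro order_trans[OF _ closure_of_subset]) fastforce+
  moreover have "?F \<subseteq> h u" if "u \<in> Upper A S" for u
    using that assms le_iff regular_closed_closedin h_regular
    unfolding Upper_def by (intro closure_of_minimal) fastforce+
  ultimately show ?thesis
    using assms by (intro least_UpperI) (auto simp: le_iff h_elem F elem_closed Upper_def)
qed

lemma greatest_elem:
  assumes "S \<subseteq> carrier A"
  shows "greatest A (elem (X closure_of (X interior_of (topspace X \<inter> \<Inter>(h ` S))))) (Lower A S)"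
proof -
  let ?T = "topspace X \<inter> \<Inter>(h ` S)" and ?F = "X closure_of (X interior_of (topspace X \<inter> \<Inter>(h ` S)))"
  have F: "?F \<in> regular_closed_sets X"
    by (rule regular_closed_regularization)
  have "?F \<subseteq> h a" if "a \<in> S" for a
  proof (rule closure_of_minimal)
    show "X interior_of ?T \<subseteq> h a"
      using that interior_of_subset[of X ?T] by auto
    show "closedin X (h a)"
      using that assms h_regular regular_closed_closedin by blast
  qed
  moreover have "h l \<subseteq> ?F" if "l \<in> Lower A S" for l
  proof (rule regular_closed_subset_regularization)
    have l: "l \<in> carrier A" "\<And>a. a \<in> S \<Longrightarrow> l \<sqsubseteq> a"
      using that assms unfolding Lower_def by auto
    then show "h l \<in> regular_closed_sets X" by (simp add: h_regular)
    show "h l \<subseteq> ?T" using l assms le_iff h_subset by blast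
  qed
  ultimately show ?thesis
    using assms by (intro greatest_LowerI) (auto simp: le_iff h_elem F elem_closed Lower_def)
qed

lemma is_complete_lattice: "complete_lattice A"
proof -
  interpret partial_order A by (rule is_partial_order)
  show ?thesis
    by (rule complete_latticeI) (use least_elem greatest_elem in blast)+
qed

sublocale complete_lattice A by (rule is_complete_lattice)

lemma h_sup: "S \<subseteq> carrier A \<Longrightarrow> h (\<Squnion>S) = X closure_of \<Union>(h ` S)"
  using least_unique[OF sup_lub least_elem] h_elem regular_closed_Union h_regular
  by (metis image_subset_iff subsetD)

lemma h_inf: "S \<subseteq> carrier A \<Longrightarrow> h (\<Sqinter>S) = X closure_of (X interior_of (topspace X \<inter> \<Inter>(h ` S)))"
  using greatest_unique[OF inf_glb greatest_elem] h_elem regular_closed_regularization by metis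

lemma h_join: "\<lbrakk>a \<in> carrier A; b \<in> carrier A\<rbrakk> \<Longrightarrow> h (a \<squnion> b) = h a \<union> h b"
  using h_sup[of "{a, b}"]
    closure_of_closedin[OF regular_closed_closedin[OF h_regular[of a]]]
    closure_of_closedin[OF regular_closed_closedin[OF h_regular[of b]]]
  by (simp add: join_def)

lemma h_meet: "\<lbrakk>a \<in> carrier A; b \<in> carrier A\<rbrakk> \<Longrightarrow> h (a \<sqinter> b) = X closure_of (X interior_of (h a \<inter> h b))"
  using h_inf[of "{a, b}"] h_subset[of a] by (simp add: meet_def Int_absorb1 le_infI1)

lemma h_bottom: "h \<bottom> = {}"
  by (metis bottom_closed bottom_lower elem_closed h_elem le_iff regular_closed_empty subset_empty)

lemma h_top: "h \<top> = topspace X"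
  by (metis top_closed top_higher elem_closed h_elem h_subset le_iff regular_closed_topspace
      subset_antisym)

lemma is_boolean_lattice: "boolean_lattice A"
proof
  fix a b c assume abc: "a \<in> carrier A" "b \<in> carrier A" "c \<in> carrier A"
  have "h (a \<sqinter> (b \<squnion> c)) = h ((a \<sqinter> b) \<squnion> (a \<sqinter> c))"
  proof
    show "h (a \<sqinter> (b \<squnion> c)) \<subseteq> h ((a \<sqinter> b) \<squnion> (a \<sqinter> c))"
      using abc by (simp add: h_meet h_join regularization_Int_Un_subset h_regular)
    show "h ((a \<sqinter> b) \<squnion> (a \<sqinter> c)) \<subseteq> h (a \<sqinter> (b \<squnion> c))"
      using abc by (simp add: h_meet h_join) (intro conjI closure_of_mono interior_of_mono; blast)
  qed
  then show "a \<sqinter> (b \<squnion> c) = (a \<sqinter> b) \<squnion> (a \<sqinter> c)"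
    using abc by (simp add: h_eq_iff)
next
  fix a assume a: "a \<in> carrier A"
  let ?b = "elem (X closure_of (topspace X - h a))"
  have F: "X closure_of (topspace X - h a) \<in> regular_closed_sets X"
    using a by (simp add: h_regular regular_closed_complement)
  have b: "?b \<in> carrier A" using F by (rule elem_closed)
  have "h (a \<sqinter> ?b) = h \<bottom>"
    using a b F by (simp add: h_meet h_elem h_bottom regularization_Int_closure_complement)
  moreover have "h (a \<squnion> ?b) = h \<top>"
    using a b F h_subset[OF a] closure_of_subset[of "topspace X - h a" X]
      closure_of_subset_topspace[of X "topspace X - h a"]
    by (auto simp: h_join h_elem h_top)
  ultimately have "a \<sqinter> ?b = \<bottom>" "a \<squnion> ?b = \<top>"
    using a b by (simp_all add: h_eq_iff)
  then show "\<exists>y\<in>carrier A. a \<sqinter> y = \<bottom> \<and> a \<squnion> y = \<top>"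
    using b by blast
qed

end

context boolean_lattice
begin

lemma complement_unique:
  assumes "x \<in> carrier B" "y \<in> carrier B" "z \<in> carrier B"
    "x \<squnion> y = \<top>" "x \<sqinter> z = \<bottom>"
  shows "z \<sqsubseteq> y"
proof -
  have "z = z \<sqinter> (x \<squnion> y)"
    using assms by (metis le_iff_join top_closed top_higher)
  also have "\<dots> = (z \<sqinter> x) \<squnion> (z \<sqinter> y)"
    using assms by (intro meet_join_distrib)
  also have "\<dots> = z \<sqinter> y"
    using assms by (metis bottom_closed bottom_lower le_iff_meet meet_closed meet_comm)
  finally show ?thesis
    using assms by (metis meet_right)
qed

lemma bcompl:
  assumes "x \<in> carrier B"
  shows bcompl_closed: "bcompl B x \<in> carrier B"
    and meet_bcompl: "x \<sqinter> bcompl B x = \<bottom>" and join_bcompl: "x \<squnion> bcompl B x = \<top>"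
proof -
  obtain y where y: "y \<in> carrier B" "x \<sqinter> y = \<bottom>" "x \<squnion> y = \<top>"
    using complemented assms by blast
  have "bcompl B x \<in> carrier B \<and> x \<sqinter> bcompl B x = \<bottom> \<and> x \<squnion> bcompl B x = \<top>"
    unfolding bcompl_def
    by (rule theI[of _ y]) (use y assms complement_unique le_antisym in blast)+
  then show "bcompl B x \<in> carrier B" "x \<sqinter> bcompl B x = \<bottom>" "x \<squnion> bcompl B x = \<top>"
    by auto
qed

lemma bcompl_eqI:
  assumes "x \<in> carrier B" "y \<in> carrier B" "x \<sqinter> y = \<bottom>" "x \<squnion> y = \<top>"
  shows "bcompl B x = y"
  using assms bcompl complement_unique le_antisym by metis

lemma bcompl_bcompl: "x \<in> carrier B \<Longrightarrow> bcompl B (bcompl B x) = x"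
  by (metis bcompl bcompl_eqI join_comm meet_comm)

lemma le_bcompl_iff:
  assumes "x \<in> carrier B" "y \<in> carrier B"
  shows "y \<sqsubseteq> bcompl B x \<longleftrightarrow> x \<sqinter> y = \<bottom>"
proof
  assume "y \<sqsubseteq> bcompl B x"
  then have "x \<sqinter> y \<sqsubseteq> x \<sqinter> bcompl B x"
    using assms by (meson bcompl_closed le_trans meet_closed meet_le meet_left meet_right)
  then show "x \<sqinter> y = \<bottom>"
    using assms by (simp add: meet_bcompl bottom_lower le_antisym)
next
  assume "x \<sqinter> y = \<bottom>"
  then show "y \<sqsubseteq> bcompl B x"
    using assms bcompl complement_unique by blast
qed

lemma le_iff_meet_bcompl:
  assumes "x \<in> carrier B" "y \<in> carrier B"
  shows "x \<sqsubseteq> y \<longleftrightarrow> x \<sqinter> bcompl B y = \<bottom>"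
  using le_bcompl_iff[of "bcompl B y" x] assms by (simp add: bcompl_closed bcompl_bcompl meet_comm)

lemma bcompl_mono:
  assumes "x \<in> carrier B" "y \<in> carrier B" "x \<sqsubseteq> y"
  shows "bcompl B y \<sqsubseteq> bcompl B x"
  using assms by (simp add: le_bcompl_iff bcompl_closed flip: le_iff_meet_bcompl)

lemma bcompl_bottom: "bcompl B \<bottom> = \<top>"
  by (rule bcompl_eqI) (auto simp: bottom_lower le_antisym top_higher meet_left join_right)

lemma bcompl_top: "bcompl B \<top> = \<bottom>"
  using bcompl_bcompl[OF bottom_closed] by (simp add: bcompl_bottom)

end

context contact_representation
begin

sublocale boolean_lattice A by (rule is_boolean_lattice)

lemma h_bcompl:
  assumes a: "a \<in> carrier A"
  shows "h (bcompl A a) = X closure_of (topspace X - h a)"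
proof
  have c: "bcompl A a \<in> carrier A" using a by (rule bcompl_closed)
  have F: "X closure_of (topspace X - h a) \<in> regular_closed_sets X"
    using a by (simp add: h_regular regular_closed_complement)
  have "h a \<union> h (bcompl A a) = topspace X"
    using h_join[OF a c] by (simp add: join_bcompl a h_top)
  then show "X closure_of (topspace X - h a) \<subseteq> h (bcompl A a)"
    using c by (intro closure_of_minimal) (auto simp: h_regular regular_closed_closedin)
  let ?b = "elem (X closure_of (topspace X - h a))"
  have b: "?b \<in> carrier A" using F by (rule elem_closed)
  have "h (a \<squnion> ?b) = h \<top>"
    using a b F h_subset[OF a] closure_of_subset[of "topspace X - h a" X]
      closure_of_subset_topspace[of X "topspace X - h a"]
    by (auto simp: h_join h_elem h_top)
  then have "a \<squnion> ?b = \<top>" using a b by (simp add: h_eq_iff)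
  then have "bcompl A a \<sqsubseteq> ?b"
    using complement_unique[of a ?b "bcompl A a"] a b c meet_bcompl by blast
  then show "h (bcompl A a) \<subseteq> X closure_of (topspace X - h a)"
    using b c F by (simp add: le_iff h_elem)
qed

lemma well_inside_iff:
  "\<lbrakk>a \<in> carrier A; b \<in> carrier A\<rbrakk> \<Longrightarrow> well_inside A a b \<longleftrightarrow> h a \<subseteq> X interior_of (h b)"
  using disjoint_closure_complement_iff[OF h_subset, of a "h b"]
  by (simp add: well_inside_def contact_iff bcompl_closed h_bcompl)

lemma is_contact_algebra: "contact_algebra A"
proof
  fix a assume "a \<in> carrier A" "a \<noteq> \<bottom>"
  then show "contact A a a"
    using contact_iff h_bottom by (metis bottom_closed h_eq_iff inf.idem)
qed (auto simp: contact_iff h_join h_bottom)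

text \<open>
  An element out of contact with its complement is represented by a regular closed set contained in
  its own interior, that is, by a clopen set; and clopen sets are regular closed.
\<close>

lemma connected_iff: "connected_contact A \<longleftrightarrow> connected_space X"
proof
  assume con: "connected_contact A"
  show "connected_space X"
    unfolding connected_space_clopen_in
  proof (intro allI impI)
    fix T assume T: "openin X T \<and> closedin X T"
    then have R: "T \<in> regular_closed_sets X"
      by (simp add: regular_closed_iff interior_of_openin closure_of_closedin)
    let ?a = "elem T"
    have a: "?a \<in> carrier A" using R by (rule elem_closed)
    have "h ?a \<inter> h (bcompl A ?a) = {}"
      using T R a by (auto simp: h_bcompl h_elem closure_of_complement interior_of_openin)
    then have "?a = \<bottom> \<or> ?a = \<top>"
      using con a contact_iff unfolding connected_contact_def by (metis bcompl_closed)
    then show "T = {} \<or> T = topspace X"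
      using R h_bottom h_top h_elem by metis
  qed
next
  assume con: "connected_space X"
  show "connected_contact A"
    unfolding connected_contact_def
  proof (intro ballI impI, rule ccontr)
    fix a assume a: "a \<in> carrier A" and n: "a \<noteq> \<bottom> \<and> a \<noteq> \<top>" "\<not> contact A a (bcompl A a)"
    have "h a \<subseteq> X interior_of (h a)"
      using n a h_subset[OF a]
      by (simp add: contact_iff bcompl_closed h_bcompl disjoint_closure_complement_iff)
    then have "openin X (h a)"
      by (metis interior_of_eq interior_of_subset subset_antisym)
    moreover have "closedin X (h a)"
      using a by (simp add: h_regular regular_closed_closedin)
    ultimately have "h a = {} \<or> h a = topspace X"
      using con unfolding connected_space_clopen_in by blast
    then show False
      using n a by (metis h_bottom h_top h_eq_iff bottom_closed top_closed)
  qed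
qed

end

locale local_contact_representation = contact_representation A X h
  for A :: "('a, 'c) local_contact_struct_scheme" (structure)
    and X :: "'x topology" and h :: "'a \<Rightarrow> 'x set" +
  assumes locally_compact: "locally_compact_space X"
    and Hausdorff: "Hausdorff_space X"
    and bdd_eq: "bdd A = {a \<in> carrier A. compactin X (h a)}"
begin

text \<open>
  In terms of sets, \<open>well_inside A a b\<close> means that \<open>h a\<close> is contained in the interior of \<open>h b\<close>. So
  (BC1) interpolates a compact regular closed set between a compact set and an open set, (BC3)
  shrinks a nonempty open set, and (BC2) restricts to a compact neighbourhood of a common point.
\<close>

lemma is_local_contact_algebra: "local_contact_algebra A"
proof -
  interpret contact_algebra A by (rule is_contact_algebra)
  note between = locally_compact_regular_closed_between[OF locally_compact Hausdorff]
  note nbhd = locally_compact_regular_closed_neighbourhood[OF locally_compact Hausdorff]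
  show ?thesis
  proof
    show "boolean_ideal A (bdd A)"
      unfolding boolean_ideal_def bdd_eq
    proof (intro conjI ballI impI)
      fix a b assume "a \<in> {a \<in> carrier A. compactin X (h a)}" "b \<in> carrier A" "b \<sqsubseteq> a"
      then show "b \<in> {a \<in> carrier A. compactin X (h a)}"
        using closed_compactin h_regular regular_closed_closedin by (force simp: le_iff)
    qed (auto simp: h_bottom h_join compactin_Un)
  next
    fix a c assume a: "a \<in> bdd A" and c: "c \<in> carrier A" and ac: "well_inside A a c"
    have "h a \<subseteq> X interior_of (h c)"
      using a c ac by (simp add: well_inside_iff bdd_eq)
    then obtain H where H: "H \<in> regular_closed_sets X" "compactin X H" "h a \<subseteq> X interior_of H"
        "H \<subseteq> X interior_of (h c)"
      using between[of "h a" "X interior_of (h c)"] a by (auto simp: bdd_eq)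
    then show "\<exists>b\<in>bdd A. well_inside A a b \<and> well_inside A b c"
      using a c by (intro bexI[of _ "elem H"]) (auto simp: well_inside_iff bdd_eq elem_closed h_elem)
  next
    fix a b assume ab: "a \<in> carrier A" "b \<in> carrier A" "contact A a b"
    then obtain p where p: "p \<in> h a" "p \<in> h b" by (auto simp: contact_iff)
    then have "p \<in> topspace X" using ab h_subset by blast
    then obtain H where H: "H \<in> regular_closed_sets X" "compactin X H" "p \<in> X interior_of H"
      using nbhd[of "topspace X" p] by auto
    have "h b = X closure_of (X interior_of (h b))"
      using ab h_regular regular_closed_iff by metis
    then have "p \<in> X closure_of (X interior_of (H \<inter> h b))"
      using openin_Int_closure_of_subset[of X "X interior_of H" "X interior_of (h b)"] p H
      by (auto simp: interior_of_Int)
    then have "contact A a (elem H \<sqinter> b)"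
      using ab H p by (auto simp: contact_iff h_meet elem_closed h_elem)
    then show "\<exists>c\<in>bdd A. contact A a (c \<sqinter> b)"
      using H by (intro bexI[of _ "elem H"]) (auto simp: bdd_eq elem_closed h_elem)
  next
    fix a assume a: "a \<in> carrier A" "a \<noteq> \<bottom>"
    then have "h a \<noteq> {}" using h_bottom h_eq_iff by blast
    then obtain p where p: "p \<in> X interior_of (h a)"
      using a h_regular regular_closed_iff
      by (metis closure_of_empty ex_in_conv)
    then obtain H where H: "H \<in> regular_closed_sets X" "compactin X H" "p \<in> X interior_of H"
        "H \<subseteq> X interior_of (h a)"
      using nbhd[of "X interior_of (h a)" p] by auto
    then have "elem H \<noteq> \<bottom>"
      using interior_of_subset[of X H] h_elem[of H] h_bottom by auto
    then show "\<exists>b\<in>bdd A - {\<bottom>}. well_inside A b a"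
      using H a by (intro bexI[of _ "elem H"]) (auto simp: bdd_eq well_inside_iff elem_closed h_elem)
  qed
qed

end

section \<open>Open perfect maps and homomorphisms\<close>

lemma proper_map_eq:
  assumes "proper_map X Y f" "\<And>x. x \<in> topspace X \<Longrightarrow> f x = g x"
  shows "proper_map X Y g"
proof -
  have "{x \<in> topspace X. g x = y} = {x \<in> topspace X. f x = y}" for y
    using assms(2) by auto
  then show ?thesis
    using assms closed_map_eq[of X Y f g] unfolding proper_map_def by simp
qed

text \<open>
  Openness of \<open>f\<close> is used for the inclusion from left to right: if \<open>T\<close> is a neighbourhood of \<open>y\<close>,
  then \<open>f ` T\<close> is a neighbourhood of \<open>f y\<close> and hence meets \<open>S\<close>.
\<close>

lemma preimage_closure_of:
  assumes f: "continuous_map Y X f" "open_map Y X f" and S: "S \<subseteq> topspace X"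
  shows "{y \<in> topspace Y. f y \<in> X closure_of S} = Y closure_of {y \<in> topspace Y. f y \<in> S}"
proof
  show "{y \<in> topspace Y. f y \<in> X closure_of S} \<subseteq> Y closure_of {y \<in> topspace Y. f y \<in> S}"
  proof
    fix y assume y: "y \<in> {y \<in> topspace Y. f y \<in> X closure_of S}"
    have "\<exists>z. z \<in> {y \<in> topspace Y. f y \<in> S} \<and> z \<in> T" if T: "y \<in> T" "openin Y T" for T
    proof -
      have "openin X (f ` T)" using f(2) T unfolding open_map_def by blast
      then obtain s where "s \<in> S" "s \<in> f ` T"
        using y T unfolding in_closure_of by blast
      then show ?thesis
        using openin_subset[OF T(2)] by blast
    qed
    then show "y \<in> Y closure_of {y \<in> topspace Y. f y \<in> S}"
      using y unfolding in_closure_of by blast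
  qed
  show "Y closure_of {y \<in> topspace Y. f y \<in> S} \<subseteq> {y \<in> topspace Y. f y \<in> X closure_of S}"
    using closure_of_subset[OF S]
    by (intro closure_of_minimal closedin_continuous_map_preimage[OF f(1)]) auto
qed

lemma preimage_interior_of:
  assumes f: "continuous_map Y X f" "open_map Y X f" and S: "S \<subseteq> topspace X"
  shows "{y \<in> topspace Y. f y \<in> X interior_of S} = Y interior_of {y \<in> topspace Y. f y \<in> S}"
proof -
  have Y: "f y \<in> topspace X" if "y \<in> topspace Y" for y
    using f(1) that by (auto simp: continuous_map_def)
  have "{y \<in> topspace Y. f y \<in> X interior_of S} =
      topspace Y - {y \<in> topspace Y. f y \<in> X closure_of (topspace X - S)}"
    unfolding interior_of_closure_of using Y by auto
  also have "\<dots> = topspace Y - Y closure_of {y \<in> topspace Y. f y \<in> topspace X - S}"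
    using preimage_closure_of[OF f] by auto
  also have "{y \<in> topspace Y. f y \<in> topspace X - S} = topspace Y - {y \<in> topspace Y. f y \<in> S}"
    using Y by auto
  also have "topspace Y - Y closure_of \<dots> = Y interior_of {y \<in> topspace Y. f y \<in> S}"
    by (rule interior_of_closure_of[symmetric])
  finally show ?thesis .
qed

lemma preimage_regular_closed:
  assumes "continuous_map Y X f" "open_map Y X f" "F \<in> regular_closed_sets X"
  shows "{y \<in> topspace Y. f y \<in> F} \<in> regular_closed_sets Y"
proof -
  have "Y closure_of (Y interior_of {y \<in> topspace Y. f y \<in> F}) =
      {y \<in> topspace Y. f y \<in> X closure_of (X interior_of F)}"
    using assms(1,2) regular_closed_subset[OF assms(3)]
    by (simp add: preimage_closure_of preimage_interior_of interior_of_subset_topspace)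
  then show ?thesis
    using assms(3) by (simp add: regular_closed_iff)
qed

text \<open>
  \<open>f ` G\<close> is closed, and it is the image of the closure of \<open>Y interior_of G\<close>, whose image is open
  and therefore contained in the interior of \<open>f ` G\<close>.
\<close>

lemma image_regular_closed:
  assumes f: "continuous_map Y X f" "open_map Y X f" "closed_map Y X f"
    and G: "G \<in> regular_closed_sets Y"
  shows "f ` G \<in> regular_closed_sets X"
  unfolding regular_closed_iff
proof
  show "X closure_of (X interior_of (f ` G)) \<subseteq> f ` G"
    using f(3) regular_closed_closedin[OF G] unfolding closed_map_def
    by (intro closure_of_minimal interior_of_subset) blast
  have "f ` G = f ` (Y closure_of (Y interior_of G))"
    using G by (simp add: regular_closed_iff)
  also have "\<dots> \<subseteq> X closure_of (f ` (Y interior_of G))"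
    by (rule continuous_map_image_closure_subset[OF f(1)])
  also have "\<dots> \<subseteq> X closure_of (X interior_of (f ` G))"
    using f(2) unfolding open_map_def
    by (intro closure_of_mono interior_of_maximal image_mono interior_of_subset) simp
  finally show "f ` G \<subseteq> X closure_of (X interior_of (f ` G))" .
qed

lemma left_adjoint_eqI:
  assumes "partial_order A" "c \<in> carrier A"
    and "\<And>a. a \<in> carrier A \<Longrightarrow> b \<sqsubseteq>\<^bsub>B\<^esub> \<phi> a \<longleftrightarrow> c \<sqsubseteq>\<^bsub>A\<^esub> a"
  shows "left_adjoint A B \<phi> b = c"
proof -
  interpret partial_order A by fact
  show ?thesis
    unfolding left_adjoint_def
  proof (rule the_equality)
    fix d assume "d \<in> carrier A \<and> (\<forall>a\<in>carrier A. b \<sqsubseteq>\<^bsub>B\<^esub> \<phi> a \<longleftrightarrow> d \<sqsubseteq>\<^bsub>A\<^esub> a)"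
    then show "d = c"
      using assms le_antisym le_refl by metis
  qed (use assms in auto)
qed

text \<open>
  As \<open>\<phi>\<close> preserves meets, the least \<open>a\<close> with \<open>b \<sqsubseteq> \<phi> a\<close> exists: it is the meet of all such \<open>a\<close>.
\<close>

lemma left_adjoint:
  assumes "complete_lattice A" "complete_lattice B" "complete_boolean_hom A B \<phi>" "b \<in> carrier B"
  shows "left_adjoint A B \<phi> b \<in> carrier A"
    and "a \<in> carrier A \<Longrightarrow> b \<sqsubseteq>\<^bsub>B\<^esub> \<phi> a \<longleftrightarrow> left_adjoint A B \<phi> b \<sqsubseteq>\<^bsub>A\<^esub> a"
proof -
  interpret A: complete_lattice A by fact
  interpret B: complete_lattice B by fact
  let ?S = "{a \<in> carrier A. b \<sqsubseteq>\<^bsub>B\<^esub> \<phi> a}"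
  have \<phi>: "\<phi> a \<in> carrier B" if "a \<in> carrier A" for a
    using assms(3) that unfolding complete_boolean_hom_def boolean_hom_def by blast
  have meets: "\<phi> (\<Sqinter>\<^bsub>A\<^esub>S) = \<Sqinter>\<^bsub>B\<^esub>(\<phi> ` S)" if "S \<subseteq> carrier A" for S
    using assms(3) that unfolding complete_boolean_hom_def by blast
  have meet: "\<phi> (x \<sqinter>\<^bsub>A\<^esub> y) = \<phi> x \<sqinter>\<^bsub>B\<^esub> \<phi> y" if "x \<in> carrier A" "y \<in> carrier A" for x y
    using assms(3) that unfolding complete_boolean_hom_def boolean_hom_def by blast
  obtain c where c: "c \<in> carrier A" "b \<sqsubseteq>\<^bsub>B\<^esub> \<phi> c" "\<And>a. a \<in> ?S \<Longrightarrow> c \<sqsubseteq>\<^bsub>A\<^esub> a"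
  proof
    have S: "?S \<subseteq> carrier A" by blast
    show "\<Sqinter>\<^bsub>A\<^esub>?S \<in> carrier A" by (rule A.inf_closed[OF S])
    show "b \<sqsubseteq>\<^bsub>B\<^esub> \<phi> (\<Sqinter>\<^bsub>A\<^esub>?S)"
      unfolding meets[OF S] using \<phi> assms(4) by (intro B.inf_greatest) auto
    show "\<Sqinter>\<^bsub>A\<^esub>?S \<sqsubseteq>\<^bsub>A\<^esub> a" if "a \<in> ?S" for a
      using S that by (rule A.inf_lower)
  qed
  have iff: "b \<sqsubseteq>\<^bsub>B\<^esub> \<phi> a \<longleftrightarrow> c \<sqsubseteq>\<^bsub>A\<^esub> a" if a: "a \<in> carrier A" for a
  proof
    assume "b \<sqsubseteq>\<^bsub>B\<^esub> \<phi> a"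
    then show "c \<sqsubseteq>\<^bsub>A\<^esub> a" using a c(3) by blast
  next
    assume "c \<sqsubseteq>\<^bsub>A\<^esub> a"
    then have "\<phi> c \<sqsubseteq>\<^bsub>B\<^esub> \<phi> a"
      using meet[OF c(1) a] A.le_iff_join[OF c(1) a] B.le_iff_join[OF \<phi>[OF c(1)] \<phi>[OF a]]
      by simp
    then show "b \<sqsubseteq>\<^bsub>B\<^esub> \<phi> a"
      by (rule B.le_trans[OF c(2) _ assms(4) \<phi>[OF c(1)] \<phi>[OF a]])
  qed
  have eq: "left_adjoint A B \<phi> b = c"
    by (rule left_adjoint_eqI[OF A.partial_order_axioms c(1) iff])
  show "left_adjoint A B \<phi> b \<in> carrier A"
    unfolding eq by (rule c)
  show "b \<sqsubseteq>\<^bsub>B\<^esub> \<phi> a \<longleftrightarrow> left_adjoint A B \<phi> b \<sqsubseteq>\<^bsub>A\<^esub> a" if "a \<in> carrier A"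
    unfolding eq by (rule iff[OF that])
qed

definition open_perfect_map :: "'y topology \<Rightarrow> 'x topology \<Rightarrow> ('y \<Rightarrow> 'x) \<Rightarrow> bool" where
  "open_perfect_map Y X f \<longleftrightarrow> continuous_map Y X f \<and> open_map Y X f \<and> proper_map Y X f"

definition local_contact_hom ::
  "('a, 'c) local_contact_struct_scheme \<Rightarrow> ('b, 'd) local_contact_struct_scheme \<Rightarrow> ('a \<Rightarrow> 'b) \<Rightarrow> bool"
  where
  "local_contact_hom A B \<phi> \<longleftrightarrow>
     complete_boolean_hom A B \<phi> \<and>
     (\<forall>a\<in>carrier A. \<forall>b\<in>carrier A. contact B (\<phi> a) (\<phi> b) \<longrightarrow> contact A a b) \<and>
     (\<forall>b\<in>bdd B. left_adjoint A B \<phi> b \<in> bdd A) \<and>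
     (\<forall>a\<in>bdd A. \<phi> a \<in> bdd B) \<and>
     (\<forall>a\<in>carrier A. \<forall>b\<in>bdd B. contact A (left_adjoint A B \<phi> b) a \<longrightarrow> contact B b (\<phi> a))"

definition preimage_hom ::
  "('a, 'c) gorder_scheme \<Rightarrow> ('a \<Rightarrow> 'x set) \<Rightarrow> ('b, 'd) gorder_scheme \<Rightarrow> 'y topology \<Rightarrow> ('b \<Rightarrow> 'y set) \<Rightarrow>
   ('y \<Rightarrow> 'x) \<Rightarrow> 'a \<Rightarrow> 'b" where
  "preimage_hom A h B Y k f =
     (\<lambda>a\<in>carrier A. inv_into (carrier B) k {y \<in> topspace Y. f y \<in> h a})"

locale representation_pair =
  A: local_contact_representation A X h + B: local_contact_representation B Y k
  for A :: "('a, 'c) local_contact_struct_scheme" and X :: "'x topology" and h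
    and B :: "('b, 'd) local_contact_struct_scheme" and Y :: "'y topology" and k
begin

abbreviation dual :: "('y \<Rightarrow> 'x) \<Rightarrow> 'a \<Rightarrow> 'b" where
  "dual \<equiv> preimage_hom A h B Y k"

lemma
  assumes "open_perfect_map Y X f" "a \<in> carrier A"
  shows dual_closed: "dual f a \<in> carrier B"
    and k_dual: "k (dual f a) = {y \<in> topspace Y. f y \<in> h a}"
proof -
  have "{y \<in> topspace Y. f y \<in> h a} \<in> regular_closed_sets Y"
    using assms unfolding open_perfect_map_def
    by (intro preimage_regular_closed[of Y X f]) (auto simp: A.h_regular)
  then show "dual f a \<in> carrier B" "k (dual f a) = {y \<in> topspace Y. f y \<in> h a}"
    using assms(2) B.elem_closed B.h_elem unfolding preimage_hom_def B.elem_def by auto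
qed

lemma k_dual_closure_of:
  assumes f: "open_perfect_map Y X f" and "S \<subseteq> topspace X"
  shows "{y \<in> topspace Y. f y \<in> X closure_of S} = Y closure_of {y \<in> topspace Y. f y \<in> S}"
    and "{y \<in> topspace Y. f y \<in> X interior_of S} = Y interior_of {y \<in> topspace Y. f y \<in> S}"
  using assms preimage_closure_of preimage_interior_of unfolding open_perfect_map_def by blast+

lemma dual_complete_boolean_hom:
  assumes f: "open_perfect_map Y X f"
  shows "complete_boolean_hom A B (dual f)"
proof -
  have fY: "f y \<in> topspace X" if "y \<in> topspace Y" for y
    using f that unfolding open_perfect_map_def by (auto simp: continuous_map_def)
  note dc = dual_closed[OF f] and kd = k_dual[OF f] and cl = k_dual_closure_of[OF f]
  have eqI: "x = y" if "x \<in> carrier B" "y \<in> carrier B" "k x = k y" for x y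
    using that B.h_eq_iff by blast
  have sup: "dual f (\<Squnion>\<^bsub>A\<^esub>S) = \<Squnion>\<^bsub>B\<^esub>(dual f ` S)" if S: "S \<subseteq> carrier A" for S
  proof (rule eqI)
    have S': "dual f ` S \<subseteq> carrier B" using S dc by blast
    show "\<Squnion>\<^bsub>B\<^esub>(dual f ` S) \<in> carrier B" using S' by (rule B.sup_closed)
    show "dual f (\<Squnion>\<^bsub>A\<^esub>S) \<in> carrier B" using S by (intro dc A.sup_closed)
    have "\<Union>(h ` S) \<subseteq> topspace X" using S A.h_subset by blast
    note 1 = cl(1)[OF this]
    have "{y \<in> topspace Y. f y \<in> \<Union>(h ` S)} = \<Union>(k ` dual f ` S)"
      using S kd by (auto simp: subset_iff)
    then show "k (dual f (\<Squnion>\<^bsub>A\<^esub>S)) = k (\<Squnion>\<^bsub>B\<^esub>(dual f ` S))"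
      using S S' 1 by (simp add: kd A.sup_closed A.h_sup B.h_sup)
  qed
  have inf: "dual f (\<Sqinter>\<^bsub>A\<^esub>S) = \<Sqinter>\<^bsub>B\<^esub>(dual f ` S)" if S: "S \<subseteq> carrier A" for S
  proof (rule eqI)
    have S': "dual f ` S \<subseteq> carrier B" using S dc by blast
    show "\<Sqinter>\<^bsub>B\<^esub>(dual f ` S) \<in> carrier B" using S' by (rule B.inf_closed)
    show "dual f (\<Sqinter>\<^bsub>A\<^esub>S) \<in> carrier B" using S by (intro dc A.inf_closed)
    let ?T = "topspace X \<inter> \<Inter>(h ` S)"
    have "{y \<in> topspace Y. f y \<in> ?T} = topspace Y \<inter> \<Inter>(k ` dual f ` S)"
      using S kd fY by (auto simp: subset_iff)
    moreover have "k (dual f (\<Sqinter>\<^bsub>A\<^esub>S)) = Y closure_of (Y interior_of {y \<in> topspace Y. f y \<in> ?T})"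
      using S by (simp add: kd A.inf_closed A.h_inf cl interior_of_subset_topspace)
    ultimately show "k (dual f (\<Sqinter>\<^bsub>A\<^esub>S)) = k (\<Sqinter>\<^bsub>B\<^esub>(dual f ` S))"
      using B.h_inf[OF S'] by simp
  qed
  have compl: "dual f (bcompl A a) = bcompl B (dual f a)" if a: "a \<in> carrier A" for a
  proof (rule eqI)
    show "dual f (bcompl A a) \<in> carrier B" using a by (intro dc A.bcompl_closed)
    show "bcompl B (dual f a) \<in> carrier B" using a by (intro dc B.bcompl_closed)
    have "{y \<in> topspace Y. f y \<in> topspace X - h a} = topspace Y - k (dual f a)"
      using a kd fY by auto
    then show "k (dual f (bcompl A a)) = k (bcompl B (dual f a))"
      using a by (simp add: kd[of "bcompl A a"] A.bcompl_closed A.h_bcompl B.h_bcompl dc cl)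
  qed
  have bot: "dual f \<bottom>\<^bsub>A\<^esub> = \<bottom>\<^bsub>B\<^esub>"
    by (rule eqI) (auto simp: dc kd A.h_bottom B.h_bottom)
  have top: "dual f \<top>\<^bsub>A\<^esub> = \<top>\<^bsub>B\<^esub>"
    by (rule eqI) (auto simp: dc kd A.h_top B.h_top fY)
  show ?thesis
    unfolding complete_boolean_hom_def boolean_hom_def
    using bot top compl inf sup sup[of "{_, _}"] inf[of "{_, _}"] dc
    by (simp add: join_def meet_def)
qed

text \<open>
  The left adjoint of taking preimages is taking images, because \<open>k b\<close> lies in the preimage of
  \<open>h a\<close> iff \<open>f ` k b\<close> lies in \<open>h a\<close>. Images of regular closed sets are regular closed as \<open>f\<close> is
  both open and closed.
\<close>

lemma left_adjoint_dual:
  assumes f: "open_perfect_map Y X f" and b: "b \<in> carrier B"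
  shows "left_adjoint A B (dual f) b \<in> carrier A" "h (left_adjoint A B (dual f) b) = f ` k b"
proof -
  have R: "f ` k b \<in> regular_closed_sets X"
    using f b unfolding open_perfect_map_def
    by (intro image_regular_closed[of Y X f]) (auto simp: B.h_regular proper_map_def)
  have "left_adjoint A B (dual f) b = A.elem (f ` k b)"
    using R b f B.h_subset[OF b]
    by (intro left_adjoint_eqI A.is_partial_order)
      (auto simp: A.elem_closed A.le_iff A.h_elem B.le_iff k_dual dual_closed)
  then show "left_adjoint A B (dual f) b \<in> carrier A" "h (left_adjoint A B (dual f) b) = f ` k b"
    using R by (simp_all add: A.elem_closed A.h_elem)
qed

lemma dual_local_contact_hom:
  assumes f: "open_perfect_map Y X f"
  shows "local_contact_hom A B (dual f)"
  unfolding local_contact_hom_def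
proof (intro conjI ballI impI)
  show "complete_boolean_hom A B (dual f)"
    by (rule dual_complete_boolean_hom[OF f])
next
  fix a b assume "a \<in> carrier A" "b \<in> carrier A" "contact B (dual f a) (dual f b)"
  then show "contact A a b"
    using f by (auto simp: A.contact_iff B.contact_iff dual_closed k_dual)
next
  fix b assume "b \<in> bdd B"
  then show "left_adjoint A B (dual f) b \<in> bdd A"
    using f unfolding A.bdd_eq B.bdd_eq
    by (auto simp: left_adjoint_dual open_perfect_map_def intro: image_compactin)
next
  fix a assume "a \<in> bdd A"
  then show "dual f a \<in> bdd B"
    using f unfolding A.bdd_eq B.bdd_eq
    by (auto simp: k_dual dual_closed)
      (auto simp: open_perfect_map_def intro: compactin_proper_map_preimage)
next
  fix a b assume "a \<in> carrier A" "b \<in> bdd B" "contact A (left_adjoint A B (dual f) b) a"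
  then show "contact B b (dual f a)"
    using f B.h_subset unfolding B.bdd_eq
    by (auto simp: A.contact_iff B.contact_iff left_adjoint_dual k_dual dual_closed)
qed

text \<open>
  In a Hausdorff space distinct points are separated by the closure of an open set.
\<close>

lemma dual_inj:
  assumes "open_perfect_map Y X f" "open_perfect_map Y X g" "dual f = dual g" "y \<in> topspace Y"
  shows "f y = g y"
proof (rule ccontr)
  assume ne: "f y \<noteq> g y"
  have "f y \<in> topspace X" "g y \<in> topspace X"
    using assms unfolding open_perfect_map_def by (auto simp: continuous_map_def)
  then obtain U V where UV: "openin X U" "openin X V" "f y \<in> U" "g y \<in> V" "disjnt U V"
    using A.Hausdorff ne unfolding Hausdorff_space_def by meson
  let ?F = "X closure_of U"
  have R: "?F \<in> regular_closed_sets X" using UV regular_closed_closure_openin by blast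
  have "f y \<in> ?F" using UV by (meson closure_of_subset openin_subset subsetD)
  then have "y \<in> k (dual f (A.elem ?F))"
    using assms(1,4) R by (simp add: k_dual A.elem_closed A.h_elem)
  then have "g y \<in> ?F"
    using assms(2,3,4) R by (simp add: k_dual A.elem_closed A.h_elem)
  then show False
    using UV by (auto simp: in_closure_of disjnt_def)
qed

text \<open>
  Reconstruction of a map from a morphism \<open>\<phi>\<close>. If \<open>\<phi>\<close> takes preimages under \<open>f\<close>, then \<open>\<psi>\<close> takes
  images, and by continuity \<open>f y\<close> lies in \<open>\<psi> G\<close> for every neighbourhood \<open>G\<close> of \<open>y\<close>. For a given
  \<open>\<phi>\<close>, the sets \<open>\<psi> G\<close> with \<open>G\<close> a compact neighbourhood of \<open>y\<close> have the finite intersection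
  property and are compact by (L2), so they have a common point, which is taken as \<open>f y\<close>.

  The key point is that \<open>\<phi>\<close> takes preimages under this \<open>f\<close>. If \<open>f y\<close> is in \<open>F\<close>, then \<open>\<psi> G\<close> meets
  \<open>F\<close> for all such \<open>G\<close>, so \<open>G\<close> meets \<open>\<phi> F\<close> by (LO), and \<open>y\<close> is in the closed set \<open>\<phi> F\<close>. If
  \<open>f y\<close> is not in \<open>F\<close>, it has a regular closed neighbourhood \<open>H\<close> disjoint from \<open>F\<close>; then \<open>y\<close> is in
  \<open>\<phi> H\<close> by the first part, and \<open>\<phi> H\<close> is disjoint from \<open>\<phi> F\<close> by (L1). Continuity follows because
  the regular closed sets form a base of closed sets, properness follows from (L3), and openness
  because \<open>\<psi>\<close> takes images of compact sets.
\<close>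

lemma dual_surj:
  assumes \<phi>: "local_contact_hom A B \<phi>"
  obtains f where "open_perfect_map Y X f"
    "\<And>a. a \<in> carrier A \<Longrightarrow> k (\<phi> a) = {y \<in> topspace Y. f y \<in> h a}"
proof -
  note nbhdX = locally_compact_regular_closed_neighbourhood[OF A.locally_compact A.Hausdorff]
  note nbhdY = locally_compact_regular_closed_neighbourhood[OF B.locally_compact B.Hausdorff]
  have hom: "complete_boolean_hom A B \<phi>" using \<phi> unfolding local_contact_hom_def by blast
  have \<phi>_closed: "\<phi> a \<in> carrier B" if "a \<in> carrier A" for a
    using hom that unfolding complete_boolean_hom_def boolean_hom_def by blast
  have \<phi>_compl: "k (\<phi> (bcompl A a)) = Y closure_of (topspace Y - k (\<phi> a))" if "a \<in> carrier A" for a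
    using hom that B.h_bcompl \<phi>_closed unfolding complete_boolean_hom_def boolean_hom_def by simp
  have \<phi>_bot: "k (\<phi> \<bottom>\<^bsub>A\<^esub>) = {}"
    using hom B.h_bottom unfolding complete_boolean_hom_def boolean_hom_def by simp
  define \<psi> where "\<psi> = left_adjoint A B \<phi>"
  have \<psi>_closed: "\<psi> b \<in> carrier A" if "b \<in> carrier B" for b
    using left_adjoint(1)[OF A.is_complete_lattice B.is_complete_lattice hom that]
    unfolding \<psi>_def .
  have adj: "k b \<subseteq> k (\<phi> a) \<longleftrightarrow> h (\<psi> b) \<subseteq> h a" if "a \<in> carrier A" "b \<in> carrier B" for a b
    using left_adjoint(2)[OF A.is_complete_lattice B.is_complete_lattice hom that(2,1)] that
    by (simp add: A.le_iff B.le_iff \<phi>_closed \<psi>_closed flip: \<psi>_def)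
  have L1: "h a \<inter> h a' \<noteq> {}" if "a \<in> carrier A" "a' \<in> carrier A" "k (\<phi> a) \<inter> k (\<phi> a') \<noteq> {}" for a a'
    using \<phi> that unfolding local_contact_hom_def by (simp add: A.contact_iff B.contact_iff \<phi>_closed)
  have L2: "compactin X (h (\<psi> b))" if "b \<in> carrier B" "compactin Y (k b)" for b
    using \<phi> that unfolding local_contact_hom_def A.bdd_eq B.bdd_eq \<psi>_def by blast
  have L3: "compactin Y (k (\<phi> a))" if "a \<in> carrier A" "compactin X (h a)" for a
    using \<phi> that unfolding local_contact_hom_def A.bdd_eq B.bdd_eq by blast
  have LO: "k b \<inter> k (\<phi> a) \<noteq> {}"
    if "a \<in> carrier A" "b \<in> carrier B" "compactin Y (k b)" "h (\<psi> b) \<inter> h a \<noteq> {}" for a b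
    using \<phi> that unfolding local_contact_hom_def B.bdd_eq
    by (auto simp: A.contact_iff B.contact_iff \<phi>_closed \<psi>_closed simp flip: \<psi>_def)
  have \<psi>_unit: "k b \<subseteq> k (\<phi> (\<psi> b))" if "b \<in> carrier B" for b
    using adj[of "\<psi> b" b] that \<psi>_closed by blast
  have \<psi>_mono: "h (\<psi> b) \<subseteq> h (\<psi> c)" if "b \<in> carrier B" "c \<in> carrier B" "k b \<subseteq> k c" for b c
    using adj[of "\<psi> c" b] \<psi>_unit[of c] that \<psi>_closed by blast
  have \<psi>_nonempty: "h (\<psi> b) \<noteq> {}" if "b \<in> carrier B" "k b \<noteq> {}" for b
    using adj[of "\<bottom>\<^bsub>A\<^esub>" b] \<phi>_bot that by auto
  define N where "N y = {b \<in> carrier B. compactin Y (k b) \<and> y \<in> Y interior_of (k b)}" for y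
  have N: "\<exists>b\<in>N y. k b \<subseteq> W" if W: "openin Y W" "y \<in> W" for y W
  proof -
    obtain H where "H \<in> regular_closed_sets Y" "compactin Y H" "y \<in> Y interior_of H" "H \<subseteq> W"
      using nbhdY[OF W] by blast
    then show ?thesis
      by (intro bexI[of _ "B.elem H"]) (auto simp: N_def B.elem_closed B.h_elem)
  qed
  have "\<exists>x. x \<in> topspace X \<and> (\<forall>b\<in>N y. x \<in> h (\<psi> b))" if y: "y \<in> topspace Y" for y
  proof -
    obtain b0 where b0: "b0 \<in> N y" using N[of "topspace Y" y] y by auto
    have "h (\<psi> b0) \<inter> \<Inter>((\<lambda>b. h (\<psi> b)) ` N y) \<noteq> {}"
    proof -
      have comp: "compactin X (h (\<psi> b0))" using b0 L2 by (auto simp: N_def)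
      have "h (\<psi> b0) \<inter> \<Inter>\<F> \<noteq> {}" if F: "finite \<F>" "\<F> \<subseteq> (\<lambda>b. h (\<psi> b)) ` N y" for \<F>
      proof -
        obtain J where J: "finite J" "J \<subseteq> N y" "\<F> = (\<lambda>b. h (\<psi> b)) ` J"
          using F by (meson finite_subset_image)
        have "openin Y (\<Inter>b\<in>insert b0 J. Y interior_of (k b))"
          using J by (intro openin_INT2) auto
        moreover have "y \<in> (\<Inter>b\<in>insert b0 J. Y interior_of (k b))"
          using J b0 by (auto simp: N_def)
        ultimately obtain b where b: "b \<in> N y" "k b \<subseteq> (\<Inter>b\<in>insert b0 J. Y interior_of (k b))"
          using N by meson
        have "h (\<psi> b) \<subseteq> h (\<psi> c)" if c: "c \<in> insert b0 J" for c
        proof (rule \<psi>_mono)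
          show "b \<in> carrier B" "c \<in> carrier B"
            using b(1) b0 c J(2) by (auto simp: N_def)
          have "k b \<subseteq> Y interior_of (k c)" using b(2) c by blast
          then show "k b \<subseteq> k c" using interior_of_subset by (rule order_trans)
        qed
        moreover have "h (\<psi> b) \<noteq> {}"
          using b(1) interior_of_subset[of Y "k b"] by (intro \<psi>_nonempty) (auto simp: N_def)
        ultimately show ?thesis unfolding J(3) by blast
      qed
      moreover have "closedin X C" if "C \<in> (\<lambda>b. h (\<psi> b)) ` N y" for C
        using that by (auto simp: N_def A.h_regular \<psi>_closed regular_closed_closedin)
      ultimately show ?thesis
        by (intro comp[unfolded compactin_fip, THEN conjunct2, rule_format]) blast
    qed
    then obtain x where x: "x \<in> h (\<psi> b0)" "\<forall>b\<in>N y. x \<in> h (\<psi> b)"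
      by blast
    moreover have "h (\<psi> b0) \<subseteq> topspace X"
      using b0 by (intro A.h_subset \<psi>_closed) (simp add: N_def)
    ultimately show ?thesis by blast
  qed
  then obtain f where f: "\<And>y. y \<in> topspace Y \<Longrightarrow> f y \<in> topspace X"
      "\<And>y b. \<lbrakk>y \<in> topspace Y; b \<in> N y\<rbrakk> \<Longrightarrow> f y \<in> h (\<psi> b)"
    by metis
  \<comment> \<open>(LO), applied to a compact neighbourhood of \<open>y\<close> outside \<open>k (\<phi> a)\<close>.\<close>
  have pre1: "y \<in> k (\<phi> a)" if a: "a \<in> carrier A" and y: "y \<in> topspace Y" "f y \<in> h a" for a y
  proof (rule ccontr)
    assume "y \<notin> k (\<phi> a)"
    moreover have "closedin Y (k (\<phi> a))"
      using that B.h_regular \<phi>_closed regular_closed_closedin by blast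
    ultimately obtain b where b: "b \<in> N y" "k b \<subseteq> topspace Y - k (\<phi> a)"
      using N[of "topspace Y - k (\<phi> a)" y] y by blast
    then show False
      using LO[of a b] f(2)[OF y(1) b(1)] a y(2) by (auto simp: N_def)
  qed
  \<comment> \<open>(L1), applied to a regular closed neighbourhood of \<open>f y\<close> outside \<open>h a\<close>.\<close>
  have pre2: "f y \<in> h a" if a: "a \<in> carrier A" and y: "y \<in> topspace Y" "y \<in> k (\<phi> a)" for a y
  proof (rule ccontr)
    assume "f y \<notin> h a"
    moreover have "closedin X (h a)"
      using that A.h_regular regular_closed_closedin by blast
    ultimately obtain H where H: "H \<in> regular_closed_sets X" "f y \<in> X interior_of H"
        "H \<subseteq> topspace X - h a"
      using nbhdX[of "topspace X - h a" "f y"] f(1) y by blast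
    then have "y \<in> k (\<phi> (A.elem H))"
      using interior_of_subset[of X H] y by (intro pre1) (auto simp: A.elem_closed A.h_elem)
    then show False
      using L1[of a "A.elem H"] a y H by (auto simp: A.elem_closed A.h_elem)
  qed
  have pre: "k (\<phi> a) = {y \<in> topspace Y. f y \<in> h a}" if "a \<in> carrier A" for a
    using pre1 pre2 that B.h_subset[OF \<phi>_closed[OF that]] by blast
  have preR: "{y \<in> topspace Y. f y \<in> F} = k (\<phi> (A.elem F))" if "F \<in> regular_closed_sets X" for F
    using pre[of "A.elem F"] that by (simp add: A.elem_closed A.h_elem)
  have cont: "continuous_map Y X f"
    unfolding continuous_map_def
  proof (intro conjI allI impI)
    fix W assume W: "openin X W"
    show "openin Y {y \<in> topspace Y. f y \<in> W}"
    proof (subst openin_subopen, intro ballI)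
      fix y assume y: "y \<in> {y \<in> topspace Y. f y \<in> W}"
      then obtain H where H: "H \<in> regular_closed_sets X" "f y \<in> X interior_of H" "H \<subseteq> W"
        using nbhdX[OF W] by blast
      let ?F = "X closure_of (topspace X - H)"
      have F: "?F = topspace X - X interior_of H" by (rule closure_of_complement)
      have R: "?F \<in> regular_closed_sets X" using H by (intro regular_closed_complement)
      have "closedin Y (k (\<phi> (A.elem ?F)))"
        using R by (simp add: A.elem_closed \<phi>_closed B.h_regular regular_closed_closedin)
      then have "openin Y (topspace Y - {y \<in> topspace Y. f y \<in> ?F})"
        unfolding preR[OF R] by blast
      then show "\<exists>T. openin Y T \<and> y \<in> T \<and> T \<subseteq> {y \<in> topspace Y. f y \<in> W}"
        using y H f(1) interior_of_subset[of X H] unfolding F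
        by (intro exI[of _ "topspace Y - {y \<in> topspace Y. f y \<in> topspace X - X interior_of H}"]) auto
    qed
  qed (use f in auto)
  have proper: "proper_map Y X f"
  proof (rule compact_imp_proper_map)
    show "k_space X" by (rule locally_compact_imp_k_space[OF A.locally_compact])
    show "kc_space X" by (rule Hausdorff_imp_kc_space[OF A.Hausdorff])
    fix K assume K: "compactin X K"
    then obtain H where H: "H \<in> regular_closed_sets X" "compactin X H" "K \<subseteq> X interior_of H"
      using locally_compact_regular_closed_between[OF A.locally_compact A.Hausdorff K openin_topspace]
        compactin_subset_topspace by blast
    have "compactin Y {y \<in> topspace Y. f y \<in> H}"
      unfolding preR[OF H(1)] using H by (intro L3) (auto simp: A.elem_closed A.h_elem)
    moreover have "closedin Y {y \<in> topspace Y. f y \<in> K}"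
      using cont K A.Hausdorff by (intro closedin_continuous_map_preimage compactin_imp_closedin)
    ultimately show "compactin Y {y \<in> topspace Y. f y \<in> K}"
      using H interior_of_subset[of X H] by (elim closed_compactin) auto
  qed (use f cont in auto)
  have "open_map Y X f"
    unfolding open_map_def
  proof (intro allI impI)
    fix U assume U: "openin Y U"
    show "openin X (f ` U)"
    proof (subst openin_subopen, intro ballI)
      fix x assume "x \<in> f ` U"
      then obtain y where y: "y \<in> U" "x = f y" by blast
      then have yY: "y \<in> topspace Y" using U openin_subset by blast
      obtain b where b: "b \<in> N y" "k b \<subseteq> U" using N[OF U y(1)] by blast
      then have bB: "b \<in> carrier B" "compactin Y (k b)" "y \<in> Y interior_of (k b)"
        by (auto simp: N_def)
      \<comment> \<open>A point of \<open>h (\<psi> b)\<close> outside the compact set \<open>f ` k b\<close> would have a regular closed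
      neighbourhood \<open>H\<close> outside it; by (LO), \<open>k b\<close> would meet the preimage of \<open>H\<close>.\<close>
      have "h (\<psi> b) \<subseteq> f ` k b"
      proof (rule ccontr)
        assume "\<not> h (\<psi> b) \<subseteq> f ` k b"
        then obtain z where z: "z \<in> h (\<psi> b)" "z \<notin> f ` k b" by blast
        have "closedin X (f ` k b)"
          using bB cont A.Hausdorff by (intro compactin_imp_closedin image_compactin[of Y])
        moreover have "z \<in> topspace X" using z bB \<psi>_closed A.h_subset by blast
        ultimately obtain H where H: "H \<in> regular_closed_sets X" "z \<in> X interior_of H"
            "H \<subseteq> topspace X - f ` k b"
          using nbhdX[of "topspace X - f ` k b" z] z by blast
        have "k b \<inter> k (\<phi> (A.elem H)) \<noteq> {}"
          using bB H z interior_of_subset[of X H]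
          by (intro LO) (auto simp: A.elem_closed A.h_elem)
        then show False
          using H unfolding preR[OF H(1), symmetric] by blast
      qed
      \<comment> \<open>Otherwise \<open>f y\<close> is in the complement of \<open>\<psi> b\<close>, so \<open>y\<close> is in \<open>\<phi>\<close> of this complement, and
      hence in the complement of \<open>b\<close>, as \<open>b \<sqsubseteq> \<phi> (\<psi> b)\<close>; but \<open>y\<close> is interior to \<open>k b\<close>.\<close>
      moreover have "f y \<in> X interior_of (h (\<psi> b))"
      proof (rule ccontr)
        assume "f y \<notin> X interior_of (h (\<psi> b))"
        then have "f y \<in> h (bcompl A (\<psi> b))"
          using bB f(1) yY by (simp add: A.h_bcompl \<psi>_closed closure_of_complement)
        then have "y \<in> k (\<phi> (bcompl A (\<psi> b)))"
          using bB yY by (intro pre1) (auto simp: \<psi>_closed A.bcompl_closed)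
        also have "\<dots> \<subseteq> Y closure_of (topspace Y - k b)"
          using \<psi>_unit bB by (subst \<phi>_compl) (auto simp: \<psi>_closed intro!: closure_of_mono)
        finally show False
          using bB(3) by (simp add: closure_of_complement)
      qed
      ultimately show "\<exists>T. openin X T \<and> x \<in> T \<and> T \<subseteq> f ` U"
        using b y interior_of_subset[of X "h (\<psi> b)"]
        by (intro exI[of _ "X interior_of (h (\<psi> b))"]) auto
    qed
  qed
  then show thesis
    using that[OF _ pre] cont proper unfolding open_perfect_map_def by blast
qed

lemma dual_bij_betw:
  "bij_betw dual {f \<in> extensional (topspace Y). open_perfect_map Y X f}
     {\<phi> \<in> extensional (carrier A). local_contact_hom A B \<phi>}"
  unfolding bij_betw_def
proof (intro conjI equalityI subsetI)
  show "inj_on dual {f \<in> extensional (topspace Y). open_perfect_map Y X f}"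
    by (rule inj_onI) (auto intro: extensionalityI dual_inj)
next
  fix \<phi> assume "\<phi> \<in> dual ` {f \<in> extensional (topspace Y). open_perfect_map Y X f}"
  then show "\<phi> \<in> {\<phi> \<in> extensional (carrier A). local_contact_hom A B \<phi>}"
    using dual_local_contact_hom by (auto simp: preimage_hom_def)
next
  fix \<phi> assume \<phi>: "\<phi> \<in> {\<phi> \<in> extensional (carrier A). local_contact_hom A B \<phi>}"
  then obtain f where f: "open_perfect_map Y X f"
      "\<And>a. a \<in> carrier A \<Longrightarrow> k (\<phi> a) = {y \<in> topspace Y. f y \<in> h a}"
    using dual_surj by blast
  let ?g = "restrict f (topspace Y)"
  have g: "open_perfect_map Y X ?g"
    using f(1) unfolding open_perfect_map_def
    by (metis (mono_tags, lifting) continuous_map_eq open_map_eq proper_map_eq restrict_apply')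
  have "dual ?g = \<phi>"
  proof (rule extensionalityI)
    show "dual ?g \<in> extensional (carrier A)" by (simp add: preimage_hom_def)
    show "\<phi> \<in> extensional (carrier A)" using \<phi> by simp
    fix a assume a: "a \<in> carrier A"
    have "\<phi> a \<in> carrier B"
      using \<phi> a unfolding local_contact_hom_def complete_boolean_hom_def boolean_hom_def by blast
    moreover have "{y \<in> topspace Y. ?g y \<in> h a} = {y \<in> topspace Y. f y \<in> h a}" by auto
    ultimately show "dual ?g a = \<phi> a"
      using B.h_eq_iff[OF dual_closed[OF g a], of "\<phi> a"] k_dual[OF g a] f(2)[OF a] by simp
  qed
  then show "\<phi> \<in> dual ` {f \<in> extensional (topspace Y). open_perfect_map Y X f}"
    using g by (intro image_eqI[of _ _ ?g]) auto
qed

end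

lemma (in local_contact_representation) preimage_hom_ident:
  "preimage_hom A h A X h (\<lambda>x\<in>topspace X. x) = (\<lambda>a\<in>carrier A. a)"
proof -
  have "{x \<in> topspace X. (\<lambda>x\<in>topspace X. x) x \<in> h a} = h a" if "a \<in> carrier A" for a
    using h_subset[OF that] by auto
  then show ?thesis
    unfolding preimage_hom_def using elem_h unfolding elem_def by (intro restrict_ext) auto
qed

lemma preimage_hom_compose:
  assumes "representation_pair A X h B Y k" "representation_pair B Y k E Z l"
    and f: "open_perfect_map Y X f" and g: "open_perfect_map Z Y g"
  shows "preimage_hom A h E Z l (compose (topspace Z) f g) =
    compose (carrier A) (preimage_hom B k E Z l g) (preimage_hom A h B Y k f)"
proof -
  interpret f: representation_pair A X h B Y k by fact
  interpret g: representation_pair B Y k E Z l by fact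
  have gZ: "g z \<in> topspace Y" if "z \<in> topspace Z" for z
    using g that unfolding open_perfect_map_def by (auto simp: continuous_map_def)
  have "{z \<in> topspace Z. compose (topspace Z) f g z \<in> h a} = {z \<in> topspace Z. g z \<in> k (f.dual f a)}"
    if "a \<in> carrier A" for a
    using that gZ f by (auto simp: f.k_dual compose_def)
  then show ?thesis
    unfolding preimage_hom_def[of A h E] unfolding compose_def
    using f.dual_closed[OF f] by (intro restrict_ext) (simp add: preimage_hom_def[of B])
qed

section \<open>Ultrafilters of Boolean algebras\<close>

definition boolean_ultrafilter :: "('a, 'b) gorder_scheme \<Rightarrow> 'a set \<Rightarrow> bool" where
  "boolean_ultrafilter B u \<longleftrightarrow>
     u \<subseteq> carrier B \<and> \<bottom>\<^bsub>B\<^esub> \<notin> u \<and>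
     (\<forall>a\<in>u. \<forall>b\<in>carrier B. a \<sqsubseteq>\<^bsub>B\<^esub> b \<longrightarrow> b \<in> u) \<and>
     (\<forall>a\<in>u. \<forall>b\<in>u. a \<sqinter>\<^bsub>B\<^esub> b \<in> u) \<and>
     (\<forall>a\<in>carrier B. a \<in> u \<or> bcompl B a \<in> u)"

context boolean_lattice
begin

lemma meet_join_distrib_right:
  assumes "x \<in> carrier B" "y \<in> carrier B" "z \<in> carrier B"
  shows "(x \<squnion> y) \<sqinter> z = (x \<sqinter> z) \<squnion> (y \<sqinter> z)"
  using meet_join_distrib[of z x y] assms by (simp add: meet_comm)

lemma meet_mono_left:
  assumes "x \<in> carrier B" "y \<in> carrier B" "z \<in> carrier B" "x \<sqsubseteq> y"
  shows "x \<sqinter> z \<sqsubseteq> y \<sqinter> z"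
  using assms le_trans[OF meet_left[of x z] assms(4)] by (intro meet_le) (auto simp: meet_right)

lemma meet_split:
  assumes "x \<in> carrier B" "y \<in> carrier B"
  shows "(y \<sqinter> x) \<squnion> (bcompl B y \<sqinter> x) = x"
proof -
  have "(y \<sqinter> x) \<squnion> (bcompl B y \<sqinter> x) = \<top> \<sqinter> x"
    using assms by (simp add: bcompl_closed join_bcompl flip: meet_join_distrib_right)
  also have "\<dots> = x"
    using assms by (metis le_iff_join meet_comm top_closed top_higher)
  finally show ?thesis .
qed

text \<open>
  If \<open>a\<close> could not be added to the maximal ideal \<open>M\<close>, then \<open>m \<squnion> a = \<top>\<close> for some \<open>m\<close> in \<open>M\<close>, and the
  complement of \<open>a\<close> is below \<open>m\<close>.
\<close>

lemma maximal_ideal_complement: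
  assumes M: "boolean_ideal B M" "\<top> \<notin> M"
    and max: "\<And>J. \<lbrakk>boolean_ideal B J; \<top> \<notin> J; M \<subseteq> J\<rbrakk> \<Longrightarrow> J = M"
    and a: "a \<in> carrier B" "a \<notin> M"
  shows "bcompl B a \<in> M"
proof -
  have M': "M \<subseteq> carrier B" "\<bottom> \<in> M" "\<And>x y. \<lbrakk>x \<in> M; y \<in> carrier B; y \<sqsubseteq> x\<rbrakk> \<Longrightarrow> y \<in> M"
      "\<And>x y. \<lbrakk>x \<in> M; y \<in> M\<rbrakk> \<Longrightarrow> x \<squnion> y \<in> M"
    using M(1) unfolding boolean_ideal_def by auto
  let ?J = "{x \<in> carrier B. \<exists>m\<in>M. x \<sqsubseteq> m \<squnion> a}"
  have J: "boolean_ideal B ?J"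
    unfolding boolean_ideal_def
  proof (intro conjI ballI impI)
    show "\<bottom> \<in> ?J" using M'(1,2) a(1) by (auto intro!: bexI[of _ "\<bottom>"])
  next
    fix x y assume x: "x \<in> ?J" and y: "y \<in> carrier B" "y \<sqsubseteq> x"
    then obtain m where "m \<in> M" "x \<sqsubseteq> m \<squnion> a" by blast
    then show "y \<in> ?J"
      using x y a M'(1) le_trans[of y x "m \<squnion> a"] by (auto simp: subset_iff)
  next
    fix x y assume "x \<in> ?J" "y \<in> ?J"
    then obtain m n where mn: "m \<in> M" "x \<sqsubseteq> m \<squnion> a" "n \<in> M" "y \<sqsubseteq> n \<squnion> a"
        "x \<in> carrier B" "y \<in> carrier B" by blast
    have c: "m \<in> carrier B" "n \<in> carrier B" using mn M'(1) by auto
    have "m \<squnion> a \<sqsubseteq> (m \<squnion> n) \<squnion> a" "n \<squnion> a \<sqsubseteq> (m \<squnion> n) \<squnion> a"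
      using c a by (meson join_closed join_le join_left join_right le_trans)+
    then have "x \<sqsubseteq> (m \<squnion> n) \<squnion> a" "y \<sqsubseteq> (m \<squnion> n) \<squnion> a"
      using mn c a by (meson join_closed le_trans)+
    then have "x \<squnion> y \<sqsubseteq> (m \<squnion> n) \<squnion> a"
      using mn c a by (meson join_closed join_le)
    then show "x \<squnion> y \<in> ?J" using mn M'(4) by auto
  qed auto
  have MJ: "M \<subseteq> ?J" using M'(1) a join_left by blast
  have aJ: "a \<in> ?J" using a(1) M'(2) join_right[OF bottom_closed a(1)] by blast
  have "\<top> \<in> ?J"
  proof (rule ccontr)
    assume "\<top> \<notin> ?J"
    then have "?J = M" using J MJ by (intro max)
    then show False using aJ a(2) by simp
  qed
  then obtain m where m: "m \<in> M" "\<top> \<sqsubseteq> m \<squnion> a" by blast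
  then have mB: "m \<in> carrier B" using M' by blast
  then have "a \<squnion> m = \<top>"
    using m a by (metis join_closed join_comm le_antisym top_closed top_higher)
  then have "bcompl B a \<sqsubseteq> m"
    using complement_unique[of a m "bcompl B a"] a mB by (simp add: bcompl)
  then show ?thesis by (rule M'(3)[OF m(1) bcompl_closed[OF a(1)]])
qed

text \<open>
  The complement of a maximal ideal is an ultrafilter.
\<close>

lemma ultrafilter_disjoint_ideal:
  assumes I: "boolean_ideal B I" "\<top> \<notin> I"
  obtains u where "boolean_ultrafilter B u" "u \<inter> I = {}"
proof -
  let ?S = "{J. boolean_ideal B J \<and> \<top> \<notin> J \<and> I \<subseteq> J}"
  have "\<exists>M\<in>?S. \<forall>J\<in>?S. M \<subseteq> J \<longrightarrow> J = M"
  proof (rule subset_Zorn_nonempty)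
    show "?S \<noteq> {}" using I by blast
    fix \<C> assume C: "\<C> \<noteq> {}" "subset.chain ?S \<C>"
    then have sub: "\<C> \<subseteq> ?S" and tot: "\<And>J K. \<lbrakk>J \<in> \<C>; K \<in> \<C>\<rbrakk> \<Longrightarrow> J \<subseteq> K \<or> K \<subseteq> J"
      unfolding subset.chain_def by auto
    have "boolean_ideal B (\<Union>\<C>)"
      unfolding boolean_ideal_def
    proof (intro conjI ballI impI)
      fix x y assume "x \<in> \<Union>\<C>" "y \<in> \<Union>\<C>"
      then obtain J where "J \<in> \<C>" "x \<in> J" "y \<in> J" using tot by blast
      then show "x \<squnion> y \<in> \<Union>\<C>" using sub unfolding boolean_ideal_def by blast
    next
      show "\<Union>\<C> \<subseteq> carrier B" "\<bottom> \<in> \<Union>\<C>"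
        using C(1) sub unfolding boolean_ideal_def by blast+
    next
      fix x y assume "x \<in> \<Union>\<C>" "y \<in> carrier B" "y \<sqsubseteq> x"
      then show "y \<in> \<Union>\<C>" using sub unfolding boolean_ideal_def by blast
    qed
    then show "\<Union>\<C> \<in> ?S" using C(1) sub by blast
  qed
  then obtain M where "M \<in> ?S" and mx: "\<forall>J\<in>?S. M \<subseteq> J \<longrightarrow> J = M"
    by (rule bexE)
  then have M: "boolean_ideal B M" "\<top> \<notin> M" "I \<subseteq> M"
    by simp_all
  have max: "J = M" if "boolean_ideal B J" "\<top> \<notin> J" "M \<subseteq> J" for J
    using mx that order_trans[OF M(3) that(3)] by simp
  have M': "M \<subseteq> carrier B" "\<bottom> \<in> M" "\<And>x y. \<lbrakk>x \<in> M; y \<in> carrier B; y \<sqsubseteq> x\<rbrakk> \<Longrightarrow> y \<in> M"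
      "\<And>x y. \<lbrakk>x \<in> M; y \<in> M\<rbrakk> \<Longrightarrow> x \<squnion> y \<in> M"
    using M(1) unfolding boolean_ideal_def by auto
  note compl = maximal_ideal_complement[OF M(1,2) max]
  have "boolean_ultrafilter B (carrier B - M)"
    unfolding boolean_ultrafilter_def
  proof (intro conjI ballI impI)
    fix a b assume a: "a \<in> carrier B - M" and b: "b \<in> carrier B - M"
    have "bcompl B a \<in> M" using a compl by blast
    show "a \<sqinter> b \<in> carrier B - M"
    proof (rule ccontr)
      assume "a \<sqinter> b \<notin> carrier B - M"
      then have "(a \<sqinter> b) \<squnion> bcompl B a \<in> M"
        using a b \<open>bcompl B a \<in> M\<close> M'(4) by auto
      moreover have "b \<sqsubseteq> (a \<sqinter> b) \<squnion> bcompl B a"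
      proof -
        have "bcompl B a \<sqinter> b \<sqsubseteq> bcompl B a"
          using a b by (intro meet_left bcompl_closed) auto
        then have "(a \<sqinter> b) \<squnion> (bcompl B a \<sqinter> b) \<sqsubseteq> (a \<sqinter> b) \<squnion> bcompl B a"
          using a b le_trans[OF _ join_right[of "a \<sqinter> b" "bcompl B a"], of "bcompl B a \<sqinter> b"]
          by (intro join_le) (auto simp: join_left bcompl_closed)
        then show ?thesis using a b by (simp add: meet_split)
      qed
      ultimately have "b \<in> M"
        using b M'(3)[of "(a \<sqinter> b) \<squnion> bcompl B a" b] by blast
      then show False using b by simp
    qed
  next
    fix a assume a: "a \<in> carrier B"
    show "a \<in> carrier B - M \<or> bcompl B a \<in> carrier B - M"
      using a M'(4)[of a "bcompl B a"] M(2) by (auto simp: bcompl_closed join_bcompl)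
  next
    fix a b assume "a \<in> carrier B - M" "b \<in> carrier B" "a \<sqsubseteq> b"
    then show "b \<in> carrier B - M" using M'(3)[of b a] by blast
  qed (use M'(2) in auto)
  moreover have "(carrier B - M) \<inter> I = {}" using M(3) by blast
  ultimately show thesis by (rule that)
qed

end

section \<open>Bounded clusters\<close>

context contact_algebra
begin

lemma contact_mono:
  assumes "contact B a b" "b \<sqsubseteq> c" "a \<in> carrier B" "b \<in> carrier B" "c \<in> carrier B"
  shows "contact B a c"
  using assms C4[of a b c] le_iff_meet[of b c] by simp

lemma contact_mono2:
  assumes "contact B a b" "a \<sqsubseteq> a'" "b \<sqsubseteq> b'"
    "a \<in> carrier B" "b \<in> carrier B" "a' \<in> carrier B" "b' \<in> carrier B"
  shows "contact B a' b'"
  using assms by (meson C3 contact_mono)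

lemma contact_if_meet:
  assumes "a \<in> carrier B" "b \<in> carrier B" "a \<sqinter> b \<noteq> \<bottom>"
  shows "contact B a b"
  using contact_mono2[OF C1[of "a \<sqinter> b"]] assms by (simp add: meet_left meet_right)

text \<open>
  In the algebra of regular closed sets of a space, an ultrafilter with a compact member converges
  to one point, and \<open>cluster_of\<close> is the family of all regular closed sets through this point.
\<close>

definition cluster_of :: "'a set \<Rightarrow> 'a set" where
  "cluster_of u = {a \<in> carrier B. \<forall>b\<in>u. contact B a b}"

lemma ultrafilter_subset_cluster_of: "boolean_ultrafilter B u \<Longrightarrow> u \<subseteq> cluster_of u"
  unfolding cluster_of_def boolean_ultrafilter_def
  by (smt (verit) CollectI contact_if_meet subset_iff)

lemma top_mem_ultrafilter: "boolean_ultrafilter B u \<Longrightarrow> \<top> \<in> u"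
  unfolding boolean_ultrafilter_def using bcompl_top by (metis top_closed)

text \<open>
  If \<open>c\<close> and \<open>d\<close> are members of \<open>u\<close> that witness that \<open>a\<close> and \<open>b\<close> are not in the cluster, then
  \<open>c \<sqinter> d\<close> is a witness for \<open>a \<squnion> b\<close>.
\<close>

lemma cluster_of_join_iff:
  assumes u: "boolean_ultrafilter B u" and ab: "a \<in> carrier B" "b \<in> carrier B"
  shows "a \<squnion> b \<in> cluster_of u \<longleftrightarrow> a \<in> cluster_of u \<or> b \<in> cluster_of u"
proof
  have uB: "u \<subseteq> carrier B" "\<And>c d. \<lbrakk>c \<in> u; d \<in> u\<rbrakk> \<Longrightarrow> c \<sqinter> d \<in> u"
    using u unfolding boolean_ultrafilter_def by auto
  have join: "contact B (a \<squnion> b) c \<longleftrightarrow> contact B a c \<or> contact B b c" if "c \<in> carrier B" for c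
    using C4[of c a b] C3 ab that by (metis join_closed)
  assume L: "a \<squnion> b \<in> cluster_of u"
  show "a \<in> cluster_of u \<or> b \<in> cluster_of u"
  proof (rule ccontr)
    assume "\<not> ?thesis"
    then obtain c d where cd: "c \<in> u" "d \<in> u" "\<not> contact B a c" "\<not> contact B b d"
      using ab unfolding cluster_of_def by blast
    have "c \<sqinter> d \<in> u" "c \<in> carrier B" "d \<in> carrier B" using cd uB by auto
    then have "contact B a (c \<sqinter> d) \<or> contact B b (c \<sqinter> d)"
      using L join uB(1) unfolding cluster_of_def by blast
    then show False
      using cd ab \<open>c \<in> carrier B\<close> \<open>d \<in> carrier B\<close>
      by (meson contact_mono meet_closed meet_left meet_right)
  qed
next
  assume L: "a \<in> cluster_of u \<or> b \<in> cluster_of u"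
  show "a \<squnion> b \<in> cluster_of u"
    unfolding cluster_of_def
  proof (intro CollectI conjI ballI)
    fix c assume "c \<in> u"
    then have c: "c \<in> carrier B" "contact B a c \<or> contact B b c"
      using u L unfolding boolean_ultrafilter_def cluster_of_def by auto
    then show "contact B (a \<squnion> b) c"
      using ab contact_mono2[of a c "a \<squnion> b" c] contact_mono2[of b c "a \<squnion> b" c]
      by (auto simp: join_left join_right)
  qed (use ab in simp)
qed

end

context local_contact_algebra
begin

lemma bdd_closed: "a \<in> bdd B \<Longrightarrow> a \<in> carrier B"
  using bdd_ideal unfolding boolean_ideal_def by blast

lemma bdd_downward: "\<lbrakk>a \<in> bdd B; b \<in> carrier B; b \<sqsubseteq> a\<rbrakk> \<Longrightarrow> b \<in> bdd B"
  using bdd_ideal unfolding boolean_ideal_def by blast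

lemma bdd_meet: "\<lbrakk>a \<in> bdd B; b \<in> carrier B\<rbrakk> \<Longrightarrow> a \<sqinter> b \<in> bdd B"
  using bdd_downward bdd_closed by (meson meet_closed meet_left)

text \<open>
  The requirement that \<open>u\<close> has a bounded member excludes the point at infinity of the one-point
  compactification.
\<close>

definition clusters :: "'a set set" where
  "clusters = cluster_of ` {u. boolean_ultrafilter B u \<and> u \<inter> bdd B \<noteq> {}}"

lemma bdd_interpolation:
  assumes "a \<in> bdd B" "b \<in> carrier B" "\<not> contact B a b"
  obtains c where "c \<in> bdd B" "\<not> contact B a (bcompl B c)" "\<not> contact B c b"
proof -
  have "well_inside B a (bcompl B b)"
    using assms by (simp add: well_inside_def bcompl_bcompl)
  then obtain c where "c \<in> bdd B" "well_inside B a c" "well_inside B c (bcompl B b)"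
    using BC1[OF assms(1) bcompl_closed[OF assms(2)]] by blast
  then show thesis using that assms(2) by (simp add: well_inside_def bcompl_bcompl)
qed

text \<open>
  If \<open>j\<close> is a bounded member of \<open>u\<close>, then \<open>j\<close> is well inside \<open>\<top>\<close>, and (BC1) inserts a bounded \<open>k\<close>
  between them. As the complement of \<open>k\<close> is not in the cluster, \<open>k\<close> is a bounded neighbourhood
  of the point that the cluster stands for.
\<close>

lemma cluster_bounded:
  assumes "\<sigma> \<in> clusters"
  obtains k where "k \<in> bdd B" "bcompl B k \<notin> \<sigma>"
proof -
  obtain u j where u: "boolean_ultrafilter B u" "j \<in> u" "j \<in> bdd B" "\<sigma> = cluster_of u"
    using assms unfolding clusters_def by blast
  have "\<not> contact B j \<bottom>" using C2[of j \<bottom>] bdd_closed u by auto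
  then obtain k where k: "k \<in> bdd B" "\<not> contact B j (bcompl B k)"
    using bdd_interpolation[of j \<bottom>] u by blast
  have "bcompl B k \<notin> \<sigma>"
    using k u C3[of "bcompl B k" j] bdd_closed bcompl_closed unfolding cluster_of_def by blast
  then show thesis using that k by blast
qed

lemma cluster_closed: "\<lbrakk>\<sigma> \<in> clusters; a \<in> \<sigma>\<rbrakk> \<Longrightarrow> a \<in> carrier B"
  unfolding clusters_def cluster_of_def by auto

lemma cluster_join_iff:
  "\<lbrakk>\<sigma> \<in> clusters; a \<in> carrier B; b \<in> carrier B\<rbrakk> \<Longrightarrow> a \<squnion> b \<in> \<sigma> \<longleftrightarrow> a \<in> \<sigma> \<or> b \<in> \<sigma>"
  using cluster_of_join_iff unfolding clusters_def by blast

lemma cluster_upward: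
  "\<lbrakk>\<sigma> \<in> clusters; a \<in> \<sigma>; b \<in> carrier B; a \<sqsubseteq> b\<rbrakk> \<Longrightarrow> b \<in> \<sigma>"
  using cluster_join_iff[of \<sigma> a b] cluster_closed[of \<sigma> a] le_iff_meet[of a b] by simp

lemma top_mem_cluster: "\<sigma> \<in> clusters \<Longrightarrow> \<top> \<in> \<sigma>"
  unfolding clusters_def using top_mem_ultrafilter ultrafilter_subset_cluster_of by blast

lemma bottom_notin_cluster: "\<sigma> \<in> clusters \<Longrightarrow> \<bottom> \<notin> \<sigma>"
  unfolding clusters_def cluster_of_def
  using top_mem_ultrafilter C2[of \<bottom> \<top>] by auto

lemma cluster_bdd_part:
  assumes \<sigma>: "\<sigma> \<in> clusters" and a: "a \<in> \<sigma>"
  obtains k where "k \<in> bdd B" "k \<in> \<sigma>" "k \<sqsubseteq> a"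
proof -
  obtain k where k: "k \<in> bdd B" "bcompl B k \<notin> \<sigma>" using cluster_bounded[OF \<sigma>] .
  have c: "a \<in> carrier B" "k \<in> carrier B" "bcompl B k \<in> carrier B"
    using k a \<sigma> cluster_closed bdd_closed bcompl_closed by auto
  have "bcompl B k \<sqinter> a \<notin> \<sigma>"
    using cluster_upward[OF \<sigma>, of "bcompl B k \<sqinter> a" "bcompl B k"] k c by (meson meet_left)
  then have "k \<sqinter> a \<in> \<sigma>"
    using cluster_join_iff[OF \<sigma>, of "k \<sqinter> a" "bcompl B k \<sqinter> a"] meet_split[of a k] a c by simp
  then show thesis using that[of "k \<sqinter> a"] k c bdd_meet meet_right by blast
qed

text \<open>
  If \<open>a\<close> and \<open>b\<close> were not in contact, one could assume \<open>a\<close> to be bounded by \<open>cluster_bdd_part\<close>.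
  By (BC1) some \<open>d\<close> is not in contact with \<open>b\<close> while its complement is not in contact with \<open>a\<close>; one
  of the two belongs to the ultrafilter, so \<open>b\<close> or \<open>a\<close> is not in the cluster.
\<close>

lemma cluster_contact:
  assumes \<sigma>: "\<sigma> \<in> clusters" and ab: "a \<in> \<sigma>" "b \<in> \<sigma>"
  shows "contact B a b"
proof (rule ccontr)
  assume n: "\<not> contact B a b"
  obtain u where u: "boolean_ultrafilter B u" "\<sigma> = cluster_of u"
    using \<sigma> unfolding clusters_def by blast
  have c: "a \<in> carrier B" "b \<in> carrier B" using ab \<sigma> cluster_closed by auto
  obtain k where k: "k \<in> bdd B" "k \<in> \<sigma>" "k \<sqsubseteq> a" using cluster_bdd_part[OF \<sigma> ab(1)] .
  have kB: "k \<in> carrier B" using k bdd_closed by blast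
  have "\<not> contact B k b" using n k c kB contact_mono2[of k b a b] by blast
  then obtain d where d: "d \<in> bdd B" "\<not> contact B k (bcompl B d)" "\<not> contact B d b"
    using bdd_interpolation[OF k(1) c(2)] by blast
  have dB: "d \<in> carrier B" using d bdd_closed by blast
  have "d \<in> u \<or> bcompl B d \<in> u"
    using u(1) dB unfolding boolean_ultrafilter_def by blast
  then show False
    using d k(2) ab(2) u(2) C3[of b d] c dB unfolding cluster_of_def by blast
qed

lemma cluster_maximal:
  assumes "\<sigma> \<in> clusters" "a \<in> carrier B" "\<And>b. b \<in> \<sigma> \<Longrightarrow> contact B a b"
  shows "a \<in> \<sigma>"
proof -
  obtain u where "boolean_ultrafilter B u" "\<sigma> = cluster_of u"
    using assms(1) unfolding clusters_def by blast
  then show ?thesis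
    using assms(2,3) ultrafilter_subset_cluster_of[of u] unfolding cluster_of_def by simp blast
qed

text \<open>
  The points common to \<open>a\<close> and \<open>b\<close>. By (BC2), \<open>b\<close> can be replaced by a bounded \<open>d\<close> below it. The
  elements \<open>x\<close> for which \<open>a\<close> is not in contact with \<open>x \<sqinter> d\<close> form a proper ideal, and an ultrafilter
  that avoids this ideal contains \<open>d\<close> and only elements in contact with \<open>a\<close>.
\<close>

lemma contact_imp_cluster:
  assumes ab: "a \<in> carrier B" "b \<in> carrier B" "contact B a b"
  obtains \<sigma> where "\<sigma> \<in> clusters" "a \<in> \<sigma>" "b \<in> \<sigma>"
proof -
  obtain c where c: "c \<in> bdd B" "contact B a (c \<sqinter> b)" using BC2[OF ab] by blast
  define d where "d = c \<sqinter> b"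
  have d: "d \<in> bdd B" "d \<in> carrier B" "contact B a d" "d \<sqsubseteq> b"
    using c ab bdd_meet bdd_closed meet_right unfolding d_def by auto
  let ?I = "{x \<in> carrier B. \<not> contact B a (x \<sqinter> d)}"
  have "boolean_ideal B ?I"
    unfolding boolean_ideal_def
  proof (intro conjI ballI impI)
    have "\<bottom> \<sqinter> d = \<bottom>" using d by (simp add: le_antisym meet_left)
    then show "\<bottom> \<in> ?I" using C2[of a \<bottom>] ab by auto
  next
    fix x y assume x: "x \<in> ?I" and y: "y \<in> carrier B" "y \<sqsubseteq> x"
    have "y \<sqinter> d \<sqsubseteq> x \<sqinter> d"
      using x y d by (intro meet_mono_left) auto
    then show "y \<in> ?I" using x y d ab contact_mono[of a "y \<sqinter> d" "x \<sqinter> d"] by auto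
  next
    fix x y assume "x \<in> ?I" "y \<in> ?I"
    then show "x \<squnion> y \<in> ?I"
      using d ab C4[of a "x \<sqinter> d" "y \<sqinter> d"] by (simp add: meet_join_distrib_right)
  qed auto
  moreover have "\<top> \<sqinter> d = d" using d by (metis le_iff_join meet_comm top_closed top_higher)
  then have "\<top> \<notin> ?I" using d by simp
  ultimately obtain u where u: "boolean_ultrafilter B u" "u \<inter> ?I = {}"
    using ultrafilter_disjoint_ideal by blast
  have "bcompl B d \<sqinter> d = \<bottom>" using d by (simp add: meet_comm meet_bcompl)
  then have "bcompl B d \<in> ?I" using d ab C2[of a \<bottom>] by (auto simp: bcompl_closed)
  then have du: "d \<in> u" using u d unfolding boolean_ultrafilter_def by blast
  then have "b \<in> u" using u d ab unfolding boolean_ultrafilter_def by blast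
  then have "b \<in> cluster_of u" using u ultrafilter_subset_cluster_of by blast
  moreover have "a \<in> cluster_of u"
    unfolding cluster_of_def
  proof (intro CollectI conjI ballI)
    fix x assume "x \<in> u"
    then have "x \<in> carrier B" "contact B a (x \<sqinter> d)"
      using u unfolding boolean_ultrafilter_def by blast+
    then show "contact B a x" using ab d by (meson contact_mono meet_closed meet_left)
  qed (rule ab)
  moreover have "cluster_of u \<in> clusters" using u du d unfolding clusters_def by blast
  ultimately show thesis using that by blast
qed

text \<open>
  Algebraic form of the Hausdorff property: \<open>c\<close> and its complement are represented by two closed
  sets that cover the space, of which the first misses \<open>\<tau>\<close> and the second misses \<open>\<sigma>\<close>.
\<close>

lemma cluster_separation:
  assumes \<sigma>: "\<sigma> \<in> clusters" and \<tau>: "\<tau> \<in> clusters" and a: "a \<in> \<sigma>" "a \<notin> \<tau>"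
  obtains c where "c \<in> carrier B" "bcompl B c \<notin> \<sigma>" "c \<notin> \<tau>"
proof -
  have aB: "a \<in> carrier B" using a \<sigma> cluster_closed by blast
  obtain b where b: "b \<in> \<tau>" "\<not> contact B a b" using cluster_maximal[OF \<tau> aB] a by blast
  have bB: "b \<in> carrier B" using b \<tau> cluster_closed by blast
  obtain k where k: "k \<in> bdd B" "k \<in> \<sigma>" "k \<sqsubseteq> a" using cluster_bdd_part[OF \<sigma> a(1)] .
  have "\<not> contact B k b" using b(2) k aB bB bdd_closed contact_mono2[of k b a b] by blast
  then obtain c where "c \<in> bdd B" "\<not> contact B k (bcompl B c)" "\<not> contact B c b"
    using bdd_interpolation[OF k(1) bB] by blast
  then show thesis
    using that[of c] k(2) b(1) cluster_contact \<sigma> \<tau> bdd_closed by blast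
qed

end

section \<open>The space of bounded clusters\<close>

text \<open>
  The points are labels of the clusters instead of the clusters themselves, so that the space can be
  built on the type of the elements of the algebra.
\<close>

locale cluster_space = local_contact_algebra B + complete_lattice B
  for B :: "('a, 'b) local_contact_struct_scheme" (structure) +
  fixes P :: "'x set" and pt :: "'x \<Rightarrow> 'a set"
  assumes bij_pt: "bij_betw pt P clusters"
begin

definition pts :: "'a \<Rightarrow> 'x set" where
  "pts a = {p \<in> P. a \<in> pt p}"

text \<open>
  The sets \<open>pts a\<close> are the base of closed sets. They are closed under finite unions by \<open>pts_join\<close>.
\<close>

definition cluster_topology :: "'x topology" where
  "cluster_topology =
     topology (\<lambda>U. U \<subseteq> P \<and> (\<forall>p\<in>U. \<exists>a\<in>carrier B. p \<notin> pts a \<and> P - pts a \<subseteq> U))"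

lemma pt_cluster: "p \<in> P \<Longrightarrow> pt p \<in> clusters"
  using bij_pt by (auto simp: bij_betw_def)

lemma cluster_point: "\<sigma> \<in> clusters \<Longrightarrow> \<exists>p\<in>P. pt p = \<sigma>"
  by (metis bij_betw_imp_surj_on bij_pt imageE)

lemma pts_subset: "pts a \<subseteq> P"
  unfolding pts_def by blast

lemma pts_join: "\<lbrakk>a \<in> carrier B; b \<in> carrier B\<rbrakk> \<Longrightarrow> pts (a \<squnion> b) = pts a \<union> pts b"
  unfolding pts_def using cluster_join_iff pt_cluster by blast

lemma pts_bottom: "pts \<bottom> = {}"
  unfolding pts_def using bottom_notin_cluster pt_cluster by blast

lemma pts_top: "pts \<top> = P"
  unfolding pts_def using top_mem_cluster pt_cluster by blast

lemma pts_bcompl: "a \<in> carrier B \<Longrightarrow> P - pts (bcompl B a) \<subseteq> pts a"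
  using pts_join[of a "bcompl B a"] by (auto simp: bcompl_closed join_bcompl pts_top)

lemma contact_pts_iff:
  "\<lbrakk>a \<in> carrier B; b \<in> carrier B\<rbrakk> \<Longrightarrow> contact B a b \<longleftrightarrow> pts a \<inter> pts b \<noteq> {}"
proof
  assume "a \<in> carrier B" "b \<in> carrier B" "contact B a b"
  then obtain \<sigma> where "\<sigma> \<in> clusters" "a \<in> \<sigma>" "b \<in> \<sigma>" by (rule contact_imp_cluster)
  then show "pts a \<inter> pts b \<noteq> {}" using cluster_point unfolding pts_def by blast
qed (use cluster_contact pt_cluster in \<open>auto simp: pts_def\<close>)

text \<open>
  If \<open>a \<sqsubseteq> b\<close> fails, then by (BC3) some \<open>d \<noteq> \<bottom>\<close> is well inside \<open>a \<sqinter> bcompl B b\<close>. A point of \<open>d\<close>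
  belongs to \<open>a\<close>, and not to \<open>b\<close>, since \<open>d\<close> and \<open>b\<close> are not in contact.
\<close>

lemma pts_le_iff:
  assumes ab: "a \<in> carrier B" "b \<in> carrier B"
  shows "a \<sqsubseteq> b \<longleftrightarrow> pts a \<subseteq> pts b"
proof
  assume "a \<sqsubseteq> b"
  then show "pts a \<subseteq> pts b" unfolding pts_def using ab cluster_upward pt_cluster by blast
next
  assume sub: "pts a \<subseteq> pts b"
  show "a \<sqsubseteq> b"
  proof (rule ccontr)
    let ?c = "a \<sqinter> bcompl B b"
    assume "\<not> a \<sqsubseteq> b"
    then have c: "?c \<in> carrier B" "?c \<noteq> \<bottom>"
      using ab by (simp_all add: le_iff_meet_bcompl bcompl_closed)
    then obtain d where d: "d \<in> bdd B" "d \<noteq> \<bottom>" "\<not> contact B d (bcompl B ?c)"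
      using BC3 unfolding well_inside_def by blast
    have dB: "d \<in> carrier B" using d bdd_closed by blast
    then obtain p where p: "p \<in> P" "d \<in> pt p"
      using C1[of d] d contact_pts_iff[of d d] unfolding pts_def by blast
    have dc: "d \<sqsubseteq> ?c"
    proof (rule ccontr)
      assume "\<not> d \<sqsubseteq> ?c"
      then show False
        using d c dB contact_if_meet by (simp add: le_iff_meet_bcompl bcompl_closed)
    qed
    then have "d \<sqsubseteq> a" using ab dB c by (meson bcompl_closed le_trans meet_left)
    then have "b \<in> pt p"
      using sub p ab cluster_upward[OF pt_cluster[OF p(1)] p(2)] unfolding pts_def by blast
    moreover have "b \<sqsubseteq> bcompl B ?c"
    proof -
      have "?c \<sqsubseteq> bcompl B b" using ab by (simp add: bcompl_closed meet_right)
      then have "bcompl B (bcompl B b) \<sqsubseteq> bcompl B ?c"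
        using ab c by (intro bcompl_mono) (auto simp: bcompl_closed)
      then show ?thesis using ab by (simp add: bcompl_bcompl)
    qed
    ultimately have "contact B d b" "\<not> contact B d b"
      using cluster_contact[OF pt_cluster[OF p(1)] p(2)] d(3) dB ab c
        contact_mono[of d b "bcompl B ?c"] by (auto simp: bcompl_closed)
    then show False by blast
  qed
qed

lemma openin_cluster_topology:
  "openin cluster_topology U \<longleftrightarrow>
     U \<subseteq> P \<and> (\<forall>p\<in>U. \<exists>a\<in>carrier B. p \<notin> pts a \<and> P - pts a \<subseteq> U)"
proof -
  have "istopology (\<lambda>U. U \<subseteq> P \<and> (\<forall>p\<in>U. \<exists>a\<in>carrier B. p \<notin> pts a \<and> P - pts a \<subseteq> U))"
    unfolding istopology_def
  proof (intro conjI allI impI)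
    fix S T
    assume S: "S \<subseteq> P \<and> (\<forall>p\<in>S. \<exists>a\<in>carrier B. p \<notin> pts a \<and> P - pts a \<subseteq> S)"
      and T: "T \<subseteq> P \<and> (\<forall>p\<in>T. \<exists>a\<in>carrier B. p \<notin> pts a \<and> P - pts a \<subseteq> T)"
    show "S \<inter> T \<subseteq> P" using S by blast
    show "\<forall>p\<in>S \<inter> T. \<exists>a\<in>carrier B. p \<notin> pts a \<and> P - pts a \<subseteq> S \<inter> T"
    proof
      fix p assume "p \<in> S \<inter> T"
      then obtain a b where "a \<in> carrier B" "p \<notin> pts a" "P - pts a \<subseteq> S"
          "b \<in> carrier B" "p \<notin> pts b" "P - pts b \<subseteq> T"
        using S T by blast
      then show "\<exists>a\<in>carrier B. p \<notin> pts a \<and> P - pts a \<subseteq> S \<inter> T"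
        by (intro bexI[of _ "a \<squnion> b"]) (auto simp: pts_join)
    qed
  next
    fix \<K>
    assume K: "\<forall>S\<in>\<K>. S \<subseteq> P \<and> (\<forall>p\<in>S. \<exists>a\<in>carrier B. p \<notin> pts a \<and> P - pts a \<subseteq> S)"
    then show "\<Union>\<K> \<subseteq> P" by (simp add: Sup_le_iff)
    show "\<forall>p\<in>\<Union>\<K>. \<exists>a\<in>carrier B. p \<notin> pts a \<and> P - pts a \<subseteq> \<Union>\<K>"
    proof
      fix p assume "p \<in> \<Union>\<K>"
      then obtain S where S: "S \<in> \<K>" "p \<in> S" by blast
      then obtain a where "a \<in> carrier B" "p \<notin> pts a" "P - pts a \<subseteq> S" using K by blast
      then show "\<exists>a\<in>carrier B. p \<notin> pts a \<and> P - pts a \<subseteq> \<Union>\<K>"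
        using S(1) by (meson Sup_upper order_trans)
    qed
  qed
  then show ?thesis unfolding cluster_topology_def by (simp add: topology_inverse')
qed

lemma topspace_cluster_topology: "topspace cluster_topology = P"
proof -
  have "openin cluster_topology P"
    unfolding openin_cluster_topology
    by (auto intro!: bexI[of _ "\<bottom>"] simp: pts_bottom)
  then show ?thesis
    using openin_cluster_topology by (metis openin_subset openin_topspace subset_antisym)
qed

lemma openin_co_pts: "a \<in> carrier B \<Longrightarrow> openin cluster_topology (P - pts a)"
  unfolding openin_cluster_topology by blast

lemma closedin_pts: "a \<in> carrier B \<Longrightarrow> closedin cluster_topology (pts a)"
  by (simp add: closedin_def topspace_cluster_topology pts_subset openin_co_pts)

lemma interior_of_pts:
  assumes a: "a \<in> carrier B"
  shows "cluster_topology interior_of (pts a) = P - pts (bcompl B a)"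
proof (rule interior_of_unique)
  show "P - pts (bcompl B a) \<subseteq> pts a" by (rule pts_bcompl[OF a])
  show "openin cluster_topology (P - pts (bcompl B a))"
    by (rule openin_co_pts[OF bcompl_closed[OF a]])
  fix U assume U: "U \<subseteq> pts a" "openin cluster_topology U"
  show "U \<subseteq> P - pts (bcompl B a)"
  proof
    fix p assume p: "p \<in> U"
    then obtain b where b: "b \<in> carrier B" "p \<notin> pts b" "P - pts b \<subseteq> U"
      using U(2) unfolding openin_cluster_topology by blast
    have "pts \<top> \<subseteq> pts (a \<squnion> b)"
      using b U(1) a by (auto simp: pts_join pts_top)
    then have "\<top> \<sqsubseteq> a \<squnion> b" using a b by (simp add: pts_le_iff)
    then have "a \<squnion> b = \<top>" using a b by (simp add: le_antisym)
    then have "bcompl B a \<sqsubseteq> b"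
      using a b complement_unique[of a b "bcompl B a"] by (simp add: bcompl)
    then have "pts (bcompl B a) \<subseteq> pts b"
      using a b by (simp add: bcompl_closed flip: pts_le_iff)
    then show "p \<in> P - pts (bcompl B a)" using b U pts_subset p by blast
  qed
qed

lemma closure_of_co_pts:
  assumes a: "a \<in> carrier B"
  shows "cluster_topology closure_of (P - pts a) = pts (bcompl B a)"
proof -
  have "cluster_topology closure_of (P - pts a) = P - (P - pts (bcompl B a))"
    using closure_of_complement[of cluster_topology "pts a"]
    by (simp add: topspace_cluster_topology interior_of_pts a)
  then show ?thesis using pts_subset by blast
qed

lemma pts_regular_closed: "a \<in> carrier B \<Longrightarrow> pts a \<in> regular_closed_sets cluster_topology"
  unfolding regular_closed_iff
  by (simp add: interior_of_pts closure_of_co_pts bcompl_closed bcompl_bcompl)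

text \<open>
  This is where completeness of the algebra is used. The interior of \<open>F\<close> is a union of sets
  \<open>P - pts b\<close>, whose closures are \<open>pts (bcompl B b)\<close>; the join of these complements represents \<open>F\<close>.
\<close>

lemma regular_closed_is_pts:
  assumes F: "F \<in> regular_closed_sets cluster_topology"
  shows "\<exists>a\<in>carrier B. F = pts a"
proof -
  let ?U = "cluster_topology interior_of F"
  have U: "openin cluster_topology ?U" by simp
  define S where "S = {bcompl B b |b. b \<in> carrier B \<and> P - pts b \<subseteq> ?U}"
  have S: "S \<subseteq> carrier B" unfolding S_def using bcompl_closed by blast
  let ?a = "\<Squnion>S"
  have a: "?a \<in> carrier B" using S by (rule sup_closed)
  have "?U \<subseteq> pts ?a"
  proof
    fix p assume p: "p \<in> ?U"
    then obtain b where b: "b \<in> carrier B" "p \<notin> pts b" "P - pts b \<subseteq> ?U"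
      using U unfolding openin_cluster_topology by blast
    then have bS: "bcompl B b \<in> S" unfolding S_def by blast
    have "pts (bcompl B b) \<subseteq> pts ?a"
      using pts_le_iff[of "bcompl B b" ?a] sup_upper[OF S bS] a S bS by auto
    moreover have "P - pts b \<subseteq> pts (bcompl B b)"
      using pts_bcompl[OF bcompl_closed[OF b(1)]] b(1) by (simp add: bcompl_bcompl)
    moreover have "p \<in> P" using p U openin_cluster_topology by blast
    ultimately show "p \<in> pts ?a" using b by blast
  qed
  then have 1: "F \<subseteq> pts ?a"
    using F closedin_pts[OF a] by (metis closure_of_minimal regular_closed_iff)
  have 2: "pts ?a \<subseteq> F"
  proof
    fix p assume p: "p \<in> pts ?a"
    show "p \<in> F"
    proof (rule ccontr)
      assume "p \<notin> F"
      moreover have "openin cluster_topology (P - F)"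
        using regular_closed_closedin[OF F] by (simp add: closedin_def topspace_cluster_topology)
      moreover have "p \<in> P" using p pts_subset by blast
      ultimately obtain c where c: "c \<in> carrier B" "p \<notin> pts c" "P - pts c \<subseteq> P - F"
        unfolding openin_cluster_topology by blast
      have "F \<subseteq> P" using regular_closed_subset[OF F] topspace_cluster_topology by simp
      then have Fc: "F \<subseteq> pts c" using c(3) by blast
      have "?a \<sqsubseteq> c"
      proof (rule sup_least[OF S c(1)])
        fix x assume "x \<in> S"
        then obtain b where b: "b \<in> carrier B" "P - pts b \<subseteq> ?U" "x = bcompl B b"
          unfolding S_def by blast
        have "P - pts b \<subseteq> pts c"
          by (rule order_trans[OF b(2) order_trans[OF interior_of_subset Fc]])
        then have "pts (bcompl B b) \<subseteq> pts c"
          using closure_of_minimal[OF _ closedin_pts[OF c(1)], of "P - pts b"]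
          by (simp add: closure_of_co_pts[OF b(1)])
        then show "x \<sqsubseteq> c" using b c by (simp add: pts_le_iff bcompl_closed)
      qed
      then have "pts ?a \<subseteq> pts c" using a c by (simp flip: pts_le_iff)
      then show False using p c by blast
    qed
  qed
  show ?thesis using a 1 2 by blast
qed

lemma point_bdd_neighbourhood:
  assumes "p \<in> P"
  obtains k where "k \<in> bdd B" "p \<in> P - pts (bcompl B k)"
  using cluster_bounded[OF pt_cluster[OF assms]] assms unfolding pts_def by blast

text \<open>
  Let a family of open sets cover \<open>pts a\<close>. The elements \<open>x\<close> such that \<open>pts (x \<sqinter> a)\<close> is covered by
  finitely many of them form an ideal. If it is proper, an ultrafilter \<open>u\<close> avoids it; \<open>u\<close> contains
  the bounded element \<open>a\<close>, so it determines a point of \<open>pts a\<close>. Some member of the cover contains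
  \<open>P - pts c\<close>, where the point is outside \<open>pts c\<close>; then some \<open>b\<close> in \<open>u\<close> is not in contact with \<open>c\<close>,
  and \<open>pts b\<close> is covered by a single member, contrary to the choice of \<open>u\<close>.
\<close>

lemma compactin_pts:
  assumes a: "a \<in> bdd B"
  shows "compactin cluster_topology (pts a)"
  unfolding compactin_def
proof (intro conjI allI impI)
  show "pts a \<subseteq> topspace cluster_topology" by (simp add: topspace_cluster_topology pts_subset)
  fix \<U> assume "(\<forall>U\<in>\<U>. openin cluster_topology U) \<and> pts a \<subseteq> \<Union>\<U>"
  then have op: "\<And>U. U \<in> \<U> \<Longrightarrow> openin cluster_topology U" and cov: "pts a \<subseteq> \<Union>\<U>" by auto
  have aB: "a \<in> carrier B" using a bdd_closed by blast
  define fin where "fin T \<longleftrightarrow> (\<exists>\<F>. finite \<F> \<and> \<F> \<subseteq> \<U> \<and> T \<subseteq> \<Union>\<F>)" for T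
  have fin_mono: "fin T" if "fin T'" "T \<subseteq> T'" for T T' using that unfolding fin_def by blast
  have fin_Un: "fin (T \<union> T')" if T: "fin T" "fin T'" for T T'
  proof -
    obtain \<F> \<G> where "finite \<F>" "\<F> \<subseteq> \<U>" "T \<subseteq> \<Union>\<F>" "finite \<G>" "\<G> \<subseteq> \<U>" "T' \<subseteq> \<Union>\<G>"
      using T unfolding fin_def by blast
    then show ?thesis unfolding fin_def by (intro exI[of _ "\<F> \<union> \<G>"]) auto
  qed
  have "fin (pts a)"
  proof (rule ccontr)
    assume nfin: "\<not> fin (pts a)"
    let ?I = "{x \<in> carrier B. fin (pts (x \<sqinter> a))}"
    have "boolean_ideal B ?I"
      unfolding boolean_ideal_def
    proof (intro conjI ballI impI)
      have "\<bottom> \<sqinter> a = \<bottom>" using aB by (simp add: le_antisym meet_left)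
      then show "\<bottom> \<in> ?I" by (auto simp: pts_bottom fin_def)
    next
      fix x y assume x: "x \<in> ?I" and y: "y \<in> carrier B" "y \<sqsubseteq> x"
      have "y \<sqinter> a \<sqsubseteq> x \<sqinter> a"
        using x y aB by (intro meet_mono_left) auto
      then show "y \<in> ?I" using x y aB fin_mono by (auto simp: pts_le_iff)
    next
      fix x y assume "x \<in> ?I" "y \<in> ?I"
      then show "x \<squnion> y \<in> ?I"
        using aB fin_Un by (simp add: meet_join_distrib_right pts_join)
    qed auto
    moreover have "\<top> \<sqinter> a = a" using aB by (metis le_iff_join meet_comm top_closed top_higher)
    then have "\<top> \<notin> ?I" using nfin by simp
    ultimately obtain u where u: "boolean_ultrafilter B u" "u \<inter> ?I = {}"
      using ultrafilter_disjoint_ideal by blast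
    have "bcompl B a \<sqinter> a = \<bottom>" using aB by (simp add: meet_comm meet_bcompl)
    then have "bcompl B a \<in> ?I" using aB by (auto simp: bcompl_closed pts_bottom fin_def)
    then have au: "a \<in> u" using u aB unfolding boolean_ultrafilter_def by blast
    then have "cluster_of u \<in> clusters" using u a unfolding clusters_def by blast
    then obtain p where p: "p \<in> P" "pt p = cluster_of u" using cluster_point by blast
    have "p \<in> pts a"
      using p au ultrafilter_subset_cluster_of[OF u(1)] unfolding pts_def by blast
    then obtain U where U: "U \<in> \<U>" "p \<in> U" using cov by blast
    then obtain c where c: "c \<in> carrier B" "p \<notin> pts c" "P - pts c \<subseteq> U"
      using op[OF U(1)] unfolding openin_cluster_topology by blast
    then obtain b where b: "b \<in> u" "\<not> contact B c b"
      using p unfolding pts_def cluster_of_def by blast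
    have bB: "b \<in> carrier B" using b u unfolding boolean_ultrafilter_def by blast
    have "pts c \<inter> pts b = {}" using contact_pts_iff[OF c(1) bB] b by blast
    then have "pts b \<subseteq> \<Union>{U}" using c(3) pts_subset by blast
    then have "fin (pts b)" unfolding fin_def using U(1) by blast
    moreover have "pts (b \<sqinter> a) \<subseteq> pts b"
      using bB aB by (simp add: meet_left flip: pts_le_iff)
    ultimately have "b \<in> ?I" using bB fin_mono by blast
    then show False using b u by blast
  qed
  then show "\<exists>\<F>. finite \<F> \<and> \<F> \<subseteq> \<U> \<and> pts a \<subseteq> \<Union>\<F>" unfolding fin_def .
qed

text \<open>
  Every point has a bounded neighbourhood, so a compact \<open>pts a\<close> is covered by finitely many bounded
  elements, and \<open>a\<close> is below their join.
\<close>

lemma compactin_pts_imp_bdd: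
  assumes a: "a \<in> carrier B" and comp: "compactin cluster_topology (pts a)"
  shows "a \<in> bdd B"
proof -
  let ?\<U> = "{P - pts (bcompl B k) |k. k \<in> bdd B}"
  have "\<And>U. U \<in> ?\<U> \<Longrightarrow> openin cluster_topology U"
    using openin_co_pts bdd_closed bcompl_closed by blast
  moreover have "pts a \<subseteq> \<Union>?\<U>"
  proof
    fix p assume "p \<in> pts a"
    then have "p \<in> P" using pts_subset by blast
    then show "p \<in> \<Union>?\<U>" by (rule point_bdd_neighbourhood) blast
  qed
  ultimately obtain \<F> where F: "finite \<F>" "\<F> \<subseteq> ?\<U>" "pts a \<subseteq> \<Union>\<F>"
    using comp unfolding compactin_def by meson
  have "\<exists>k\<in>bdd B. \<Union>\<F> \<subseteq> pts k"
    using F(1,2)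
  proof (induction \<F>)
    case empty
    have "\<bottom> \<in> bdd B" using bdd_ideal unfolding boolean_ideal_def by blast
    then show ?case by auto
  next
    case (insert U \<F>)
    then obtain k where k: "k \<in> bdd B" "\<Union>\<F> \<subseteq> pts k" by auto
    obtain j where j: "j \<in> bdd B" "U = P - pts (bcompl B j)" using insert.prems by auto
    have "U \<subseteq> pts j" using j pts_bcompl bdd_closed by blast
    moreover have "j \<squnion> k \<in> bdd B" using j k bdd_ideal unfolding boolean_ideal_def by blast
    moreover have "pts (j \<squnion> k) = pts j \<union> pts k"
      by (intro pts_join bdd_closed j k)
    ultimately show ?case
      using k(2) by (intro bexI[of _ "j \<squnion> k"]) auto
  qed
  then obtain k where k: "k \<in> bdd B" "\<Union>\<F> \<subseteq> pts k" by (rule bexE)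
  then have "a \<sqsubseteq> k"
    using pts_le_iff[OF a bdd_closed[OF k(1)]] order_trans[OF F(3) k(2)] by simp
  then show ?thesis by (rule bdd_downward[OF k(1) a])
qed

lemma Hausdorff_cluster_topology: "Hausdorff_space cluster_topology"
proof -
  have sep: "\<exists>U V. openin cluster_topology U \<and> openin cluster_topology V \<and> p \<in> U \<and> q \<in> V \<and> disjnt U V"
    if p: "p \<in> P" and q: "q \<in> P" and a: "a \<in> pt p" "a \<notin> pt q" for p q a
  proof -
    obtain c where c: "c \<in> carrier B" "bcompl B c \<notin> pt p" "c \<notin> pt q"
      using cluster_separation[OF pt_cluster[OF p] pt_cluster[OF q] a] .
    have "disjnt (P - pts (bcompl B c)) (P - pts c)"
      using pts_bcompl[OF c(1)] by (auto simp: disjnt_def)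
    moreover have "p \<in> P - pts (bcompl B c)" "q \<in> P - pts c"
      using c p q by (auto simp: pts_def)
    ultimately show ?thesis
      using openin_co_pts[OF bcompl_closed[OF c(1)]] openin_co_pts[OF c(1)] by blast
  qed
  show ?thesis
    unfolding Hausdorff_space_def topspace_cluster_topology
  proof (intro allI impI)
    fix p q assume pq: "p \<in> P \<and> q \<in> P \<and> p \<noteq> q"
    then have "pt p \<noteq> pt q" using bij_pt unfolding bij_betw_def inj_on_def by blast
    then consider a where "a \<in> pt p" "a \<notin> pt q" | a where "a \<in> pt q" "a \<notin> pt p" by blast
    then show "\<exists>U V. openin cluster_topology U \<and> openin cluster_topology V \<and> p \<in> U \<and> q \<in> V \<and> disjnt U V"
    proof cases
      case 1
      then show ?thesis using sep pq by blast
    next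
      case 2
      then have "\<exists>U V. openin cluster_topology U \<and> openin cluster_topology V \<and> q \<in> U \<and> p \<in> V \<and> disjnt U V"
        using sep pq by blast
      then show ?thesis using disjnt_sym by blast
    qed
  qed
qed

lemma locally_compact_cluster_topology: "locally_compact_space cluster_topology"
  unfolding locally_compact_space_def topspace_cluster_topology
proof
  fix p assume "p \<in> P"
  then obtain k where k: "k \<in> bdd B" "p \<in> P - pts (bcompl B k)"
    by (rule point_bdd_neighbourhood)
  then show "\<exists>U K. openin cluster_topology U \<and> compactin cluster_topology K \<and> p \<in> U \<and> U \<subseteq> K"
    using openin_co_pts bcompl_closed bdd_closed pts_bcompl compactin_pts by meson
qed

lemma cluster_representation: "local_contact_representation B cluster_topology pts"
proof (intro local_contact_representation.intro contact_representation.intro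
    local_contact_representation_axioms.intro)
  show "partial_order B" by (rule partial_order_axioms)
  show "bij_betw pts (carrier B) (regular_closed_sets cluster_topology)"
    unfolding bij_betw_def
  proof
    show "inj_on pts (carrier B)"
      by (rule inj_onI) (metis le_antisym pts_le_iff subset_refl)
    show "pts ` carrier B = regular_closed_sets cluster_topology"
      using pts_regular_closed regular_closed_is_pts by blast
  qed
  show "bdd B = {a \<in> carrier B. compactin cluster_topology (pts a)}"
    using compactin_pts compactin_pts_imp_bdd bdd_closed by blast
qed (auto simp: pts_le_iff contact_pts_iff Hausdorff_cluster_topology locally_compact_cluster_topology)

end

section \<open>Algebras of spaces and spaces of algebras within the size bound\<close>

text \<open>
  A regular closed set is a set of points, whereas the elements of an algebra in the category are
  taken from the same type as the points; \<open>e\<close> codes the former by the latter.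
\<close>

definition regular_closed_algebra :: "('x set \<Rightarrow> 'u) \<Rightarrow> 'x topology \<Rightarrow> 'u local_contact_struct" where
  "regular_closed_algebra e X =
     (let d = inv_into (regular_closed_sets X) e in
      \<lparr>carrier = e ` regular_closed_sets X, eq = (=), le = (\<lambda>a b. d a \<subseteq> d b),
       contact = (\<lambda>a b. d a \<inter> d b \<noteq> {}), bdd = e ` {F \<in> regular_closed_sets X. compactin X F}\<rparr>)"

lemma regular_closed_algebra_representation:
  assumes "locally_compact_space X" "Hausdorff_space X" and e: "inj_on e (regular_closed_sets X)"
  shows "local_contact_representation (regular_closed_algebra e X) X
    (inv_into (regular_closed_sets X) e)"
proof -
  let ?A = "regular_closed_algebra e X" and ?d = "inv_into (regular_closed_sets X) e"
  note simps = regular_closed_algebra_def Let_def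
  show ?thesis
  proof (intro local_contact_representation.intro contact_representation.intro
      local_contact_representation_axioms.intro)
    show "partial_order ?A"
      by unfold_locales (auto simp: simps inv_into_f_f[OF e])
    show "bij_betw ?d (carrier ?A) (regular_closed_sets X)"
      using bij_betw_inv_into[OF inj_on_imp_bij_betw[OF e]] by (simp add: simps)
    show "bdd ?A = {a \<in> carrier ?A. compactin X (?d a)}"
      by (auto simp: simps inv_into_f_f[OF e])
  qed (use assms in \<open>simp_all add: simps\<close>)
qed

lemma representation_card:
  assumes "contact_representation A X h"
  shows "|carrier A| =o |regular_closed_sets X|"
  using contact_representation.bij_h[OF assms] by (rule card_of_ordIsoI)

lemma size_bound_inj:
  fixes \<kappa> :: "'u rel"
  assumes "size_bound \<kappa>" "|S| <o \<kappa>"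
  obtains e :: "'x \<Rightarrow> 'u" where "inj_on e S"
proof -
  have "|S| \<le>o |Field \<kappa>|"
    using assms unfolding size_bound_def
    by (meson card_of_Field_ordIso ordIso_symmetric ordLeq_ordIso_trans ordLess_imp_ordLeq)
  then show thesis using that unfolding card_of_ordLeq[symmetric] by blast
qed

text \<open>
  A cluster is a set of elements of \<open>A\<close>, so the size bound provides enough points for the space of
  clusters.
\<close>

lemma ex_representing_space:
  fixes \<kappa> :: "'u rel" and A :: "'u local_contact_struct"
  assumes \<kappa>: "size_bound \<kappa>" and A: "local_contact_algebra A" "complete_lattice A" "|carrier A| <o \<kappa>"
  shows "\<exists>(X :: 'u topology) h. local_contact_representation A X h"
proof -
  interpret local_contact_algebra A by fact
  have "|Pow (carrier A)| \<le>o |UNIV :: 'u set|"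
    using \<kappa> A(3) unfolding size_bound_def by blast
  then obtain r :: "'u set \<Rightarrow> 'u" where "inj_on r (Pow (carrier A))"
    unfolding card_of_ordLeq[symmetric] by blast
  moreover have "clusters \<subseteq> Pow (carrier A)"
    using cluster_closed by blast
  ultimately have "inj_on r clusters" by (rule inj_on_subset)
  then have "bij_betw (inv_into clusters r) (r ` clusters) clusters"
    by (intro bij_betw_inv_into inj_on_imp_bij_betw)
  then have "cluster_space A (r ` clusters) (inv_into clusters r)"
    using A by (intro cluster_space.intro cluster_space_axioms.intro)
  then show ?thesis using cluster_space.cluster_representation by blast
qed

section \<open>The categories of spaces\<close>

lemma compose_on_topspace:
  assumes "continuous_map X Y f" "continuous_map Y Z g"
  shows "continuous_map X Z (compose (topspace X) g f)"
    and "open_map X Y f \<Longrightarrow> open_map Y Z g \<Longrightarrow> open_map X Z (compose (topspace X) g f)"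
    and "proper_map X Y f \<Longrightarrow> proper_map Y Z g \<Longrightarrow> proper_map X Z (compose (topspace X) g f)"
proof -
  have eq: "compose (topspace X) g f x = (g \<circ> f) x" if "x \<in> topspace X" for x
    using that by (simp add: compose_def)
  show "continuous_map X Z (compose (topspace X) g f)"
    by (rule continuous_map_eq[OF continuous_map_compose[OF assms]]) (simp add: eq)
  show "open_map X Y f \<Longrightarrow> open_map Y Z g \<Longrightarrow> open_map X Z (compose (topspace X) g f)"
    by (rule open_map_eq[OF open_map_compose[of X Y f Z g]]) (simp_all add: eq)
  show "proper_map X Y f \<Longrightarrow> proper_map Y Z g \<Longrightarrow> proper_map X Z (compose (topspace X) g f)"
    by (rule proper_map_eq[OF proper_map_compose[of X Y f Z g]]) (simp_all add: eq)
qed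

lemma ident_on_topspace:
  "continuous_map X X (\<lambda>x\<in>topspace X. x)" "open_map X X (\<lambda>x\<in>topspace X. x)"
  "proper_map X X (\<lambda>x\<in>topspace X. x)"
proof -
  show "continuous_map X X (\<lambda>x\<in>topspace X. x)"
    by (rule continuous_map_eq[OF continuous_map_id]) simp
  show "open_map X X (\<lambda>x\<in>topspace X. x)"
    by (rule open_map_eq[OF open_map_id]) simp
  show "proper_map X X (\<lambda>x\<in>topspace X. x)"
    by (rule proper_map_eq[OF proper_map_id]) simp
qed

lemma is_category_of_spaces:
  assumes "\<And>X. P X X (\<lambda>x\<in>topspace X. x)"
    and "\<And>X Y Z f g. \<lbrakk>P X Y f; P Y Z g\<rbrakk> \<Longrightarrow> P X Z (compose (topspace X) g f)"
    and "\<And>X Y f. P X Y f \<Longrightarrow> f \<in> topspace X \<rightarrow> topspace Y"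
  shows "is_category \<lparr>obj = S, hom_set = (\<lambda>X Y. {f \<in> extensional (topspace X). P X Y f}),
      idm = (\<lambda>X. \<lambda>x\<in>topspace X. x), cmp = (\<lambda>X Y Z g f. compose (topspace X) g f)\<rparr>"
  unfolding is_category_def category_data.simps
proof (intro conjI ballI)
  fix X Y f assume "X \<in> S" "Y \<in> S" "f \<in> {f \<in> extensional (topspace X). P X Y f}"
  then show "compose (topspace X) f (\<lambda>x\<in>topspace X. x) = f"
      "compose (topspace X) (\<lambda>x\<in>topspace Y. x) f = f"
    using assms(3)[of X Y f] compose_Id[of f] Id_compose[of f] by auto
next
  fix W X Y Z f g h
  assume "f \<in> {f \<in> extensional (topspace W). P W X f}"
  then show "compose (topspace W) (compose (topspace X) h g) f =
      compose (topspace W) h (compose (topspace W) g f)"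
    using assms(3)[of W X f] compose_assoc[of f "topspace W" "topspace X" h g] by simp
qed (use assms in auto)

lemma is_category_OpPerLCCon: "is_category (OpPerLCCon \<kappa>)"
  unfolding OpPerLCCon_def
  by (rule is_category_of_spaces)
    (auto simp: ident_on_topspace compose_on_topspace dest: continuous_map_funspace)

lemma is_category_OpCCon: "is_category (OpCCon \<kappa>)"
  unfolding OpCCon_def
  by (rule is_category_of_spaces)
    (auto simp: ident_on_topspace compose_on_topspace dest: continuous_map_funspace)

section \<open>Normal contact algebras as local contact algebras\<close>

definition all_bounded :: "('a, 'c) contact_struct_scheme \<Rightarrow> 'a local_contact_struct" where
  "all_bounded A = \<lparr>carrier = carrier A, eq = eq A, le = le A, contact = contact A, bdd = carrier A\<rparr>"

lemma all_bounded_simps [simp]: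
  "carrier (all_bounded A) = carrier A" "eq (all_bounded A) = eq A" "le (all_bounded A) = le A"
  "contact (all_bounded A) = contact A" "bdd (all_bounded A) = carrier A"
  by (simp_all add: all_bounded_def)

lemma least_all_bounded [simp]: "least (all_bounded A) = least A"
  and greatest_all_bounded [simp]: "greatest (all_bounded A) = greatest A"
  and Upper_all_bounded [simp]: "Upper (all_bounded A) = Upper A"
  and Lower_all_bounded [simp]: "Lower (all_bounded A) = Lower A"
  by (simp_all add: fun_eq_iff least_def greatest_def Upper_def Lower_def)

lemma all_bounded_operations [simp]:
  "\<Squnion>\<^bsub>all_bounded A\<^esub>S = \<Squnion>\<^bsub>A\<^esub>S" "\<Sqinter>\<^bsub>all_bounded A\<^esub>S = \<Sqinter>\<^bsub>A\<^esub>S"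
  "\<bottom>\<^bsub>all_bounded A\<^esub> = \<bottom>\<^bsub>A\<^esub>" "\<top>\<^bsub>all_bounded A\<^esub> = \<top>\<^bsub>A\<^esub>"
  by (simp_all add: sup_def inf_def bottom_def top_def)

lemma all_bounded_binary_operations [simp]:
  "x \<squnion>\<^bsub>all_bounded A\<^esub> y = x \<squnion>\<^bsub>A\<^esub> y" "x \<sqinter>\<^bsub>all_bounded A\<^esub> y = x \<sqinter>\<^bsub>A\<^esub> y"
  "bcompl (all_bounded A) x = bcompl A x"
  by (simp_all add: join_def meet_def bcompl_def)

lemma complete_boolean_hom_all_bounded:
  "complete_boolean_hom (all_bounded A) (all_bounded B) \<phi> \<longleftrightarrow> complete_boolean_hom A B \<phi>"
  by (simp add: complete_boolean_hom_def boolean_hom_def)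

lemma left_adjoint_all_bounded:
  "left_adjoint (all_bounded A) (all_bounded B) \<phi> = left_adjoint A B \<phi>"
  by (simp add: fun_eq_iff left_adjoint_def)

lemma partial_order_all_bounded: "partial_order (all_bounded A) \<longleftrightarrow> partial_order A"
  by (simp add: partial_order_def partial_order_axioms_def weak_partial_order_def
      weak_partial_order_axioms_def equivalence_def)

lemma complete_lattice_all_bounded: "complete_lattice (all_bounded A) \<longleftrightarrow> complete_lattice A"
  by (simp add: complete_lattice_def complete_lattice_axioms_def partial_order_all_bounded)

lemma boolean_lattice_all_bounded: "boolean_lattice (all_bounded A) \<longleftrightarrow> boolean_lattice A"
  by (simp add: boolean_lattice_def boolean_lattice_axioms_def bounded_lattice_def
      Lattice.lattice_def upper_semilattice_def upper_semilattice_axioms_def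
      lower_semilattice_def lower_semilattice_axioms_def partial_order_all_bounded
      weak_partial_order_bottom_def weak_partial_order_bottom_axioms_def
      weak_partial_order_top_def weak_partial_order_top_axioms_def
      weak_partial_order_def weak_partial_order_axioms_def equivalence_def)

lemma contact_algebra_all_bounded: "contact_algebra (all_bounded A) \<longleftrightarrow> contact_algebra A"
  by (simp add: contact_algebra_def contact_algebra_axioms_def boolean_lattice_all_bounded)

lemma connected_contact_all_bounded: "connected_contact (all_bounded A) \<longleftrightarrow> connected_contact A"
  by (simp add: connected_contact_def)

text \<open>
  If everything is bounded, (BC2) is trivial, and (BC1) and (BC3) are (C5) and (C6) after replacing
  an element by its complement.
\<close>

lemma local_contact_algebra_all_bounded:
  "local_contact_algebra (all_bounded A) \<longleftrightarrow> normal_contact_algebra A"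
proof
  assume "normal_contact_algebra A"
  then interpret normal_contact_algebra A .
  show "local_contact_algebra (all_bounded A)"
  proof (intro local_contact_algebra.intro local_contact_algebra_axioms.intro)
    show "contact_algebra (all_bounded A)"
      unfolding contact_algebra_all_bounded by (rule contact_algebra_axioms)
    show "boolean_ideal (all_bounded A) (bdd (all_bounded A))"
      by (auto simp: boolean_ideal_def)
  next
    fix a c assume "a \<in> bdd (all_bounded A)" "c \<in> carrier (all_bounded A)" "well_inside (all_bounded A) a c"
    then have ac: "a \<in> carrier A" "c \<in> carrier A" "\<not> contact A a (bcompl A c)"
      by (simp_all add: well_inside_def)
    then obtain d where "d \<in> carrier A" "\<not> contact A a d" "\<not> contact A (bcompl A c) (bcompl A d)"
      using C5[of a "bcompl A c"] bcompl_closed by blast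
    then show "\<exists>b\<in>bdd (all_bounded A). well_inside (all_bounded A) a b \<and> well_inside (all_bounded A) b c"
      using ac C3[of "bcompl A d" "bcompl A c"]
      by (intro bexI[of _ "bcompl A d"]) (auto simp: well_inside_def bcompl_bcompl bcompl_closed)
  next
    fix a b assume "a \<in> carrier (all_bounded A)" "b \<in> carrier (all_bounded A)" "contact (all_bounded A) a b"
    moreover from this have "\<top>\<^bsub>A\<^esub> \<sqinter>\<^bsub>A\<^esub> b = b"
      by (metis all_bounded_simps(1) le_iff_join meet_comm top_closed top_higher)
    ultimately show "\<exists>c\<in>bdd (all_bounded A). contact (all_bounded A) a (c \<sqinter>\<^bsub>all_bounded A\<^esub> b)"
      by (intro bexI[of _ "\<top>\<^bsub>A\<^esub>"]) auto
  next
    fix a assume a: "a \<in> carrier (all_bounded A)" "a \<noteq> \<bottom>\<^bsub>all_bounded A\<^esub>"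
    then have "bcompl A a \<noteq> \<top>\<^bsub>A\<^esub>"
      using bcompl_bcompl[of a] bcompl_top by auto
    then show "\<exists>b\<in>bdd (all_bounded A) - {\<bottom>\<^bsub>all_bounded A\<^esub>}. well_inside (all_bounded A) b a"
      using C6[of "bcompl A a"] a bcompl_closed by (auto simp: well_inside_def)
  qed
next
  assume "local_contact_algebra (all_bounded A)"
  then interpret L: local_contact_algebra "all_bounded A" .
  interpret contact_algebra A
    using L.contact_algebra_axioms by (simp add: contact_algebra_all_bounded)
  show "normal_contact_algebra A"
  proof
    fix a b assume ab: "a \<in> carrier A" "b \<in> carrier A" "\<not> contact A a b"
    then obtain c where c: "c \<in> carrier A" "\<not> contact A a (bcompl A c)" "\<not> contact A c b"
      using L.bdd_interpolation[of a b] by auto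
    then show "\<exists>c\<in>carrier A. \<not> contact A a c \<and> \<not> contact A b (bcompl A c)"
      using ab C3[of b c]
      by (intro bexI[of _ "bcompl A c"]) (auto simp: bcompl_bcompl bcompl_closed)
  next
    fix a assume a: "a \<in> carrier A" "a \<noteq> \<top>\<^bsub>A\<^esub>"
    then have "bcompl A a \<noteq> \<bottom>\<^bsub>A\<^esub>"
      using bcompl_bcompl[of a] bcompl_bottom by auto
    then show "\<exists>b\<in>carrier A. b \<noteq> \<bottom>\<^bsub>A\<^esub> \<and> \<not> contact A b a"
      using L.BC3[of "bcompl A a"] a by (auto simp: well_inside_def bcompl_closed bcompl_bcompl)
  qed
qed

section \<open>The duality theorem\<close>

lemma ex_represented_algebra:
  fixes \<kappa> :: "'u rel" and X :: "'u topology"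
  assumes "size_bound \<kappa>" "|regular_closed_sets X| <o \<kappa>" "locally_compact_space X" "Hausdorff_space X"
  shows "\<exists>(A :: 'u local_contact_struct) h. local_contact_representation A X h \<and> |carrier A| <o \<kappa>"
proof -
  obtain e :: "'u set \<Rightarrow> 'u" where e: "inj_on e (regular_closed_sets X)"
    using size_bound_inj[OF assms(1,2)] .
  have rep: "local_contact_representation (regular_closed_algebra e X) X
      (inv_into (regular_closed_sets X) e)"
    by (rule regular_closed_algebra_representation[OF assms(3,4) e])
  then have "|carrier (regular_closed_algebra e X)| =o |regular_closed_sets X|"
    by (intro representation_card) (rule local_contact_representation.axioms)
  then show ?thesis using rep assms(2) ordIso_ordLess_trans by blast
qed

lemma local_duality:
  fixes \<kappa> :: "'u rel"
  assumes \<kappa>: "size_bound \<kappa>"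
  shows "dually_equivalent (OpPerLCCon \<kappa>) (DOpPerLCCon \<kappa>)"
proof (rule dually_equivalentI_representation[where
      Rep = "\<lambda>X (A :: 'u local_contact_struct) h. local_contact_representation A X h" and
      \<Phi> = "\<lambda>X A h Y B k. preimage_hom A h B Y k"])
  show "is_category (OpPerLCCon \<kappa>)" by (rule is_category_OpPerLCCon)
next
  fix X assume X: "X \<in> obj (OpPerLCCon \<kappa>)"
  then have "locally_compact_space X" "Hausdorff_space X" "|regular_closed_sets X| <o \<kappa>"
    by (auto simp: OpPerLCCon_def)
  then obtain A :: "'u local_contact_struct" and h
    where A: "local_contact_representation A X h" "|carrier A| <o \<kappa>"
    using ex_represented_algebra[OF \<kappa>] by blast
  interpret local_contact_representation A X h by fact
  have "A \<in> obj (DOpPerLCCon \<kappa>)"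
    using X A(2) is_local_contact_algebra is_complete_lattice connected_iff
    by (simp add: DOpPerLCCon_def OpPerLCCon_def)
  then show "\<exists>A\<in>obj (DOpPerLCCon \<kappa>). \<exists>h. local_contact_representation A X h"
    using A(1) by blast
next
  fix A assume A: "A \<in> obj (DOpPerLCCon \<kappa>)"
  then have A': "local_contact_algebra A" "complete_lattice A" "|carrier A| <o \<kappa>"
    by (auto simp: DOpPerLCCon_def)
  then obtain X :: "'u topology" and h where X: "local_contact_representation A X h"
    using ex_representing_space[OF \<kappa>] by blast
  interpret local_contact_representation A X h by fact
  have "|regular_closed_sets X| <o \<kappa>"
    using A' representation_card[OF contact_representation_axioms] ordIso_symmetric
      ordIso_ordLess_trans by blast
  then have "X \<in> obj (OpPerLCCon \<kappa>)"
    using A connected_iff locally_compact Hausdorff by (simp add: DOpPerLCCon_def OpPerLCCon_def)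
  then show "\<exists>X\<in>obj (OpPerLCCon \<kappa>). \<exists>h. local_contact_representation A X h"
    using X by blast
next
  fix X :: "'u topology" and A :: "'u local_contact_struct" and h and Y :: "'u topology" and B :: "'u local_contact_struct" and k
  assume "local_contact_representation A X h" "local_contact_representation B Y k"
  then interpret representation_pair A X h B Y k by (rule representation_pair.intro)
  show "bij_betw (preimage_hom A h B Y k) (hom_set (OpPerLCCon \<kappa>) Y X) (hom_set (DOpPerLCCon \<kappa>) A B)"
    using dual_bij_betw
    by (simp add: OpPerLCCon_def DOpPerLCCon_def open_perfect_map_def local_contact_hom_def)
next
  fix X :: "'u topology" and A :: "'u local_contact_struct" and h
  assume "local_contact_representation A X h"
  then interpret local_contact_representation A X h .
  show "preimage_hom A h A X h (idm (OpPerLCCon \<kappa>) X) = idm (DOpPerLCCon \<kappa>) A"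
    using preimage_hom_ident by (simp add: OpPerLCCon_def DOpPerLCCon_def)
next
  fix X :: "'u topology" and A :: "'u local_contact_struct" and h and Y :: "'u topology" and B :: "'u local_contact_struct" and k
    and Z :: "'u topology" and E :: "'u local_contact_struct" and l f g
  assume r: "local_contact_representation A X h" "local_contact_representation B Y k"
    "local_contact_representation E Z l"
    and m: "f \<in> hom_set (OpPerLCCon \<kappa>) Y X" "g \<in> hom_set (OpPerLCCon \<kappa>) Z Y"
  show "preimage_hom A h E Z l (cmp (OpPerLCCon \<kappa>) Z Y X f g) =
      cmp (DOpPerLCCon \<kappa>) A B E (preimage_hom B k E Z l g) (preimage_hom A h B Y k f)"
    using preimage_hom_compose[of A X h B Y k E Z l f g] r m
    by (simp add: OpPerLCCon_def DOpPerLCCon_def representation_pair_def open_perfect_map_def)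
qed

lemma preimage_hom_all_bounded:
  "preimage_hom (all_bounded A) h (all_bounded B) Y k = preimage_hom A h B Y k"
  by (simp add: fun_eq_iff preimage_hom_def)

lemma compact_representation_iff:
  assumes "local_contact_representation A X h"
  shows "compact_space X \<longleftrightarrow> bdd A = carrier A"
proof -
  interpret local_contact_representation A X h by fact
  show ?thesis
  proof
    assume X: "compact_space X"
    then show "bdd A = carrier A"
      unfolding bdd_eq using h_regular regular_closed_closedin closedin_compact_space by blast
  next
    assume "bdd A = carrier A"
    then have "compactin X (h \<top>\<^bsub>A\<^esub>)" using bdd_eq top_closed by blast
    then show "compact_space X" by (simp add: h_top compact_space_def)
  qed
qed

lemma compact_duality:
  fixes \<kappa> :: "'u rel"
  assumes \<kappa>: "size_bound \<kappa>"
  shows "dually_equivalent (OpCCon \<kappa>) (DOpCCon \<kappa>)"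
proof (rule dually_equivalentI_representation[where
      Rep = "\<lambda>X (A :: 'u contact_struct) h. local_contact_representation (all_bounded A) X h" and
      \<Phi> = "\<lambda>X A h Y B k. preimage_hom A h B Y k"])
  show "is_category (OpCCon \<kappa>)" by (rule is_category_OpCCon)
next
  fix X assume X: "X \<in> obj (OpCCon \<kappa>)"
  then have "locally_compact_space X" "Hausdorff_space X" "|regular_closed_sets X| <o \<kappa>"
    by (auto simp: OpCCon_def compact_imp_locally_compact_space)
  then obtain A' :: "'u local_contact_struct" and h
    where A': "local_contact_representation A' X h" "|carrier A'| <o \<kappa>"
    using ex_represented_algebra[OF \<kappa>] by blast
  define A where "A = \<lparr>carrier = carrier A', eq = eq A', le = le A', contact = contact A'\<rparr>"
  have "bdd A' = carrier A'"
    using compact_representation_iff[OF A'(1)] X by (simp add: OpCCon_def)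
  then have A: "all_bounded A = A'"
    by (simp add: all_bounded_def A_def)
  interpret local_contact_representation "all_bounded A" X h unfolding A by fact
  have "A \<in> obj (DOpCCon \<kappa>)"
    using X A'(2) is_local_contact_algebra is_complete_lattice connected_iff
    by (simp add: DOpCCon_def OpCCon_def local_contact_algebra_all_bounded
        complete_lattice_all_bounded connected_contact_all_bounded flip: A)
  then show "\<exists>A\<in>obj (DOpCCon \<kappa>). \<exists>h. local_contact_representation (all_bounded A) X h"
    using A A'(1) by blast
next
  fix A assume A: "A \<in> obj (DOpCCon \<kappa>)"
  then have A': "local_contact_algebra (all_bounded A)" "complete_lattice (all_bounded A)"
      "connected_contact (all_bounded A)" "|carrier (all_bounded A)| <o \<kappa>"
    by (auto simp: DOpCCon_def local_contact_algebra_all_bounded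
        complete_lattice_all_bounded connected_contact_all_bounded)
  then obtain X :: "'u topology" and h where X: "local_contact_representation (all_bounded A) X h"
    using ex_representing_space[OF \<kappa>] by blast
  interpret local_contact_representation "all_bounded A" X h by fact
  have "|regular_closed_sets X| <o \<kappa>"
    using A'(4) representation_card[OF contact_representation_axioms] ordIso_symmetric
      ordIso_ordLess_trans by blast
  then have "X \<in> obj (OpCCon \<kappa>)"
    using A' connected_iff Hausdorff compact_representation_iff[OF X] by (simp add: OpCCon_def)
  then show "\<exists>X\<in>obj (OpCCon \<kappa>). \<exists>h. local_contact_representation (all_bounded A) X h"
    using X by blast
next
  fix X :: "'u topology" and A :: "'u contact_struct" and h and Y :: "'u topology" and B :: "'u contact_struct" and k
  assume o: "X \<in> obj (OpCCon \<kappa>)" "Y \<in> obj (OpCCon \<kappa>)"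
    and r: "local_contact_representation (all_bounded A) X h"
      "local_contact_representation (all_bounded B) Y k"
  interpret representation_pair "all_bounded A" X h "all_bounded B" Y k
    using r by (rule representation_pair.intro)
  have "open_perfect_map Y X f \<longleftrightarrow> continuous_map Y X f \<and> open_map Y X f" for f
    using o continuous_imp_proper_map[of Y X f] Hausdorff_imp_kc_space[of X]
    by (auto simp: open_perfect_map_def OpCCon_def)
  then have C: "{f \<in> extensional (topspace Y). open_perfect_map Y X f} = hom_set (OpCCon \<kappa>) Y X"
    by (simp add: OpCCon_def)
  have "local_contact_hom (all_bounded A) (all_bounded B) \<phi> \<longleftrightarrow>
      complete_boolean_hom A B \<phi> \<and>
        (\<forall>a\<in>carrier A. \<forall>b\<in>carrier A. contact B (\<phi> a) (\<phi> b) \<longrightarrow> contact A a b) \<and>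
        (\<forall>a\<in>carrier A. \<forall>b\<in>carrier B.
           contact A a (left_adjoint A B \<phi> b) \<longrightarrow> contact B (\<phi> a) b)" for \<phi>
  proof (cases "complete_boolean_hom A B \<phi>")
    case True
    have symA: "contact A a b \<longleftrightarrow> contact A b a" if "a \<in> carrier A" "b \<in> carrier A" for a b
      using A.contact_iff[of a b] A.contact_iff[of b a] that by (simp add: Int_commute)
    have symB: "contact B a b \<longleftrightarrow> contact B b a" if "a \<in> carrier B" "b \<in> carrier B" for a b
      using B.contact_iff[of a b] B.contact_iff[of b a] that by (simp add: Int_commute)
    have adj: "left_adjoint A B \<phi> b \<in> carrier A" if "b \<in> carrier B" for b
      using left_adjoint(1)[OF A.is_complete_lattice B.is_complete_lattice, of \<phi> b] that True
      by (simp add: complete_boolean_hom_all_bounded left_adjoint_all_bounded)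
    have \<phi>: "\<phi> a \<in> carrier B" if "a \<in> carrier A" for a
      using True that unfolding complete_boolean_hom_def boolean_hom_def by blast
    have "(\<forall>a\<in>carrier A. \<forall>b\<in>carrier B. contact A (left_adjoint A B \<phi> b) a \<longrightarrow> contact B b (\<phi> a)) \<longleftrightarrow>
      (\<forall>a\<in>carrier A. \<forall>b\<in>carrier B. contact A a (left_adjoint A B \<phi> b) \<longrightarrow> contact B (\<phi> a) b)"
      using symA adj symB \<phi> by metis
    then show ?thesis
      using True adj \<phi> by (simp add: local_contact_hom_def complete_boolean_hom_all_bounded
          left_adjoint_all_bounded)
  qed (simp add: local_contact_hom_def complete_boolean_hom_all_bounded)
  then have D: "{\<phi> \<in> extensional (carrier A). local_contact_hom (all_bounded A) (all_bounded B) \<phi>} =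
      hom_set (DOpCCon \<kappa>) A B"
    by (simp add: DOpCCon_def)
  show "bij_betw (preimage_hom A h B Y k) (hom_set (OpCCon \<kappa>) Y X) (hom_set (DOpCCon \<kappa>) A B)"
    using dual_bij_betw unfolding C preimage_hom_all_bounded by (simp add: D)
next
  fix X :: "'u topology" and A :: "'u contact_struct" and h
  assume "local_contact_representation (all_bounded A) X h"
  then interpret local_contact_representation "all_bounded A" X h .
  show "preimage_hom A h A X h (idm (OpCCon \<kappa>) X) = idm (DOpCCon \<kappa>) A"
    using preimage_hom_ident by (simp add: OpCCon_def DOpCCon_def preimage_hom_all_bounded)
next
  fix X :: "'u topology" and A :: "'u contact_struct" and h and Y :: "'u topology" and B :: "'u contact_struct" and k
    and Z :: "'u topology" and E :: "'u contact_struct" and l f g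
  assume o: "X \<in> obj (OpCCon \<kappa>)" "Y \<in> obj (OpCCon \<kappa>)" "Z \<in> obj (OpCCon \<kappa>)"
    and r: "local_contact_representation (all_bounded A) X h"
      "local_contact_representation (all_bounded B) Y k"
      "local_contact_representation (all_bounded E) Z l"
    and m: "f \<in> hom_set (OpCCon \<kappa>) Y X" "g \<in> hom_set (OpCCon \<kappa>) Z Y"
  have "open_perfect_map Y X f" "open_perfect_map Z Y g"
    using o m continuous_imp_proper_map Hausdorff_imp_kc_space
    by (auto simp: open_perfect_map_def OpCCon_def)
  then show "preimage_hom A h E Z l (cmp (OpCCon \<kappa>) Z Y X f g) =
      cmp (DOpCCon \<kappa>) A B E (preimage_hom B k E Z l g) (preimage_hom A h B Y k f)"
    using preimage_hom_compose[of "all_bounded A" X h "all_bounded B" Y k "all_bounded E" Z l f g] r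
    by (simp add: OpCCon_def DOpCCon_def representation_pair_def preimage_hom_all_bounded)
qed

theorem theorem3p3:
  fixes \<kappa> :: "'u rel"
  assumes "size_bound \<kappa>"
  shows "dually_equivalent (OpPerLCCon \<kappa>) (DOpPerLCCon \<kappa>) \<and>
         dually_equivalent (OpCCon \<kappa>) (DOpCCon \<kappa>)"
  using local_duality[OF assms] compact_duality[OF assms] by blast

end
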